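(* Let $2\le m\le n$ be integers, $\mathcal{H}=\mathbb{C}^2\otimes\mathbb{C}^m\otimes\mathbb{C}^n$ and $G=SL(2,\mathbb{C})\times SL(m,\mathbb{C})\times SL(n,\mathbb{C})$ acting by $A\otimes B\otimes C$. There exist strictly semistable states in $\mathbb{P}(\mathcal{H})$ if and only if $m=n\ge 4$.
   Context: The null-cone $\mathcal{N}$ is the set of vectors $|\psi\rangle$ with $0\in\overline{G|\psi\rangle}$ (standard topology); vectors outside $\mathcal{N}$ are semistable. A semistable vector is polystable if its orbit $G|\psi\rangle$ is closed in $\mathcal{H}$, and strictly semistable if it is semistable but not polystable. A state $[\psi]$ is strictly semistable if $|\psi\rangle$ is. *)

theory Defs
  imports "HOL-Analysis.Analysis" "Jordan_Normal_Form.Determinant"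
begin

text \<open>Tensors in C^2 (x) C^m (x) C^n, represented as coordinate functions
  psi i j k, vanishing outside the index box {0..<2} x {0..<m} x {0..<n}.
  The topology is the product topology on functions, which restricted to the
  (closed) finite-dimensional coordinate subspace is the standard topology.\<close>

type_synonym tensor3 = "nat \<Rightarrow> nat \<Rightarrow> nat \<Rightarrow> complex"

definition tens :: "nat \<Rightarrow> nat \<Rightarrow> tensor3 set" where
  "tens m n = {\<psi>. \<forall>i j k. \<psi> i j k \<noteq> 0 \<longrightarrow> i < 2 \<and> j < m \<and> k < n}"

definition SLgrp :: "nat \<Rightarrow> nat \<Rightarrow> (complex mat \<times> complex mat \<times> complex mat) set" where
  "SLgrp m n = {(A, B, C). A \<in> carrier_mat 2 2 \<and> det A = 1 \<and>
                          B \<in> carrier_mat m m \<and> det B = 1 \<and>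
                          C \<in> carrier_mat n n \<and> det C = 1}"

definition act :: "nat \<Rightarrow> nat \<Rightarrow> complex mat \<times> complex mat \<times> complex mat \<Rightarrow> tensor3 \<Rightarrow> tensor3" where
  "act m n g \<psi> = (case g of (A, B, C) \<Rightarrow>
     (\<lambda>i j k. if i < 2 \<and> j < m \<and> k < n then
        (\<Sum>a<2. \<Sum>b<m. \<Sum>c<n. A $$ (i, a) * B $$ (j, b) * C $$ (k, c) * \<psi> a b c)
      else 0))"

definition orbit :: "nat \<Rightarrow> nat \<Rightarrow> tensor3 \<Rightarrow> tensor3 set" where
  "orbit m n \<psi> = (\<lambda>g. act m n g \<psi>) ` SLgrp m n"

definition nullcone :: "nat \<Rightarrow> nat \<Rightarrow> tensor3 set" where
  "nullcone m n = {\<psi> \<in> tens m n. (\<lambda>i j k. 0) \<in> closure (orbit m n \<psi>)}"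

definition semistable :: "nat \<Rightarrow> nat \<Rightarrow> tensor3 \<Rightarrow> bool" where
  "semistable m n \<psi> \<longleftrightarrow> \<psi> \<in> tens m n \<and> \<psi> \<notin> nullcone m n"

definition polystable :: "nat \<Rightarrow> nat \<Rightarrow> tensor3 \<Rightarrow> bool" where
  "polystable m n \<psi> \<longleftrightarrow> semistable m n \<psi> \<and> closed (orbit m n \<psi>)"

definition strictly_semistable :: "nat \<Rightarrow> nat \<Rightarrow> tensor3 \<Rightarrow> bool" where
  "strictly_semistable m n \<psi> \<longleftrightarrow> semistable m n \<psi> \<and> \<not> polystable m n \<psi>"

end

theory Submission
  imports Defs "Jordan_Normal_Form.Jordan_Normal_Form_Existence"
begin

text \<open>A tensor is a pencil \<open>x M0 + y M1\<close> of \<open>m\<times>n\<close> matrices. If \<open>m < n\<close>, a kernel vector of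
  minimal degree in \<open>\<complex>[t]\<^sup>n\<close> spans a destabilising pair of subspaces unless its degree is
  \<open>m / (n - m)\<close>; in the remaining case the pencil is equivalent to a direct sum of equal Kronecker
  blocks, so all semistable tensors form a single orbit up to scalars. For \<open>m = n \<le> 3\<close> semistability
  forces \<open>det (x M0 + y M1)\<close> to have distinct roots, and again there is a single orbit up to
  scalars. A homogeneous invariant of degree \<open>N\<close> then shows that a limit of the orbit is
  \<open>\<zeta>\<close> times an orbit point with \<open>\<zeta>^N = 1\<close>, and multiplication by such a \<open>\<zeta>\<close> preserves the orbit.
  For \<open>m = n \<ge> 4\<close> a pencil with determinant \<open>x^k y^k (x + y)^(n - 2k)\<close>, \<open>k = n div 2\<close>, and
  nontrivial Jordan blocks is semistable but degenerates to its diagonal part.\<close>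

unbundle no vec_syntax
hide_const (open) Determinants.det Finite_Cartesian_Product.vec Finite_Cartesian_Product.row Finite_Cartesian_Product.column
hide_fact (open) Determinants.det_2 Determinants.det_transpose Determinants.det_def
hide_type (open) Finite_Cartesian_Product.vec

text \<open>Instability is always exhibited by an explicit diagonal one-parameter subgroup, and
  semistability of the witness by an explicit lower bound along its orbit, so only the elementary
  direction of the Hilbert-Mumford criterion enters. The threshold 4 comes from Jordan blocks:
  semistability limits the roots of the determinant to multiplicity at most n/2, while a nontrivial
  block needs multiplicity at least 2. For m < n the invariant is the determinant of multiplication
  by the pencil, from vectors of degree below k to vectors of degree at most k; these spaces have
  equal dimension because k n = (k + 1) m. The obstacle is its invariance under the first factor,
  which mixes degrees. This is not computed: the normal form is reached without using the first
  factor, so that factor changes the determinant by a character of SL2, and such characters are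
  trivial. For n = 2 and n = 3 the discriminant of the determinant serves instead. That the diagonal
  limit leaves the orbit for n >= 4 is seen from kernels: it has a slice with kernel of dimension at
  least 2, which no nonzero member of the witness pencil has.\<close>

definition slice :: "nat \<Rightarrow> nat \<Rightarrow> tensor3 \<Rightarrow> nat \<Rightarrow> complex mat" where
  "slice m n \<psi> i = mat m n (\<lambda>(r, c). \<psi> i r c)"

definition pencil :: "nat \<Rightarrow> nat \<Rightarrow> complex mat \<Rightarrow> complex mat \<Rightarrow> tensor3" where
  "pencil m n M0 M1 = (\<lambda>i r c. if i < 2 \<and> r < m \<and> c < n then (if i = 0 then M0 else M1) $$ (r, c) else 0)"

lemma slice_carrier [simp]: "slice m n \<psi> i \<in> carrier_mat m n"
  "dim_row (slice m n \<psi> i) = m" "dim_col (slice m n \<psi> i) = n"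
  by (auto simp: slice_def)

lemma slice_index [simp]: "r < m \<Longrightarrow> c < n \<Longrightarrow> slice m n \<psi> i $$ (r, c) = \<psi> i r c"
  by (simp add: slice_def)

lemma pencil_tens [simp]: "pencil m n M0 M1 \<in> tens m n"
  by (auto simp: tens_def pencil_def)

lemma slice_pencil:
  assumes "M0 \<in> carrier_mat m n" "M1 \<in> carrier_mat m n"
  shows "slice m n (pencil m n M0 M1) 0 = M0" "slice m n (pencil m n M0 M1) (Suc 0) = M1"
  using assms by (auto simp: slice_def pencil_def intro!: eq_matI)

lemma tens_eqI:
  assumes "\<phi> \<in> tens m n" "\<psi> \<in> tens m n"
    and "slice m n \<phi> 0 = slice m n \<psi> 0" "slice m n \<phi> (Suc 0) = slice m n \<psi> (Suc 0)"
  shows "\<phi> = \<psi>"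
proof (intro ext)
  fix i r c
  show "\<phi> i r c = \<psi> i r c"
  proof (cases "i < 2 \<and> r < m \<and> c < n")
    case True
    then have "i = 0 \<or> i = Suc 0" by auto
    moreover have "slice m n \<phi> 0 $$ (r, c) = slice m n \<psi> 0 $$ (r, c)"
      "slice m n \<phi> (Suc 0) $$ (r, c) = slice m n \<psi> (Suc 0) $$ (r, c)"
      using assms(3,4) by simp_all
    ultimately show ?thesis using True by auto
  next
    case False
    then have "\<phi> i r c = 0" "\<psi> i r c = 0" using assms(1,2) unfolding tens_def by blast+
    then show ?thesis by simp
  qed
qed

lemma pencil_slice: "\<psi> \<in> tens m n \<Longrightarrow> pencil m n (slice m n \<psi> 0) (slice m n \<psi> (Suc 0)) = \<psi>"
  by (rule tens_eqI) (auto simp: slice_pencil)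

lemma act_tens [simp]: "act m n g \<psi> \<in> tens m n"
  by (auto simp: act_def tens_def split: prod.splits)

section \<open>The group action in matrix form\<close>

lemma sandwich_linear:
  assumes "B \<in> carrier_mat p m" "C \<in> carrier_mat n q"
    "(X :: 'a :: comm_ring_1 mat) \<in> carrier_mat m n" "Y \<in> carrier_mat m n"
  shows "B * (a \<cdot>\<^sub>m X + b \<cdot>\<^sub>m Y) * C = a \<cdot>\<^sub>m (B * X * C) + b \<cdot>\<^sub>m (B * Y * C)"
proof -
  have "B * (a \<cdot>\<^sub>m X + b \<cdot>\<^sub>m Y) = a \<cdot>\<^sub>m (B * X) + b \<cdot>\<^sub>m (B * Y)"
    using assms by (simp add: mult_add_distrib_mat[of _ p m _ n] mult_smult_distrib[of _ p m _ n])
  then show ?thesis using assms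
    by (simp add: add_mult_distrib_mat[of _ p n _ _ q] mult_smult_assoc_mat[of _ p n _ q])
qed

lemma mult_assoc_five:
  assumes "(B :: 'a :: semiring_0 mat) \<in> carrier_mat p q" "B' \<in> carrier_mat q r" "Z \<in> carrier_mat r s"
    "D \<in> carrier_mat s t" "E \<in> carrier_mat t u"
  shows "B * (B' * Z * D) * E = (B * B') * Z * (D * E)"
proof -
  have "B * (B' * Z * D) = B * B' * Z * D"
    using assms assoc_mult_mat[of B p q "B' * Z" s D t] assoc_mult_mat[of B p q B' r Z s] by simp
  then show ?thesis using assms assoc_mult_mat[of "B * B' * Z" p s D t E u] by simp
qed

lemma slice_act:
  assumes "A \<in> carrier_mat 2 2" "B \<in> carrier_mat m m" "C \<in> carrier_mat n n" "i < 2"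
  shows "slice m n (act m n (A, B, C) \<psi>) i =
    B * (A $$ (i, 0) \<cdot>\<^sub>m slice m n \<psi> 0 + A $$ (i, Suc 0) \<cdot>\<^sub>m slice m n \<psi> (Suc 0)) * transpose_mat C"
proof (rule eq_matI, goal_cases)
  case (1 r c)
  then have rc: "r < m" "c < n" using assms by auto
  let ?t = "\<lambda>a b c'. A $$ (i, a) * B $$ (r, b) * C $$ (c, c') * \<psi> a b c'"
  let ?X = "A $$ (i, 0) \<cdot>\<^sub>m slice m n \<psi> 0 + A $$ (i, Suc 0) \<cdot>\<^sub>m slice m n \<psi> (Suc 0)"
  have "slice m n (act m n (A, B, C) \<psi>) i $$ (r, c) = (\<Sum>b<m. \<Sum>c'<n. ?t 0 b c') + (\<Sum>b<m. \<Sum>c'<n. ?t (Suc 0) b c')"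
    using rc \<open>i < 2\<close> by (simp add: act_def numeral_2_eq_2)
  also have "\<dots> = (\<Sum>b<m. \<Sum>c'<n. B $$ (r, b) * ?X $$ (b, c') * C $$ (c, c'))"
    unfolding sum.distrib[symmetric] by (intro sum.cong refl) (simp add: algebra_simps)
  also have "\<dots> = (\<Sum>c'<n. (\<Sum>b<m. B $$ (r, b) * ?X $$ (b, c')) * C $$ (c, c'))"
    by (subst sum.swap) (simp add: sum_distrib_right)
  also have "\<dots> = (B * ?X * transpose_mat C) $$ (r, c)"
    using assms rc by (simp add: scalar_prod_def lessThan_atLeast0)
  finally show ?case .
qed (use assms in auto)

lemma act_act:
  assumes "A \<in> carrier_mat 2 2" "B \<in> carrier_mat m m" "C \<in> carrier_mat n n"
    and "A' \<in> carrier_mat 2 2" "B' \<in> carrier_mat m m" "C' \<in> carrier_mat n n"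
  shows "act m n (A, B, C) (act m n (A', B', C') \<psi>) = act m n (A * A', B * B', C * C') \<psi>"
proof -
  let ?S = "slice m n \<psi>"
  have "slice m n (act m n (A, B, C) (act m n (A', B', C') \<psi>)) i = slice m n (act m n (A * A', B * B', C * C') \<psi>) i"
    if i: "i < 2" for i
  proof -
    define X where "X j = A' $$ (j, 0) \<cdot>\<^sub>m ?S 0 + A' $$ (j, Suc 0) \<cdot>\<^sub>m ?S (Suc 0)" for j
    have X: "X j \<in> carrier_mat m n" for j by (auto simp: X_def)
    have tr: "transpose_mat (C * C') = transpose_mat C' * transpose_mat C"
      using assms by (simp add: transpose_mult[of _ n n])
    have XX: "A $$ (i, 0) \<cdot>\<^sub>m X 0 + A $$ (i, Suc 0) \<cdot>\<^sub>m X (Suc 0) =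
      (A * A') $$ (i, 0) \<cdot>\<^sub>m ?S 0 + (A * A') $$ (i, Suc 0) \<cdot>\<^sub>m ?S (Suc 0)"
      using assms i by (intro eq_matI) (auto simp: X_def scalar_prod_def numeral_2_eq_2 algebra_simps)
    have "slice m n (act m n (A, B, C) (act m n (A', B', C') \<psi>)) i =
      B * (A $$ (i, 0) \<cdot>\<^sub>m (B' * X 0 * transpose_mat C') + A $$ (i, Suc 0) \<cdot>\<^sub>m (B' * X (Suc 0) * transpose_mat C')) * transpose_mat C"
      using assms i by (simp add: slice_act X_def)
    also have "\<dots> = B * (B' * (A $$ (i, 0) \<cdot>\<^sub>m X 0 + A $$ (i, Suc 0) \<cdot>\<^sub>m X (Suc 0)) * transpose_mat C') * transpose_mat C"
      using assms X by (subst sandwich_linear[of B' m m _ n n]) auto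
    also have "\<dots> = (B * B') * (A $$ (i, 0) \<cdot>\<^sub>m X 0 + A $$ (i, Suc 0) \<cdot>\<^sub>m X (Suc 0)) * transpose_mat (C * C')"
      unfolding tr using assms X by (intro mult_assoc_five[of _ m m _ m _ n _ n _ n]) auto
    also have "\<dots> = slice m n (act m n (A * A', B * B', C * C') \<psi>) i"
      unfolding XX using assms i by (simp add: slice_act)
    finally show ?thesis .
  qed
  from this[of 0] this[of "Suc 0"] show ?thesis by (intro tens_eqI) auto
qed

lemma act_one:
  assumes "\<psi> \<in> tens m n"
  shows "act m n (1\<^sub>m 2, 1\<^sub>m m, 1\<^sub>m n) \<psi> = \<psi>"
  by (rule tens_eqI) (use assms in \<open>auto simp: slice_act intro!: eq_matI\<close>)

section \<open>Scalars, general linear groups and equivalence\<close>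

definition tscale :: "complex \<Rightarrow> tensor3 \<Rightarrow> tensor3" where
  "tscale c \<psi> = (\<lambda>i j k. c * \<psi> i j k)"

lemma tscale_tens: "\<psi> \<in> tens m n \<Longrightarrow> tscale c \<psi> \<in> tens m n"
  by (auto simp: tscale_def tens_def)

lemma tscale_tscale [simp]: "tscale c (tscale d \<psi>) = tscale (c * d) \<psi>"
  by (simp add: tscale_def mult.assoc)

lemma tscale_1 [simp]: "tscale 1 \<psi> = \<psi>"
  by (simp add: tscale_def)

lemma act_tscale: "act m n g (tscale c \<psi>) = tscale c (act m n g \<psi>)"
  by (auto simp: act_def tscale_def sum_distrib_left algebra_simps split: prod.splits intro!: ext)

lemma act_smult:
  assumes "A \<in> carrier_mat 2 2" "B \<in> carrier_mat m m" "C \<in> carrier_mat n n"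
  shows "act m n (a \<cdot>\<^sub>m A, b \<cdot>\<^sub>m B, c \<cdot>\<^sub>m C) \<psi> = tscale (a * b * c) (act m n (A, B, C) \<psi>)"
  using assms by (auto simp: act_def tscale_def sum_distrib_left algebra_simps intro!: ext sum.cong)

lemma inverse_mat_exists:
  assumes "(A :: complex mat) \<in> carrier_mat n n" "det A \<noteq> 0"
  obtains A' where "A' \<in> carrier_mat n n" "A * A' = 1\<^sub>m n" "A' * A = 1\<^sub>m n" "det A * det A' = 1"
proof -
  from det_non_zero_imp_unit[OF assms, of undefined] obtain A' where
    A': "A' \<in> carrier_mat n n" "A * A' = 1\<^sub>m n" "A' * A = 1\<^sub>m n"
    by (auto simp: Units_def ring_mat_def)
  have "det A * det A' = 1"
    using det_mult[OF assms(1) A'(1)] A'(2) by simp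
  then show ?thesis using A' that by blast
qed

definition GLgrp :: "nat \<Rightarrow> nat \<Rightarrow> (complex mat \<times> complex mat \<times> complex mat) set" where
  "GLgrp m n = {(A, B, C). A \<in> carrier_mat 2 2 \<and> det A \<noteq> 0 \<and>
                          B \<in> carrier_mat m m \<and> det B \<noteq> 0 \<and>
                          C \<in> carrier_mat n n \<and> det C \<noteq> 0}"

lemma SLgrp_mult:
  assumes "g \<in> SLgrp m n" "h \<in> SLgrp m n"
  obtains gh where "gh \<in> SLgrp m n" "\<And>\<psi>. act m n g (act m n h \<psi>) = act m n gh \<psi>"
proof -
  obtain A B C A' B' C' where gh: "g = (A, B, C)" "h = (A', B', C')"
    by (cases g; cases h) auto
  with assms have "(A * A', B * B', C * C') \<in> SLgrp m n"
    by (auto simp: SLgrp_def det_mult)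
  moreover have "act m n g (act m n h \<psi>) = act m n (A * A', B * B', C * C') \<psi>" for \<psi>
    using assms gh by (auto simp: SLgrp_def act_act)
  ultimately show ?thesis using that by blast
qed

lemma SLgrp_inverse:
  assumes "g \<in> SLgrp m n"
  obtains h where "h \<in> SLgrp m n" "\<And>\<psi>. \<psi> \<in> tens m n \<Longrightarrow> act m n h (act m n g \<psi>) = \<psi>"
proof -
  obtain A B C where g: "g = (A, B, C)" by (cases g) auto
  with assms have c: "A \<in> carrier_mat 2 2" "B \<in> carrier_mat m m" "C \<in> carrier_mat n n"
    and d: "det A = 1" "det B = 1" "det C = 1" by (auto simp: SLgrp_def)
  obtain A' where A': "A' \<in> carrier_mat 2 2" "A' * A = 1\<^sub>m 2" "det A' = 1"
    using inverse_mat_exists[OF c(1)] d by auto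
  obtain B' where B': "B' \<in> carrier_mat m m" "B' * B = 1\<^sub>m m" "det B' = 1"
    using inverse_mat_exists[OF c(2)] d by auto
  obtain C' where C': "C' \<in> carrier_mat n n" "C' * C = 1\<^sub>m n" "det C' = 1"
    using inverse_mat_exists[OF c(3)] d by auto
  show ?thesis
    by (rule that[of "(A', B', C')"]) (use A' B' C' c g in \<open>auto simp: SLgrp_def act_act act_one\<close>)
qed

lemma SLgrp_one: "(1\<^sub>m 2, 1\<^sub>m m, 1\<^sub>m n) \<in> SLgrp m n"
  by (auto simp: SLgrp_def)

lemma complex_root_exists:
  assumes "(w :: complex) \<noteq> 0" "0 < n"
  obtains z where "z ^ n = w" "z \<noteq> 0"
proof -
  have "(exp (Ln w / of_nat n)) ^ n = w"
    using assms by (simp flip: exp_of_nat_mult)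
  then show ?thesis using that[of "exp (Ln w / of_nat n)"] by simp
qed

lemma det_normalize:
  assumes "(A :: complex mat) \<in> carrier_mat n n" "det A \<noteq> 0" "0 < n"
  obtains a A' where "a \<noteq> 0" "A' \<in> carrier_mat n n" "det A' = 1" "A = a \<cdot>\<^sub>m A'"
proof -
  obtain a where a: "a ^ n = det A" "a \<noteq> 0" using complex_root_exists[OF assms(2,3)] .
  show ?thesis
  proof (rule that[of a "inverse a \<cdot>\<^sub>m A"])
    show "det (inverse a \<cdot>\<^sub>m A) = 1" using a assms by (simp add: power_inverse)
    show "A = a \<cdot>\<^sub>m (inverse a \<cdot>\<^sub>m A)" using a assms by (intro eq_matI) auto
  qed (use a assms in auto)
qed

text \<open>Each matrix is a scalar times one of determinant 1, and the three scalars merge into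
  one. The last clause keeps a trivial first factor trivial; the wide case depends on normal forms
  that do not touch that factor.\<close>

lemma GL_to_SL:
  assumes "(A, B, C) \<in> GLgrp m n" "0 < m" "0 < n"
  obtains c A' B' C' where "c \<noteq> 0" "(A', B', C') \<in> SLgrp m n"
    "\<And>\<psi>. act m n (A, B, C) \<psi> = tscale c (act m n (A', B', C') \<psi>)" "A = 1\<^sub>m 2 \<Longrightarrow> A' = 1\<^sub>m 2"
proof -
  from assms have g: "A \<in> carrier_mat 2 2" "B \<in> carrier_mat m m" "C \<in> carrier_mat n n"
    "det A \<noteq> 0" "det B \<noteq> 0" "det C \<noteq> 0" by (auto simp: GLgrp_def)
  obtain a A' where a: "a \<noteq> 0" "A' \<in> carrier_mat 2 2" "det A' = 1" "A = a \<cdot>\<^sub>m A'" "A = 1\<^sub>m 2 \<Longrightarrow> A' = 1\<^sub>m 2"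
  \<comment> \<open>\<open>det_normalize\<close> returns some root of the determinant, not
    necessarily 1, so the identity is treated separately.\<close>
  proof (cases "A = 1\<^sub>m 2")
    case True
    then show ?thesis by (intro that[of 1 "1\<^sub>m 2"]) auto
  next
    case False
    then show ?thesis using det_normalize[OF g(1,4)] that by (metis zero_less_numeral)
  qed
  obtain b B' where b: "b \<noteq> 0" "B' \<in> carrier_mat m m" "det B' = 1" "B = b \<cdot>\<^sub>m B'"
    using det_normalize[OF g(2,5) assms(2)] .
  obtain c C' where c: "c \<noteq> 0" "C' \<in> carrier_mat n n" "det C' = 1" "C = c \<cdot>\<^sub>m C'"
    using det_normalize[OF g(3,6) assms(3)] .
  show ?thesis
    by (rule that[of "a * b * c" A' B' C']) (use a b c in \<open>auto simp: SLgrp_def act_smult\<close>)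
qed

text \<open>Keeping the scalar explicit lets normal forms use arbitrary invertible matrices, while
  the SL-orbit is only rescaled; semistability and closedness of the orbit are unaffected.\<close>

definition equivalent :: "nat \<Rightarrow> nat \<Rightarrow> tensor3 \<Rightarrow> tensor3 \<Rightarrow> bool" where
  "equivalent m n \<phi> \<psi> \<longleftrightarrow> (\<exists>c g. c \<noteq> 0 \<and> g \<in> SLgrp m n \<and> \<phi> = tscale c (act m n g \<psi>))"

lemma equivalent_trans:
  assumes "equivalent m n \<phi> \<psi>" "equivalent m n \<psi> \<chi>"
  shows "equivalent m n \<phi> \<chi>"
proof -
  obtain c g d h where *: "c \<noteq> 0" "g \<in> SLgrp m n" "\<phi> = tscale c (act m n g \<psi>)"
    "d \<noteq> 0" "h \<in> SLgrp m n" "\<psi> = tscale d (act m n h \<chi>)"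
    using assms unfolding equivalent_def by blast
  obtain k where "k \<in> SLgrp m n" "act m n g (act m n h \<chi>) = act m n k \<chi>"
    using SLgrp_mult * by metis
  then show ?thesis unfolding equivalent_def
    by (intro exI[of _ "c * d"] exI[of _ k]) (use * in \<open>auto simp: act_tscale\<close>)
qed

lemma equivalent_sym:
  assumes "equivalent m n \<phi> \<psi>" "\<psi> \<in> tens m n"
  shows "equivalent m n \<psi> \<phi>"
proof -
  obtain c g where *: "c \<noteq> 0" "g \<in> SLgrp m n" "\<phi> = tscale c (act m n g \<psi>)"
    using assms unfolding equivalent_def by blast
  obtain h where h: "h \<in> SLgrp m n" "\<And>\<psi>. \<psi> \<in> tens m n \<Longrightarrow> act m n h (act m n g \<psi>) = \<psi>"
    using SLgrp_inverse * by metis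
  show ?thesis unfolding equivalent_def
    by (intro exI[of _ "inverse c"] exI[of _ h]) (use * h assms in \<open>auto simp: act_tscale\<close>)
qed

lemma equivalent_tens: "equivalent m n \<phi> \<psi> \<Longrightarrow> \<phi> \<in> tens m n"
  by (auto simp: equivalent_def tscale_tens)

lemma equivalent_GL:
  assumes "g \<in> GLgrp m n" "0 < m" "0 < n"
  shows "equivalent m n (act m n g \<psi>) \<psi>"
proof -
  obtain A B C where g: "g = (A, B, C)" by (cases g) auto
  show ?thesis
    using GL_to_SL[OF assms(1)[unfolded g] assms(2,3)] unfolding g equivalent_def by metis
qed

lemma equivalent_pencil_sandwich:
  assumes "B \<in> carrier_mat m m" "det B \<noteq> 0" "C \<in> carrier_mat n n" "det C \<noteq> 0" "0 < m" "0 < n"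
    and "M0 \<in> carrier_mat m n" "M1 \<in> carrier_mat m n"
  shows "equivalent m n (pencil m n (B * M0 * C) (B * M1 * C)) (pencil m n M0 M1)"
proof -
  have "pencil m n (B * M0 * C) (B * M1 * C) = act m n (1\<^sub>m 2, B, transpose_mat C) (pencil m n M0 M1)"
  proof (rule tens_eqI)
    have [simp]: "1 \<cdot>\<^sub>m M0 + 0 \<cdot>\<^sub>m M1 = M0" "0 \<cdot>\<^sub>m M0 + 1 \<cdot>\<^sub>m M1 = M1"
      using assms by (auto intro!: eq_matI)
    show "slice m n (pencil m n (B * M0 * C) (B * M1 * C)) 0 = slice m n (act m n (1\<^sub>m 2, B, transpose_mat C) (pencil m n M0 M1)) 0"
      "slice m n (pencil m n (B * M0 * C) (B * M1 * C)) (Suc 0) = slice m n (act m n (1\<^sub>m 2, B, transpose_mat C) (pencil m n M0 M1)) (Suc 0)"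
      using assms by (simp_all add: slice_act slice_pencil)
  qed auto
  then show ?thesis
    using assms equivalent_GL[of "(1\<^sub>m 2, B, transpose_mat C)" m n "pencil m n M0 M1"]
    by (simp add: GLgrp_def det_transpose)
qed

lemma det_2x2:
  assumes "A \<in> carrier_mat 2 2"
  shows "det A = A $$ (0, 0) * A $$ (1, 1) - A $$ (0, 1) * A $$ (1, 0)"
proof -
  have "det (mat_delete A i 0) = A $$ (1 - i, 1)" if "i < 2" for i
    using assms that by (subst det_single) (auto simp: mat_delete_def)
  then show ?thesis
    using assms laplace_expansion_column[OF assms, of 0]
    by (simp add: cofactor_def numeral_2_eq_2 lessThan_Suc mult.commute)
qed

lemma equivalent_pencil_combination:
  assumes "a * d - b * c \<noteq> 0" "0 < m" "0 < n"
    and M: "M0 \<in> carrier_mat m n" "M1 \<in> carrier_mat m n"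
  shows "equivalent m n (pencil m n (a \<cdot>\<^sub>m M0 + b \<cdot>\<^sub>m M1) (c \<cdot>\<^sub>m M0 + d \<cdot>\<^sub>m M1)) (pencil m n M0 M1)"
proof -
  define A where "A = mat 2 2 (\<lambda>(i, j). if i = 0 then (if j = 0 then a else b) else (if j = 0 then c else d))"
  have A: "A \<in> carrier_mat 2 2" "A $$ (0, 0) = a" "A $$ (0, Suc 0) = b" "A $$ (Suc 0, 0) = c" "A $$ (Suc 0, Suc 0) = d"
    by (auto simp: A_def)
  then have "det A \<noteq> 0" using assms(1) by (simp add: det_2x2)
  have "pencil m n (a \<cdot>\<^sub>m M0 + b \<cdot>\<^sub>m M1) (c \<cdot>\<^sub>m M0 + d \<cdot>\<^sub>m M1) = act m n (A, 1\<^sub>m m, 1\<^sub>m n) (pencil m n M0 M1)"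
    by (rule tens_eqI[of _ m n]) (use A M in \<open>auto simp: slice_act slice_pencil\<close>)
  then show ?thesis
    using assms A \<open>det A \<noteq> 0\<close> equivalent_GL[of "(A, 1\<^sub>m m, 1\<^sub>m n)" m n "pencil m n M0 M1"]
    by (simp add: GLgrp_def)
qed

section \<open>Orbits and one-parameter degenerations\<close>

lemma continuous_on_coord: "continuous_on S (\<lambda>\<psi> :: tensor3. \<psi> i j k)"
proof -
  have "continuous_on S (\<lambda>\<psi> :: tensor3. \<psi>)" by (rule continuous_on_id)
  then show ?thesis
    using continuous_on_product_then_coordinatewise[of S "\<lambda>\<psi>. \<psi>" i]
      continuous_on_product_then_coordinatewise[of S "\<lambda>\<psi>. \<psi> i" j]
      continuous_on_product_then_coordinatewise[of S "\<lambda>\<psi>. \<psi> i j" k] by blast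
qed

lemma continuous_on_tensorI:
  assumes "\<And>i j k. continuous_on S (\<lambda>x. f x i j k)"
  shows "continuous_on S (f :: _ \<Rightarrow> tensor3)"
  using assms by (intro continuous_on_coordinatewise_then_product)

lemma continuous_on_act: "continuous_on S (act m n g)"
proof (rule continuous_on_tensorI)
  fix i j k
  obtain A B C where g: "g = (A, B, C)" by (cases g) auto
  show "continuous_on S (\<lambda>\<psi>. act m n g \<psi> i j k)"
    by (cases "i < 2 \<and> j < m \<and> k < n")
      (auto simp: act_def g intro!: continuous_intros continuous_on_coord)
qed

lemma continuous_on_tscale: "continuous_on S (tscale c)"
  by (rule continuous_on_tensorI) (auto simp: tscale_def intro!: continuous_intros continuous_on_coord)

lemma closed_tens: "closed (tens m n)"
proof -
  have "closed {\<psi> :: tensor3. \<psi> i j k \<noteq> 0 \<longrightarrow> i < 2 \<and> j < m \<and> k < n}" for i j k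
  proof (cases "i < 2 \<and> j < m \<and> k < n")
    case False
    then have "{\<psi> :: tensor3. \<psi> i j k \<noteq> 0 \<longrightarrow> i < 2 \<and> j < m \<and> k < n} = {\<psi>. \<psi> i j k = 0}" by auto
    then show ?thesis by (simp add: closed_Collect_eq continuous_on_coord)
  qed simp
  then show ?thesis unfolding tens_def by (intro closed_Collect_all)
qed

lemma orbit_subset_tens: "orbit m n \<psi> \<subseteq> tens m n"
  by (auto simp: orbit_def)

lemma closure_orbit_subset_tens: "closure (orbit m n \<psi>) \<subseteq> tens m n"
  by (rule closure_minimal[OF orbit_subset_tens closed_tens])

lemma mem_orbit_self: "\<psi> \<in> tens m n \<Longrightarrow> \<psi> \<in> orbit m n \<psi>"
  unfolding orbit_def by (rule image_eqI[OF _ SLgrp_one]) (simp add: act_one)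

lemma closure_orbit_mono:
  assumes "\<phi> \<in> closure (orbit m n \<psi>)"
  shows "closure (orbit m n \<phi>) \<subseteq> closure (orbit m n \<psi>)"
proof (rule closure_minimal)
  show "orbit m n \<phi> \<subseteq> closure (orbit m n \<psi>)"
  proof
    fix \<chi> assume "\<chi> \<in> orbit m n \<phi>"
    then obtain g where g: "g \<in> SLgrp m n" "\<chi> = act m n g \<phi>" by (auto simp: orbit_def)
    \<comment> \<open>A group element maps the orbit into itself and acts continuously, so it also
      maps the closure into itself.\<close>
    have "act m n g ` orbit m n \<psi> \<subseteq> orbit m n \<psi>"
    proof
      fix x assume "x \<in> act m n g ` orbit m n \<psi>"
      then obtain h where "h \<in> SLgrp m n" "x = act m n g (act m n h \<psi>)" by (auto simp: orbit_def)
      then show "x \<in> orbit m n \<psi>" using SLgrp_mult[OF g(1)] unfolding orbit_def by (metis image_eqI)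
    qed
    then have "act m n g ` closure (orbit m n \<psi>) \<subseteq> closure (orbit m n \<psi>)"
      by (meson closed_closure closure_subset continuous_on_act image_closure_subset order_trans)
    then show "\<chi> \<in> closure (orbit m n \<psi>)" using assms g by auto
  qed
qed simp

lemma semistable_alt:
  "semistable m n \<psi> \<longleftrightarrow> \<psi> \<in> tens m n \<and> (\<lambda>i j k. 0) \<notin> closure (orbit m n \<psi>)"
  by (auto simp: semistable_def nullcone_def)

lemma semistable_closure:
  assumes "semistable m n \<psi>" "\<phi> \<in> closure (orbit m n \<psi>)"
  shows "semistable m n \<phi>"
  using assms closure_orbit_mono[OF assms(2)] closure_orbit_subset_tens[of m n \<psi>]
  unfolding semistable_alt by blast

lemma equivalent_orbit:
  assumes "equivalent m n \<phi> \<psi>" "\<psi> \<in> tens m n"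
  obtains c where "c \<noteq> 0" "orbit m n \<phi> = tscale c ` orbit m n \<psi>"
proof -
  obtain c g where *: "c \<noteq> 0" "g \<in> SLgrp m n" "\<phi> = tscale c (act m n g \<psi>)"
    using assms unfolding equivalent_def by blast
  obtain g' where g': "g' \<in> SLgrp m n" "\<And>\<psi>. \<psi> \<in> tens m n \<Longrightarrow> act m n g' (act m n g \<psi>) = \<psi>"
    using SLgrp_inverse * by metis
  have "act m n h \<phi> \<in> tscale c ` orbit m n \<psi>" if h: "h \<in> SLgrp m n" for h
  proof -
    obtain k where "k \<in> SLgrp m n" "act m n h (act m n g \<psi>) = act m n k \<psi>"
      using SLgrp_mult[OF h *(2)] by metis
    then show ?thesis unfolding *(3) act_tscale orbit_def by auto
  qed
  moreover have "tscale c (act m n h \<psi>) \<in> orbit m n \<phi>" if h: "h \<in> SLgrp m n" for h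
  proof -
    obtain k where "k \<in> SLgrp m n" "\<And>\<chi>. act m n h (act m n g' \<chi>) = act m n k \<chi>"
      using SLgrp_mult[OF h g'(1)] by metis
    then have "tscale c (act m n h \<psi>) = act m n k \<phi>"
      unfolding *(3) act_tscale using g'(2)[OF assms(2)] by metis
    then show ?thesis using \<open>k \<in> SLgrp m n\<close> by (auto simp: orbit_def)
  qed
  ultimately have "orbit m n \<phi> = tscale c ` orbit m n \<psi>" unfolding orbit_def by auto
  then show ?thesis using * that by blast
qed

lemma closure_tscale:
  assumes "c \<noteq> 0"
  shows "closure (tscale c ` S) = tscale c ` closure S"
proof -
  \<comment> \<open>The image under an invertible scaling is a preimage under the inverse scaling,
    hence closed for closed sets.\<close>
  have vim: "tscale c ` T = tscale (inverse c) -` T" for T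
  proof
    show "tscale (inverse c) -` T \<subseteq> tscale c ` T"
    proof
      fix x assume "x \<in> tscale (inverse c) -` T"
      then show "x \<in> tscale c ` T"
        using assms by (intro image_eqI[of _ _ "tscale (inverse c) x"]) auto
    qed
  qed (use assms in auto)
  show ?thesis
  proof
    show "closure (tscale c ` S) \<subseteq> tscale c ` closure S"
    proof (rule closure_minimal)
      show "closed (tscale c ` closure S)"
        unfolding vim by (intro closed_vimage continuous_on_tscale) auto
    qed (use closure_subset in auto)
    show "tscale c ` closure S \<subseteq> closure (tscale c ` S)"
      by (rule image_closure_subset[OF continuous_on_tscale closed_closure closure_subset])
  qed
qed

lemma semistable_equivalent:
  assumes "equivalent m n \<phi> \<psi>" "\<psi> \<in> tens m n"
  shows "semistable m n \<phi> \<longleftrightarrow> semistable m n \<psi>"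
proof -
  obtain c where c: "c \<noteq> 0" "orbit m n \<phi> = tscale c ` orbit m n \<psi>"
    using equivalent_orbit[OF assms] .
  have "(\<lambda>i j k. 0) \<in> tscale c ` S \<longleftrightarrow> (\<lambda>i j k. 0) \<in> S" for S
  proof -
    have "(\<lambda>i j k. 0) = tscale c x \<longleftrightarrow> x = (\<lambda>i j k. 0)" for x
      using c by (auto simp: tscale_def fun_eq_iff)
    then show ?thesis unfolding image_iff by simp
  qed
  then show ?thesis
    using assms equivalent_tens[OF assms(1)] c by (simp add: semistable_alt closure_tscale)
qed

lemma closed_orbit_equivalent:
  assumes "equivalent m n \<phi> \<psi>" "\<psi> \<in> tens m n" "closed (orbit m n \<psi>)"
  shows "closed (orbit m n \<phi>)"
  using equivalent_orbit[OF assms(1,2)] assms(3) closure_tscale closure_closed closed_closure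
  by metis

text \<open>Invariance of \<open>D\<close> is demanded only along the one orbit: continuity then
  fixes \<open>D\<close> on the closure, and since every limit is semistable it has the form
  \<open>tscale c (act m n g \<psi>)\<close>, where homogeneity forces
  \<open>c ^ N = 1\<close>.\<close>

lemma closed_orbit_criterion:
  fixes D :: "tensor3 \<Rightarrow> complex"
  assumes ss: "semistable m n \<psi>"
    and unique: "\<And>\<phi>. semistable m n \<phi> \<Longrightarrow> equivalent m n \<phi> \<psi>"
    and cont: "continuous_on UNIV D"
    and inv: "\<And>g. g \<in> SLgrp m n \<Longrightarrow> D (act m n g \<psi>) = D \<psi>"
    and nz: "D \<psi> \<noteq> 0"
    and hom: "\<And>c \<phi>. D (tscale c \<phi>) = c ^ N * D \<phi>"
    and roots: "\<And>z. z ^ N = 1 \<Longrightarrow> tscale z \<psi> \<in> orbit m n \<psi>"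
  shows "closed (orbit m n \<psi>)"
proof -
  have "\<phi> \<in> orbit m n \<psi>" if \<phi>: "\<phi> \<in> closure (orbit m n \<psi>)" for \<phi>
  proof -
    have "closure (orbit m n \<psi>) \<subseteq> {\<phi>. D \<phi> = D \<psi>}"
      by (rule closure_minimal)
        (auto simp: orbit_def inv intro!: closed_Collect_eq cont continuous_intros)
    with \<phi> have D: "D \<phi> = D \<psi>" by auto
    obtain c g where *: "c \<noteq> 0" "g \<in> SLgrp m n" "\<phi> = tscale c (act m n g \<psi>)"
      using unique[OF semistable_closure[OF ss \<phi>]] unfolding equivalent_def by blast
    have "c ^ N = 1" using D nz *(2,3) by (simp add: hom inv)
    then obtain h where h: "h \<in> SLgrp m n" "tscale c \<psi> = act m n h \<psi>"
      using roots unfolding orbit_def by (metis imageE)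
    obtain k where "k \<in> SLgrp m n" "act m n g (act m n h \<psi>) = act m n k \<psi>"
      using SLgrp_mult[OF *(2) h(1)] by metis
    then show ?thesis using * h by (auto simp: orbit_def simp flip: act_tscale)
  qed
  then show ?thesis by (metis closure_subset closure_closed closed_closure subsetI subset_antisym)
qed

section \<open>Diagonal one-parameter subgroups\<close>

lemma det_mat_diag: "det (mat_diag n d) = (\<Prod>i<n. (d i :: complex))"
proof -
  have "det (mat_diag n d) = prod_list (diag_mat (mat_diag n d))"
    by (rule det_upper_triangular[of _ n]) (auto simp: mat_diag_def)
  also have "\<dots> = (\<Prod>i<n. d i)"
    unfolding prod_list_diag_prod by (simp add: mat_diag_def lessThan_atLeast0)
  finally show ?thesis .
qed

lemma act_mat_diag:
  assumes "\<psi> \<in> tens m n"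
  shows "act m n (mat_diag 2 a, mat_diag m b, mat_diag n c) \<psi> = (\<lambda>i j k. a i * b j * c k * \<psi> i j k)"
proof (intro ext)
  fix i j k
  show "act m n (mat_diag 2 a, mat_diag m b, mat_diag n c) \<psi> i j k = a i * b j * c k * \<psi> i j k"
  proof (cases "i < 2 \<and> j < m \<and> k < n")
    case True
    then have "act m n (mat_diag 2 a, mat_diag m b, mat_diag n c) \<psi> i j k =
      (\<Sum>a'<2. (if i = a' then a a' else 0) * (\<Sum>b'<m. (if j = b' then b b' else 0) *
        (\<Sum>c'<n. (if k = c' then c c' else 0) * \<psi> a' b' c')))"
      by (simp add: act_def mat_diag_def sum_distrib_left mult.assoc)
    also have "\<dots> = a i * b j * c k * \<psi> i j k" using True by (simp add: mult_delta_left)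
    finally show ?thesis .
  next
    case False
    then have "\<psi> i j k = 0" using assms unfolding tens_def by blast
    then show ?thesis using False by (auto simp: act_def)
  qed
qed

text \<open>The zero sums put diag(t^\<alpha>), diag(t^\<beta>), diag(t^\<gamma>) into the group. A
  coordinate is multiplied by t to its total weight, so nonnegative weights let the curve extend
  continuously to t = 0, where exactly the coordinates of weight 0 survive.\<close>

lemma torus_limit:
  fixes \<alpha> \<beta> \<gamma> :: "nat \<Rightarrow> int"
  assumes \<psi>: "\<psi> \<in> tens m n"
    and sums: "\<alpha> 0 + \<alpha> 1 = 0" "(\<Sum>j<m. \<beta> j) = 0" "(\<Sum>k<n. \<gamma> k) = 0"
    and pos: "\<And>i j k. \<psi> i j k \<noteq> 0 \<Longrightarrow> 0 \<le> \<alpha> i + \<beta> j + \<gamma> k"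
  shows "(\<lambda>i j k. if \<alpha> i + \<beta> j + \<gamma> k = 0 then \<psi> i j k else 0) \<in> closure (orbit m n \<psi>)"
proof -
  \<comment> \<open>Truncation by \<open>nat\<close> is harmless: a negative weight occurs only
    where \<psi> vanishes. At \<open>t = 0\<close> the convention 0^0 = 1 yields the limit.\<close>
  define f where "f t = (\<lambda>i j k. t ^ nat (\<alpha> i + \<beta> j + \<gamma> k) * \<psi> i j k)" for t :: complex
  have prod: "(\<Prod>j<p. t powi e j) = t powi (\<Sum>j<p. e j)" if "t \<noteq> 0" for t :: complex and e and p :: nat
    using that by (induction p) (auto simp: power_int_add)
  have "f t \<in> orbit m n \<psi>" if "t \<noteq> 0" for t
  proof -
    let ?g = "(mat_diag 2 (\<lambda>i. t powi \<alpha> i), mat_diag m (\<lambda>i. t powi \<beta> i), mat_diag n (\<lambda>i. t powi \<gamma> i))"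
    have sum2: "(\<Sum>i<2. \<alpha> i) = 0" using sums by (simp add: numeral_2_eq_2)
    have "?g \<in> SLgrp m n"
      using sums sum2 prod[OF that] by (auto simp: SLgrp_def det_mat_diag)
    moreover have "act m n ?g \<psi> = f t"
    proof (intro ext)
      fix i j k
      show "act m n ?g \<psi> i j k = f t i j k"
      proof (cases "\<psi> i j k = 0")
        case False
        have "t powi \<alpha> i * t powi \<beta> j * t powi \<gamma> k = t powi (\<alpha> i + \<beta> j + \<gamma> k)"
          using that by (simp add: power_int_add)
        also have "\<dots> = t ^ nat (\<alpha> i + \<beta> j + \<gamma> k)"
          using pos[OF False] by (simp add: power_int_def)
        finally show ?thesis by (simp add: act_mat_diag[OF \<psi>] f_def)
      qed (simp add: act_mat_diag[OF \<psi>] f_def)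
    qed
    ultimately show ?thesis unfolding orbit_def by (metis image_eqI)
  qed
  then have "f ` (UNIV - {0}) \<subseteq> closure (orbit m n \<psi>)" using closure_subset by fastforce
  moreover have "continuous_on S f" for S
    unfolding f_def by (intro continuous_on_tensorI continuous_intros)
  ultimately have "f ` closure (UNIV - {0}) \<subseteq> closure (orbit m n \<psi>)"
    by (intro image_closure_subset) auto
  moreover have "(0 :: complex) \<in> closure (UNIV - {0})"
    by (metis Compl_eq_Diff_UNIV UNIV_I closure_complement interior_singleton Compl_empty_eq)
  ultimately have "f 0 \<in> closure (orbit m n \<psi>)" by blast
  moreover have "f 0 = (\<lambda>i j k. if \<alpha> i + \<beta> j + \<gamma> k = 0 then \<psi> i j k else 0)"
    unfolding f_def using pos by (intro ext) (force simp: power_0_left)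
  ultimately show ?thesis by simp
qed

text \<open>The elementary half of the Hilbert-Mumford criterion: if all weights on the support are
  positive, the torus limit is the zero tensor.\<close>

lemma not_semistable_torus:
  fixes \<alpha> \<beta> \<gamma> :: "nat \<Rightarrow> int"
  assumes \<psi>: "\<psi> \<in> tens m n"
    and sums: "\<alpha> 0 + \<alpha> 1 = 0" "(\<Sum>j<m. \<beta> j) = 0" "(\<Sum>k<n. \<gamma> k) = 0"
    and pos: "\<And>i j k. \<psi> i j k \<noteq> 0 \<Longrightarrow> 0 < \<alpha> i + \<beta> j + \<gamma> k"
  shows "\<not> semistable m n \<psi>"
proof -
  have "(\<lambda>i j k. if \<alpha> i + \<beta> j + \<gamma> k = 0 then \<psi> i j k else 0) \<in> closure (orbit m n \<psi>)"
    by (rule torus_limit[OF \<psi> sums]) (use pos in force)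
  moreover have "(\<lambda>i j k. if \<alpha> i + \<beta> j + \<gamma> k = 0 then \<psi> i j k else 0) = (\<lambda>i j k. 0)"
    using pos by (intro ext) force
  ultimately show ?thesis by (simp add: semistable_alt)
qed

text \<open>The zero block says that both slices map a q-dimensional subspace of C^n into a
  p-dimensional subspace of C^m; the pair destabilises when p/m < q/n.\<close>

lemma not_semistable_zero_block:
  assumes \<psi>: "\<psi> \<in> tens m n" and pq: "p \<le> m" "q \<le> n" "p * n < m * q"
    and zero: "\<And>i j k. p \<le> j \<Longrightarrow> k < q \<Longrightarrow> \<psi> i j k = 0"
  shows "\<not> semistable m n \<psi>"
proof (rule not_semistable_torus[OF \<psi>])
  \<comment> \<open>The weights take two values on each index set, chosen with sum zero. Outside the
    zero block the least total weight is m q - p n, positive by assumption.\<close>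
  let ?b = "\<lambda>j. if j < p then (int m - int p) * int n else - int p * int n"
  let ?c = "\<lambda>k. if k < q then - (int n - int q) * int m else int q * int m"
  have split_sum: "(\<Sum>j<l. if j < r then (a :: int) else b) = int r * a + (int l - int r) * b" if "r \<le> l" for l r a b
  proof -
    have "(\<Sum>j<l. if j < r then a else b) = (\<Sum>j\<in>{..<r}. a) + (\<Sum>j\<in>{r..<l}. b)"
    proof -
      have "{..<l} \<inter> {j. j < r} = {..<r}" "{..<l} \<inter> - {j. j < r} = {r..<l}" using that by auto
      then show ?thesis by (simp add: sum.If_cases)
    qed
    also have "\<dots> = int r * a + (int l - int r) * b" using that by (simp add: of_nat_diff)
    finally show ?thesis .
  qed
  show "(\<Sum>j<m. ?b j) = 0" "(\<Sum>k<n. ?c k) = 0"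
    by (simp_all add: split_sum pq) (simp_all add: algebra_simps)
  have pq': "int p * int n < int m * int q" using pq(3) by (metis of_nat_less_iff of_nat_mult)
  have "0 \<le> int n * (int m - int p)" "0 \<le> int m * (int n - int q)" "0 \<le> int q * int m" "0 \<le> int p * int n" using pq by auto
  fix i j k assume nz: "\<psi> i j k \<noteq> 0"
  then have "\<not> (p \<le> j \<and> k < q)" using zero by auto
  have "m > 0" "q > 0" using pq(3) by (auto intro: gr0I)
  have "int p * int n \<le> int m * int n" using pq by (simp add: mult_right_mono)
  moreover have "0 < int q * int m" using \<open>m > 0\<close> \<open>q > 0\<close> by simp
  ultimately show "0 < (\<lambda>_. 0 :: int) i + ?b j + ?c k"
    using pq' \<open>\<not> (p \<le> j \<and> k < q)\<close> by (auto simp: algebra_simps)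
qed simp

section \<open>The determinant of a square pencil as a binary form\<close>

definition dform :: "nat \<Rightarrow> tensor3 \<Rightarrow> complex \<Rightarrow> complex \<Rightarrow> complex" where
  "dform n \<psi> x y = det (x \<cdot>\<^sub>m slice n n \<psi> 0 + y \<cdot>\<^sub>m slice n n \<psi> (Suc 0))"

lemma continuous_on_det:
  assumes "\<And>i j. i < n \<Longrightarrow> j < n \<Longrightarrow> continuous_on S (\<lambda>x. f x i j :: complex)"
  shows "continuous_on S (\<lambda>x. det (mat n n (\<lambda>(i, j). f x i j)))"
proof -
  have "continuous_on S (\<lambda>x. \<Sum>p\<in>{p. p permutes {0..<n}}. signof p * (\<Prod>i = 0..<n. f x i (p i)))"
    by (intro continuous_intros assms) (auto dest: permutes_in_image)
  moreover have "det (mat n n (\<lambda>(i, j). f x i j)) =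
    (\<Sum>p\<in>{p. p permutes {0..<n}}. signof p * (\<Prod>i = 0..<n. f x i (p i)))" for x
    by (subst det_def'[of _ n]) (auto intro!: sum.cong prod.cong dest: permutes_in_image)
  ultimately show ?thesis by simp
qed

lemma continuous_on_dform: "continuous_on S (\<lambda>\<psi>. dform n \<psi> x y)"
proof -
  have "dform n \<psi> x y = det (mat n n (\<lambda>(i, j). x * \<psi> 0 i j + y * \<psi> (Suc 0) i j))" for \<psi>
    unfolding dform_def by (rule arg_cong[of _ _ det]) (auto intro!: eq_matI)
  then show ?thesis
    by (simp only:) (intro continuous_on_det continuous_intros continuous_on_coord)
qed

text \<open>The factors B and C contribute only their determinants, so on the group the form changes
  by the linear substitution given by A alone. Invariants of binary forms thus become invariants of
  tensors.\<close>

lemma dform_act: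
  assumes "A \<in> carrier_mat 2 2" "B \<in> carrier_mat n n" "C \<in> carrier_mat n n"
  shows "dform n (act n n (A, B, C) \<psi>) x y = det B * det C *
    dform n \<psi> (x * A $$ (0, 0) + y * A $$ (1, 0)) (x * A $$ (0, 1) + y * A $$ (1, 1))"
proof -
  define X where "X i = A $$ (i, 0) \<cdot>\<^sub>m slice n n \<psi> 0 + A $$ (i, Suc 0) \<cdot>\<^sub>m slice n n \<psi> (Suc 0)" for i
  have X: "X i \<in> carrier_mat n n" for i by (simp add: X_def)
  have "x \<cdot>\<^sub>m X 0 + y \<cdot>\<^sub>m X (Suc 0) = (x * A $$ (0, 0) + y * A $$ (1, 0)) \<cdot>\<^sub>m slice n n \<psi> 0
    + (x * A $$ (0, 1) + y * A $$ (1, 1)) \<cdot>\<^sub>m slice n n \<psi> (Suc 0)"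
    unfolding X_def by (intro eq_matI) (auto simp: algebra_simps)
  moreover have "x \<cdot>\<^sub>m (B * X 0 * transpose_mat C) + y \<cdot>\<^sub>m (B * X (Suc 0) * transpose_mat C)
    = B * (x \<cdot>\<^sub>m X 0 + y \<cdot>\<^sub>m X (Suc 0)) * transpose_mat C"
    using assms X by (subst sandwich_linear[of _ n n _ n n]) auto
  moreover have "det (B * (x \<cdot>\<^sub>m X 0 + y \<cdot>\<^sub>m X (Suc 0)) * transpose_mat C)
    = det B * det C * det (x \<cdot>\<^sub>m X 0 + y \<cdot>\<^sub>m X (Suc 0))"
    using assms X by (simp add: det_mult[of _ n] det_transpose[of _ n])
  ultimately show ?thesis
    unfolding dform_def using assms by (simp add: slice_act X_def)
qed

lemma dform_tscale: "dform n (tscale c \<psi>) x y = c ^ n * dform n \<psi> x y"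
proof -
  have "x \<cdot>\<^sub>m slice n n (tscale c \<psi>) 0 + y \<cdot>\<^sub>m slice n n (tscale c \<psi>) (Suc 0)
    = c \<cdot>\<^sub>m (x \<cdot>\<^sub>m slice n n \<psi> 0 + y \<cdot>\<^sub>m slice n n \<psi> (Suc 0))"
    by (intro eq_matI) (auto simp: tscale_def algebra_simps)
  then show ?thesis unfolding dform_def by simp
qed

section \<open>Polynomial kernel vectors of pencils\<close>

lemma underdetermined_system:
  fixes a :: "nat \<Rightarrow> nat \<Rightarrow> complex"
  assumes "R < N"
  obtains x i where "i < N" "x i \<noteq> 0" "\<And>r. r < R \<Longrightarrow> (\<Sum>i<N. a r i * x i) = 0"
proof -
  define M where "M = mat N N (\<lambda>(r, i). if r < R then a r i else 0)"
  have M: "M \<in> carrier_mat N N" by (simp add: M_def)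
  \<comment> \<open>The system is padded with zero rows to a square one. Row \<open>R\<close> is
    such a row, so the transpose kills a unit vector and the determinant vanishes.\<close>
  have "transpose_mat M *\<^sub>v unit_vec N R = 0\<^sub>v N"
    using assms by (intro eq_vecI) (auto simp: M_def)
  moreover have "unit_vec N R \<noteq> (0\<^sub>v N :: complex vec)"
    using assms by (metis index_unit_vec(2) index_zero_vec(1) zero_neq_one)
  ultimately have "det (transpose_mat M) = 0"
    using M det_0_iff_vec_prod_zero_field[of "transpose_mat M" N] transpose_carrier_mat unit_vec_carrier by blast
  then have "det M = 0" using det_transpose[OF M] by simp
  then obtain v where v: "v \<in> carrier_vec N" "v \<noteq> 0\<^sub>v N" "M *\<^sub>v v = 0\<^sub>v N"
    using det_0_iff_vec_prod_zero_field[OF M] by blast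
  obtain i where i: "i < N" "v $ i \<noteq> 0"
    using v(1,2) by (metis carrier_vecD eq_vecI index_zero_vec)
  have "(\<Sum>i<N. a r i * v $ i) = 0" if "r < R" for r
  proof -
    have "(M *\<^sub>v v) $ r = 0" using v(3) that assms by simp
    then show ?thesis using that assms v(1)
      by (simp add: M_def scalar_prod_def lessThan_atLeast0)
  qed
  then show ?thesis using that i by blast
qed

section \<open>Linear independence and completion to bases\<close>

definition indep :: "nat \<Rightarrow> nat \<Rightarrow> (nat \<Rightarrow> nat \<Rightarrow> complex) \<Rightarrow> bool" where
  "indep n q v \<longleftrightarrow> (\<forall>x. (\<forall>c<n. (\<Sum>i<q. x i * v i c) = 0) \<longrightarrow> (\<forall>i<q. x i = 0))"

lemma indep_le:
  assumes "indep n q v"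
  shows "q \<le> n"
proof (rule ccontr)
  assume "\<not> q \<le> n"
  then have "n < q" by simp
  then have "\<exists>x. (\<exists>i<q. x i \<noteq> 0) \<and> (\<forall>c<n. (\<Sum>i<q. v i c * x i) = 0)"
    by (rule underdetermined_system[of n q "\<lambda>c i. v i c"]) blast
  then obtain x i where "i < q" "x i \<noteq> 0" "\<And>c. c < n \<Longrightarrow> (\<Sum>i<q. v i c * x i) = 0"
    by blast
  then have "\<forall>c<n. (\<Sum>i<q. x i * v i c) = 0" by (simp only: mult.commute[of "x _"]) simp
  then have "x i = 0" using assms[unfolded indep_def] \<open>i < q\<close> by blast
  then show False using \<open>x i \<noteq> 0\<close> by simp
qed

text \<open>Pairing a relation with the conjugate of \<open>w\<close> removes the earlier vectors
  and leaves the coefficient of \<open>w\<close> times its squared norm.\<close>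

lemma indep_snoc:
  assumes "indep n q v" "w c0 \<noteq> 0" "c0 < n"
    and orth: "\<And>i. i < q \<Longrightarrow> (\<Sum>c<n. cnj (v i c) * w c) = 0"
  shows "indep n (Suc q) (v(q := w))"
  unfolding indep_def
proof (intro allI impI)
  fix x i assume x: "\<forall>c<n. (\<Sum>i<Suc q. x i * (v(q := w)) i c) = 0" and i: "i < Suc q"
  have x': "(\<Sum>i<q. x i * v i c) + x q * w c = 0" if "c < n" for c
    using x that by simp
  have "0 = (\<Sum>c<n. ((\<Sum>i<q. x i * v i c) + x q * w c) * cnj (w c))"
    by (simp add: x')
  also have "\<dots> = (\<Sum>i<q. x i * cnj (\<Sum>c<n. cnj (v i c) * w c)) + x q * (\<Sum>c<n. w c * cnj (w c))"
  proof -
    have "(\<Sum>c<n. (\<Sum>i<q. x i * v i c) * cnj (w c)) = (\<Sum>i<q. \<Sum>c<n. x i * v i c * cnj (w c))"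
      unfolding sum_distrib_right by (rule sum.swap)
    then show ?thesis by (simp add: sum.distrib distrib_right sum_distrib_left mult.assoc)
  qed
  also have "\<dots> = x q * of_real (\<Sum>c<n. (cmod (w c))\<^sup>2)"
  proof -
    have "(\<Sum>c<n. w c * cnj (w c)) = of_real (\<Sum>c<n. (cmod (w c))\<^sup>2)"
      unfolding of_real_sum complex_norm_square by (rule refl)
    moreover have "(\<Sum>i<q. x i * cnj (\<Sum>c<n. cnj (v i c) * w c)) = 0"
      by (intro sum.neutral ballI) (simp only: orth lessThan_iff complex_cnj_zero mult_zero_right)
    ultimately show ?thesis by (simp only: add_0_left)
  qed
  finally have "x q = 0 \<or> (\<Sum>c<n. (cmod (w c))\<^sup>2) = 0"
    by (metis mult_eq_0_iff of_real_eq_0_iff)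
  moreover have "0 < (\<Sum>c<n. (cmod (w c))\<^sup>2)"
    using assms(2,3) by (intro sum_pos2[of _ c0]) auto
  ultimately have "x q = 0" by linarith
  moreover have "\<forall>c<n. (\<Sum>i<q. x i * v i c) = 0"
    using x' \<open>x q = 0\<close> by simp
  then have "\<forall>i<q. x i = 0"
    using assms(1) unfolding indep_def by blast
  ultimately show "x i = 0" using i less_Suc_eq by auto
qed

lemma indep_extend:
  assumes "indep n q v"
  obtains v' where "\<And>i. i < q \<Longrightarrow> v' i = v i" "indep n n v'"
proof -
  have "\<exists>v'. (\<forall>i<q. v' i = v i) \<and> indep n n v'"
    using indep_le[OF assms] assms
  proof (induction q arbitrary: v rule: inc_induct)
    case base
    then show ?case by blast
  next
    case (step q)
    \<comment> \<open>Orthogonality to q vectors is a system of q < n equations, so it has a nonzero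
      solution.\<close>
    have "\<exists>w. (\<exists>c<n. w c \<noteq> 0) \<and> (\<forall>i<q. (\<Sum>c<n. cnj (v i c) * w c) = 0)"
      by (rule underdetermined_system[OF step.hyps(2), of "\<lambda>i c. cnj (v i c)"]) blast
    then obtain w c0 where w: "c0 < n" "w c0 \<noteq> 0" "\<And>i. i < q \<Longrightarrow> (\<Sum>c<n. cnj (v i c) * w c) = 0"
      by blast
    then obtain v' where "\<forall>i<Suc q. v' i = (v(q := w)) i" "indep n n v'"
      using step.IH[OF indep_snoc[OF step.prems]] by blast
    then show ?case by (intro exI[of _ v']) auto
  qed
  then show ?thesis using that by blast
qed

lemma indep_det:
  assumes "indep n n v"
  shows "det (mat n n (\<lambda>(c, i). v i c)) \<noteq> 0"
proof
  let ?M = "mat n n (\<lambda>(c, i). v i c)"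
  assume "det ?M = 0"
  then obtain x where x: "x \<in> carrier_vec n" "x \<noteq> 0\<^sub>v n" "?M *\<^sub>v x = 0\<^sub>v n"
    using det_0_iff_vec_prod_zero_field[of ?M n] by auto
  have "(\<Sum>i<n. x $ i * v i c) = 0" if "c < n" for c
  proof -
    have "(?M *\<^sub>v x) $ c = 0" using x(3) that by simp
    then show ?thesis using that x(1)
      by (simp add: scalar_prod_def lessThan_atLeast0 mult.commute)
  qed
  then have "\<forall>i<n. x $ i = 0" using assms unfolding indep_def by blast
  then show False using x(1,2) by (metis carrier_vecD eq_vecI index_zero_vec)
qed

text \<open>Pairs (a, i) with i < L are flattened to a L + i throughout; this unfolds sums over the
  flattened index.\<close>

lemma sum_div_mod: "(\<Sum>p<d * (L :: nat). f p) = (\<Sum>a<d. \<Sum>i<L. f (a * L + i))"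
proof -
  have "(\<Sum>p<d * L. f p) = (\<Sum>a<d. sum f {a * L..<a * L + L})"
    by (rule sum.nat_group[symmetric])
  also have "\<dots> = (\<Sum>a<d. \<Sum>i<L. f (a * L + i))"
  proof (rule sum.cong)
    fix a
    show "sum f {a * L..<a * L + L} = (\<Sum>i<L. f (a * L + i))"
      using sum.shift_bounds_nat_ivl[of f 0 "a * L" L] by (simp add: lessThan_atLeast0 add.commute)
  qed simp
  finally show ?thesis .
qed

section \<open>Kernel vectors and independence of their coefficients\<close>

definition ap :: "nat \<Rightarrow> tensor3 \<Rightarrow> nat \<Rightarrow> (nat \<Rightarrow> complex) \<Rightarrow> nat \<Rightarrow> complex" where
  "ap n \<psi> l v r = (\<Sum>c<n. \<psi> l r c * v c)"

lemma ap_0 [simp]: "ap n \<psi> l (\<lambda>c. 0) r = 0"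
  by (simp add: ap_def)

lemma ap_sum: "ap n \<psi> l (\<lambda>c. \<Sum>i\<in>I. x i * v i c) r = (\<Sum>i\<in>I. x i * ap n \<psi> l (v i) r)"
  unfolding ap_def sum_distrib_left by (subst sum.swap) (simp add: algebra_simps)

text \<open>\<open>v i\<close> is the coefficient of \<open>t^i\<close> of a polynomial vector of degree less than \<open>K\<close>
  annihilated by \<open>M0 + t M1\<close>.\<close>

definition psol :: "nat \<Rightarrow> nat \<Rightarrow> tensor3 \<Rightarrow> nat \<Rightarrow> (nat \<Rightarrow> nat \<Rightarrow> complex) \<Rightarrow> bool" where
  "psol m n \<psi> K v \<longleftrightarrow> (\<forall>i c. K \<le> i \<or> n \<le> c \<longrightarrow> v i c = 0) \<and>
     (\<forall>r<m. ap n \<psi> 0 (v 0) r = 0) \<and>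
     (\<forall>i. \<forall>r<m. ap n \<psi> 0 (v (Suc i)) r + ap n \<psi> 1 (v i) r = 0)"

text \<open>Note the shift by one: a solution of minimal degree k is one with
  \<open>psol m n \<psi> (Suc k)\<close> in the presence of
  \<open>nosol m n \<psi> k\<close>.\<close>

definition nosol :: "nat \<Rightarrow> nat \<Rightarrow> tensor3 \<Rightarrow> nat \<Rightarrow> bool" where
  "nosol m n \<psi> K \<longleftrightarrow> (\<forall>v. psol m n \<psi> K v \<longrightarrow> v = (\<lambda>i c. 0))"

lemma psol_mono: "psol m n \<psi> K v \<Longrightarrow> K \<le> L \<Longrightarrow> psol m n \<psi> L v"
  unfolding psol_def by (meson order_trans)

text \<open>A vanishing constant term makes the solution divisible by t, and the quotient is again
  annihilated by the pencil.\<close>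

lemma psol_shift:
  assumes "psol m n \<psi> (Suc K) v" "v 0 = (\<lambda>c. 0)"
  shows "psol m n \<psi> K (\<lambda>i. v (Suc i))"
  unfolding psol_def
proof (intro conjI allI impI)
  fix r assume "r < m"
  then have "ap n \<psi> 0 (v (Suc 0)) r + ap n \<psi> 1 (v 0) r = 0"
    using assms(1) unfolding psol_def by blast
  then show "ap n \<psi> 0 (v (Suc 0)) r = 0" by (simp add: assms(2))
qed (use assms(1) in \<open>auto simp: psol_def\<close>)

lemma psol_first_zero:
  assumes "psol m n \<psi> (Suc K) v" "nosol m n \<psi> K" "v 0 = (\<lambda>c. 0)"
  shows "v = (\<lambda>i c. 0)"
proof
  fix i
  have "(\<lambda>i. v (Suc i)) = (\<lambda>i c. 0)"
    using psol_shift[OF assms(1,3)] assms(2) unfolding nosol_def by blast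
  then have "v (Suc i) = (\<lambda>c. 0)" for i by meson
  then show "v i = (\<lambda>c. 0)" using assms(3) by (cases i) auto
qed

text \<open>The kernel of M0 + t M1 is closed under multiplication by polynomials in t:
  \<open>u\<close> collects the coefficients of the sum of the products q_a v_a. No degree bound is
  claimed; truncation comes later.\<close>

lemma psol_convolution:
  fixes q :: "nat \<Rightarrow> nat \<Rightarrow> complex" and d :: nat
  assumes v: "\<And>a. a < d \<Longrightarrow> psol m n \<psi> K (v a)" and r: "r < m"
  defines "u \<equiv> \<lambda>i c. \<Sum>a<d. \<Sum>j\<le>i. q a j * v a (i - j) c"
  shows "ap n \<psi> l (u i) r = (\<Sum>a<d. \<Sum>j\<le>i. q a j * ap n \<psi> l (v a (i - j)) r)"
    and "ap n \<psi> 0 (u 0) r = 0"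
    and "ap n \<psi> 0 (u (Suc i)) r + ap n \<psi> 1 (u i) r = 0"
proof -
  have u: "ap n \<psi> l (u i) r = (\<Sum>a<d. \<Sum>j\<le>i. q a j * ap n \<psi> l (v a (i - j)) r)" for l i
    using ap_sum[of n \<psi> l "\<lambda>_. 1" "\<lambda>a c. \<Sum>j\<le>i. q a j * v a (i - j) c" "{..<d}" r]
    by (simp add: u_def ap_sum)
  show "ap n \<psi> l (u i) r = (\<Sum>a<d. \<Sum>j\<le>i. q a j * ap n \<psi> l (v a (i - j)) r)" by (rule u)
  have v0: "ap n \<psi> 0 (v a 0) r = 0" and vS: "ap n \<psi> 1 (v a i) r = - ap n \<psi> 0 (v a (Suc i)) r"
    if "a < d" for a i
    using v[OF that] r unfolding psol_def by (auto simp: eq_neg_iff_add_eq_0 add.commute)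
  show "ap n \<psi> 0 (u 0) r = 0" by (simp add: u v0)
  show "ap n \<psi> 0 (u (Suc i)) r + ap n \<psi> 1 (u i) r = 0"
    by (simp add: u v0 vS[unfolded One_nat_def] Suc_diff_le sum_negf sum.distrib)
qed

text \<open>If \<open>h\<close> is the largest index with a nonzero coefficient \<open>y a h\<close>, truncating
  the combination of the \<open>v a\<close> with polynomial coefficients \<open>\<Sum>j<h. y a (h - j) t^j\<close> modulo
  \<open>t^h\<close> yields a solution of degree less than \<open>h\<close>, which must vanish.\<close>

lemma psol_image_coeffs_indep:
  fixes d :: nat
  assumes nosol: "nosol m n \<psi> k"
    and v: "\<And>a. a < d \<Longrightarrow> psol m n \<psi> (Suc k) (v a)"
    and v0: "\<And>x. (\<And>c. (\<Sum>a<d. x a * v a 0 c) = 0) \<Longrightarrow> \<forall>a<d. x a = 0"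
    and y: "\<And>r. r < m \<Longrightarrow> (\<Sum>a<d. \<Sum>i=1..k. y a i * ap n \<psi> 0 (v a i) r) = 0"
  shows "\<forall>a<d. \<forall>i\<in>{1..k}. y a i = 0"
proof (rule ccontr)
  assume neg: "\<not> ?thesis"
  define H where "H = {i \<in> {1..k}. \<exists>a<d. y a i \<noteq> 0}"
  have H: "finite H" "H \<noteq> {}" using neg by (auto simp: H_def)
  define h where "h = Max H"
  have hH: "h \<in> H" using H by (simp add: h_def)
  have h: "1 \<le> h" "h \<le> k" using hH by (auto simp: H_def)
  have above: "y a i = 0" if "a < d" "h < i" "i \<le> k" for a i
  proof (rule ccontr)
    assume "y a i \<noteq> 0"
    then have "i \<in> H" using that h by (auto simp: H_def)
    then show False using Max_ge[OF H(1)] that unfolding h_def by (meson leD)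
  qed
  define q where "q a j = (if j < h then y a (h - j) else 0)" for a j
  define u where "u = (\<lambda>i c. \<Sum>a<d. \<Sum>j\<le>i. q a j * v a (i - j) c)"
  have conv: "ap n \<psi> 0 (u i) r = (\<Sum>a<d. \<Sum>j\<le>i. q a j * ap n \<psi> 0 (v a (i - j)) r)"
    "ap n \<psi> 0 (u 0) r = 0" "ap n \<psi> 0 (u (Suc i)) r + ap n \<psi> 1 (u i) r = 0" if "r < m" for i r
    unfolding u_def using psol_convolution[where v = v and q = q and d = d, OF v that] by blast+
  \<comment> \<open>The reversed indexing in \<open>q\<close> makes the coefficient of t^h exactly
    the sum of \<open>y a i * v a i\<close> over i from 1 to h. As \<open>y\<close> vanishes above
    h, its image under M0 is the given relation.\<close>
  have uh: "ap n \<psi> 0 (u h) r = 0" if "r < m" for r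
  proof -
    have "(\<Sum>j\<le>h. q a j * ap n \<psi> 0 (v a (h - j)) r) = (\<Sum>i=1..k. y a i * ap n \<psi> 0 (v a i) r)" if "a < d" for a
    proof -
      have "(\<Sum>j\<le>h. q a j * ap n \<psi> 0 (v a (h - j)) r) = (\<Sum>j<h. y a (h - j) * ap n \<psi> 0 (v a (h - j)) r)"
        by (rule sum.mono_neutral_cong_right) (auto simp: q_def)
      also have "\<dots> = (\<Sum>i=1..h. y a i * ap n \<psi> 0 (v a i) r)"
        by (rule sum.reindex_bij_witness[of _ "\<lambda>i. h - i" "\<lambda>i. h - i"]) auto
      also have "\<dots> = (\<Sum>i=1..k. y a i * ap n \<psi> 0 (v a i) r)"
        using h above[OF that] by (intro sum.mono_neutral_left) auto
      finally show ?thesis .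
    qed
    then show ?thesis using conv(1)[OF that, of h] y[OF that] by simp
  qed
  define x where "x = (\<lambda>i c. if i < h then u i c else 0)"
  have xi: "x i = (if i < h then u i else (\<lambda>c. 0))" for i by (auto simp: x_def)
  have "psol m n \<psi> h x"
    unfolding psol_def
  proof (intro conjI allI impI)
    fix i c assume "h \<le> i \<or> n \<le> c"
    moreover have "u i c = 0" if "n \<le> c"
      using v that unfolding u_def psol_def by (intro sum.neutral ballI) auto
    ultimately show "x i c = 0" by (auto simp: x_def)
  next
    fix r assume "r < m"
    then show "ap n \<psi> 0 (x 0) r = 0" using conv(2) h by (simp add: xi)
  next
    fix i r assume "r < m"
    consider "Suc i < h" | "Suc i = h" | "h \<le> i" by linarith
    then show "ap n \<psi> 0 (x (Suc i)) r + ap n \<psi> 1 (x i) r = 0"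
    proof cases
      \<comment> \<open>This is the equation at the cut, where the discarded coefficient
        \<open>u h\<close> would enter; it survives because M0 kills \<open>u h\<close>.\<close>
      case 2
      then show ?thesis using conv(3)[OF \<open>r < m\<close>, of i] uh[OF \<open>r < m\<close>] by (auto simp: xi)
    qed (use conv(3)[OF \<open>r < m\<close>, of i] in \<open>auto simp: xi\<close>)
  qed
  then have "x = (\<lambda>i c. 0)"
    using nosol psol_mono h unfolding nosol_def by blast
  \<comment> \<open>The constant term of the truncation is the combination of the
    \<open>v a 0\<close> with coefficients \<open>y a h\<close>, so their independence contradicts
    the choice of h.\<close>
  then have "x 0 c = 0" for c by simp
  then have "(\<Sum>a<d. y a h * v a 0 c) = 0" for c
    using h by (simp add: x_def u_def q_def)
  then have "\<forall>a<d. y a h = 0" by (rule v0)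
  then show False using hH by (auto simp: H_def)
qed

text \<open>The first claim is the previous lemma in flattened indices. For the second, M0 is
  applied to a relation among all coefficients: the constant terms lie in its kernel, so the
  coefficients with i >= 1 vanish, and what remains is a relation among the
  \<open>v a 0\<close>.\<close>

lemma psol_coeffs_indep:
  fixes d :: nat
  assumes nosol: "nosol m n \<psi> k"
    and v: "\<And>a. a < d \<Longrightarrow> psol m n \<psi> (Suc k) (v a)"
    and v0: "\<And>x. (\<And>c. (\<Sum>a<d. x a * v a 0 c) = 0) \<Longrightarrow> \<forall>a<d. x a = 0"
  shows "indep m (d * k) (\<lambda>p. ap n \<psi> 0 (v (p div k) (Suc (p mod k))))"
    and "indep n (d * Suc k) (\<lambda>p. v (p div Suc k) (p mod Suc k))"
proof -
  show "indep m (d * k) (\<lambda>p. ap n \<psi> 0 (v (p div k) (Suc (p mod k))))"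
    unfolding indep_def
  proof (intro allI impI)
    fix x p
    assume x: "\<forall>r<m. (\<Sum>p<d * k. x p * ap n \<psi> 0 (v (p div k) (Suc (p mod k))) r) = 0" and p: "p < d * k"
    define y where "y a i = x (a * k + (i - 1))" for a i
    have "(\<Sum>a<d. \<Sum>i=1..k. y a i * ap n \<psi> 0 (v a i) r) = 0" if "r < m" for r
    proof -
      have "(\<Sum>i=1..k. y a i * ap n \<psi> 0 (v a i) r) = (\<Sum>i<k. x (a * k + i) * ap n \<psi> 0 (v a (Suc i)) r)" for a
        by (rule sum.reindex_bij_witness[of _ Suc "\<lambda>i. i - 1"]) (auto simp: y_def)
      then show ?thesis using x that by (simp add: sum_div_mod)
    qed
    from psol_image_coeffs_indep[OF nosol v v0 this]
    have y: "\<forall>a<d. \<forall>i\<in>{1..k}. y a i = 0" by blast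
    have "k > 0" using p by (auto intro: gr0I)
    then have "p div k < d" "Suc (p mod k) \<in> {1..k}"
      using p by (auto simp: less_mult_imp_div_less Suc_le_eq)
    then have "y (p div k) (Suc (p mod k)) = 0" using y by blast
    then show "x p = 0" by (simp add: y_def)
  qed
  show "indep n (d * Suc k) (\<lambda>p. v (p div Suc k) (p mod Suc k))"
    unfolding indep_def
  proof (intro allI impI)
    fix x p
    assume x: "\<forall>c<n. (\<Sum>p<d * Suc k. x p * v (p div Suc k) (p mod Suc k) c) = 0" and p: "p < d * Suc k"
    define y where "y a i = x (a * Suc k + i)" for a i
    have y: "(\<Sum>a<d. \<Sum>i\<le>k. y a i * v a i c) = 0" for c
    proof (cases "c < n")
      case True
      then show ?thesis
        using x by (simp add: sum_div_mod y_def lessThan_Suc_atMost del: mult_Suc_right sum.lessThan_Suc)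
    next
      case False
      then show ?thesis using v unfolding psol_def by (intro sum.neutral ballI) auto
    qed
    have split: "(\<Sum>i\<le>k. f i) = f 0 + (\<Sum>i=1..k. f i)" for f :: "nat \<Rightarrow> complex"
      by (simp add: atMost_atLeast0 sum.atLeast_Suc_atMost)
    have "(\<Sum>a<d. \<Sum>i=1..k. y a i * ap n \<psi> 0 (v a i) r) = 0" if "r < m" for r
    proof -
      have "0 = ap n \<psi> 0 (\<lambda>c. \<Sum>a<d. \<Sum>i\<le>k. y a i * v a i c) r" by (simp add: y)
      also have "\<dots> = (\<Sum>a<d. \<Sum>i\<le>k. y a i * ap n \<psi> 0 (v a i) r)"
        using ap_sum[of n \<psi> 0 "\<lambda>_. 1" "\<lambda>a c. \<Sum>i\<le>k. y a i * v a i c" "{..<d}" r]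
        by (simp add: ap_sum)
      also have "\<dots> = (\<Sum>a<d. \<Sum>i=1..k. y a i * ap n \<psi> 0 (v a i) r)"
        using v that unfolding split psol_def by simp
      finally show ?thesis by simp
    qed
    from psol_image_coeffs_indep[OF nosol v v0 this]
    have y1: "\<forall>a<d. \<forall>i\<in>{1..k}. y a i = 0" by blast
    have "(\<Sum>a<d. y a 0 * v a 0 c) = 0" for c
      using y[of c] y1 unfolding split by simp
    then have y0: "\<forall>a<d. y a 0 = 0" by (rule v0)
    have "y (p div Suc k) (p mod Suc k) = 0"
    proof (cases "p mod Suc k = 0")
      case True
      then show ?thesis using y0 p by (simp add: less_mult_imp_div_less del: mult_Suc_right)
    next
      case False
      moreover have "p mod Suc k \<le> k" by (simp add: less_Suc_eq_le[symmetric])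
      ultimately show ?thesis using y1 p by (simp add: less_mult_imp_div_less del: mult_Suc_right)
    qed
    then show "x p = 0" by (simp only: y_def div_mult_mod_eq)
  qed
qed

lemma psol_single_first_indep:
  assumes "psol m n \<psi> (Suc k) v" "nosol m n \<psi> k" "v \<noteq> (\<lambda>i c. 0)"
  obtains c where "c < n" "v 0 c \<noteq> 0"
proof -
  have "v 0 \<noteq> (\<lambda>c. 0)" using psol_first_zero assms by blast
  then obtain c where "v 0 c \<noteq> 0" by auto
  moreover have "c < n" using assms(1) calculation unfolding psol_def by (meson not_le)
  ultimately show ?thesis using that by blast
qed

text \<open>The identities M0 v_0 = 0, M1 v_i = - M0 v_(i+1) and M1 v_k = 0 show that both slices
  map the span of v_0, ..., v_k into the span of M0 v_1, ..., M0 v_k. Minimality of the degree makes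
  the dimensions exactly k + 1 and k.\<close>

lemma not_semistable_psol:
  assumes \<psi>: "\<psi> \<in> tens m n" and v: "psol m n \<psi> (Suc k) v" "v \<noteq> (\<lambda>i c. 0)" and nosol: "nosol m n \<psi> k"
    and ineq: "k * n < m * Suc k"
  shows "\<not> semistable m n \<psi>"
proof -
  obtain c0 where c0: "c0 < n" "v 0 c0 \<noteq> 0" using psol_single_first_indep[OF v(1) nosol v(2)] .
  have first: "\<forall>a<1. x a = 0" if "\<And>c. (\<Sum>a<1. x a * v 0 c) = 0" for x :: "nat \<Rightarrow> complex"
    using that[of c0] c0 by simp
  have ind: "indep m (1 * k) (\<lambda>p. ap n \<psi> 0 (v (Suc (p mod k))))" "indep n (1 * Suc k) (\<lambda>p. v (p mod Suc k))"
    using psol_coeffs_indep[where d = 1 and v = "\<lambda>_. v", OF nosol] v(1) first by blast+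
  have indep_cong: "indep N q f \<longleftrightarrow> indep N q g" if "\<And>i. i < q \<Longrightarrow> f i = g i" for N q f g
  proof -
    have "(\<Sum>i<q. x i * f i c) = (\<Sum>i<q. x i * g i c)" for x c
      using that by (intro sum.cong) auto
    then show ?thesis unfolding indep_def by simp
  qed
  have "indep m k (\<lambda>p. ap n \<psi> 0 (v (Suc p)))"
    using ind(1) by (subst (asm) indep_cong[where g = "\<lambda>p. ap n \<psi> 0 (v (Suc p))"]) auto
  then obtain W where W: "\<And>p. p < k \<Longrightarrow> W p = ap n \<psi> 0 (v (Suc p))" "indep m m W" and km: "k \<le> m"
    using indep_extend[of m k "\<lambda>p. ap n \<psi> 0 (v (Suc p))"] indep_le by metis
  have "indep n (Suc k) v"
    using ind(2) by (subst (asm) indep_cong[where g = v]) auto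
  then obtain V where V: "\<And>p. p < Suc k \<Longrightarrow> V p = v p" "indep n n V" and kn: "Suc k \<le> n"
    using indep_extend[of n "Suc k" v] indep_le by metis
  have m: "0 < m" "0 < n" using ineq kn by (auto intro: gr0I)
  define WM where "WM = mat m m (\<lambda>(r, p). W p r)"
  define VM where "VM = mat n n (\<lambda>(c, p). V p c)"
  have WM: "WM \<in> carrier_mat m m" "det WM \<noteq> 0" and VM: "VM \<in> carrier_mat n n" "det VM \<noteq> 0"
    using indep_det[OF W(2)] indep_det[OF V(2)] by (auto simp: WM_def VM_def)
  obtain WI where WI: "WI \<in> carrier_mat m m" "WI * WM = 1\<^sub>m m" "det WM * det WI = 1"
    using inverse_mat_exists[OF WM] by metis
  let ?N = "\<lambda>l. WI * slice m n \<psi> l * VM"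
  define \<phi> where "\<phi> = pencil m n (?N 0) (?N (Suc 0))"
  have "det WI \<noteq> 0" using WI(3) by auto
  then have eq: "equivalent m n \<phi> \<psi>"
    using equivalent_pencil_sandwich[OF WI(1) _ VM m slice_carrier(1) slice_carrier(1), of \<psi> 0 \<psi> "Suc 0"] pencil_slice[OF \<psi>]
    unfolding \<phi>_def by auto
  \<comment> \<open>In the completed basis \<open>V\<close>, each of the first k + 1 columns of a
    slice is zero or, up to sign, one of the first k columns of \<open>WM\<close>.\<close>
  have col: "\<exists>p<k. \<exists>s. \<forall>r<m. (slice m n \<psi> l * VM) $$ (r, c) = s * WM $$ (r, p)" 
    if "l < 2" "c \<le> k" and nz: "\<not> (\<forall>r<m. (slice m n \<psi> l * VM) $$ (r, c) = 0)" for l c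
  proof -
    have e: "(slice m n \<psi> l * VM) $$ (r, c) = ap n \<psi> l (v c) r" if "r < m" for r
      using that \<open>c \<le> k\<close> kn V(1)[of c] by (simp add: VM_def scalar_prod_def ap_def lessThan_atLeast0)
    have WMp: "WM $$ (r, p) = ap n \<psi> 0 (v (Suc p)) r" if "r < m" "p < k" for r p
      using that W(1) km by (simp add: WM_def)
    show ?thesis
    proof (cases "l = 0")
      case True
      then obtain p where p: "c = Suc p" using nz e v(1) unfolding psol_def by (cases c) auto
      then show ?thesis using e WMp True \<open>c \<le> k\<close> by (intro exI[of _ p] conjI exI[of _ 1]) auto
    next
      case False
      then have l: "l = 1" using that by auto
      have step: "ap n \<psi> 1 (v c) r = - ap n \<psi> 0 (v (Suc c)) r" if "r < m" for r
        using v(1) that unfolding psol_def by (simp add: eq_neg_iff_add_eq_0 add.commute)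
      have "c \<noteq> k"
      proof
        assume "c = k"
        then have "v (Suc c) = (\<lambda>c. 0)" using v(1) unfolding psol_def by auto
        then show False using nz e step l by auto
      qed
      then show ?thesis using e WMp l step \<open>c \<le> k\<close> by (intro exI[of _ c] conjI exI[of _ "-1"]) auto
    qed
  qed
  \<comment> \<open>Multiplication by the inverse of \<open>WM\<close> turns those columns into
    multiples of unit vectors of index below k, leaving zeros in the rows from k on.\<close>
  have zero: "?N l $$ (r, c) = 0" if "l < 2" "k \<le> r" "c \<le> k" "r < m" for l r c
  proof -
    have "?N l = WI * (slice m n \<psi> l * VM)"
      using WI VM by (intro assoc_mult_mat[of _ m m _ n _ n]) auto
    then have *: "?N l $$ (r, c) = (\<Sum>s<m. WI $$ (r, s) * (slice m n \<psi> l * VM) $$ (s, c))"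
      using that kn WI VM by (simp add: scalar_prod_def lessThan_atLeast0 del: index_mult_mat(1)) 
        (simp add: scalar_prod_def)
    show ?thesis
    proof (cases "\<forall>r<m. (slice m n \<psi> l * VM) $$ (r, c) = 0")
      case False
      then obtain p s where p: "p < k" "\<forall>r<m. (slice m n \<psi> l * VM) $$ (r, c) = s * WM $$ (r, p)"
        using col[OF \<open>l < 2\<close> \<open>c \<le> k\<close> False] by blast
      have "?N l $$ (r, c) = s * (WI * WM) $$ (r, p)"
        unfolding * using p WI(1) WM(1) that km by (simp add: scalar_prod_def lessThan_atLeast0 sum_distrib_left algebra_simps)
      then show ?thesis using WI(2) that p by simp
    qed (simp add: *)
  qed
  have "\<not> semistable m n \<phi>"
    by (rule not_semistable_zero_block[OF equivalent_tens[OF eq], of k "Suc k"])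
      (use km kn ineq zero[of 0] zero[of "Suc 0"] in \<open>auto simp: \<phi>_def pencil_def less_Suc_eq_le\<close>)
  then show ?thesis using semistable_equivalent[OF eq \<psi>] by simp
qed

text \<open>The matrix of multiplication by M0 + t M1 from vectors of degree below K to vectors of
  degree at most K: \<open>q div n\<close> is the degree in the source, \<open>p div m\<close> the
  degree in the target.\<close>

definition toeplitz :: "nat \<Rightarrow> nat \<Rightarrow> tensor3 \<Rightarrow> nat \<Rightarrow> nat \<Rightarrow> complex" where
  "toeplitz m n \<psi> p q = (if q div n = p div m then \<psi> 0 (p mod m) (q mod n) else 0) +
     (if Suc (q div n) = p div m then \<psi> 1 (p mod m) (q mod n) else 0)"

lemma psol_of_toeplitz_kernel:
  assumes x: "\<And>p. p < Suc K * m \<Longrightarrow> (\<Sum>q<K * n. toeplitz m n \<psi> p q * x q) = 0"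
  shows "psol m n \<psi> K (\<lambda>i c. if i < K \<and> c < n then x (i * n + c) else 0)"
proof -
  let ?v = "\<lambda>i c. if i < K \<and> c < n then x (i * n + c) else 0"
  \<comment> \<open>Block row s is the coefficient of t^s in the product. At s = 0 only M0
    contributes and at s = K only M1, hence the two guards.\<close>
  have row: "(if s < K then ap n \<psi> 0 (?v s) r else 0) + (if 0 < s then ap n \<psi> 1 (?v (s - 1)) r else 0) = 0"
    if "s \<le> K" "r < m" for s r
  proof -
    have "s * m + r < Suc K * m"
      using that by (metis le_imp_less_Suc mult_Suc add.commute add_less_le_mono mult_le_mono1)
    then have "0 = (\<Sum>q<K * n. toeplitz m n \<psi> (s * m + r) q * x q)" using x by simp
    also have "\<dots> = (\<Sum>i<K. \<Sum>c<n. toeplitz m n \<psi> (s * m + r) (i * n + c) * x (i * n + c))"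
      by (rule sum_div_mod)
    also have "\<dots> = (\<Sum>i<K. (if i = s then ap n \<psi> 0 (?v i) r else 0) + (if Suc i = s then ap n \<psi> 1 (?v i) r else 0))"
      using that by (intro sum.cong refl) (auto simp: toeplitz_def ap_def intro!: sum.cong)
    also have "\<dots> = (\<Sum>i<K. if i = s then ap n \<psi> 0 (?v i) r else 0) + (\<Sum>i<K. if Suc i = s then ap n \<psi> 1 (?v i) r else 0)"
      by (rule sum.distrib)
    also have "(\<Sum>i<K. if i = s then ap n \<psi> 0 (?v i) r else 0) = (if s < K then ap n \<psi> 0 (?v s) r else 0)"
      by (subst sum.delta) auto
    also have "(\<Sum>i<K. if Suc i = s then ap n \<psi> 1 (?v i) r else 0) = (if 0 < s then ap n \<psi> 1 (?v (s - 1)) r else 0)"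
    proof (cases s)
      case (Suc s')
      then have "(\<Sum>i<K. if Suc i = s then ap n \<psi> 1 (?v i) r else 0) = (\<Sum>i<K. if i = s' then ap n \<psi> 1 (?v i) r else 0)"
        by simp
      also have "\<dots> = ap n \<psi> 1 (?v s') r" using Suc that by (subst sum.delta) auto
      moreover have "s - 1 = s'" using Suc by simp
      ultimately show ?thesis using Suc by (simp only: zero_less_Suc if_True)
    qed simp
    finally show ?thesis by (rule sym)
  qed
  show ?thesis
    unfolding psol_def
  proof (intro conjI allI impI)
    fix r assume "r < m"
    then show "ap n \<psi> 0 (?v 0) r = 0" using row[of 0 r] by (cases "0 < K") auto
  next
    fix i r assume r: "r < m"
    show "ap n \<psi> 0 (?v (Suc i)) r + ap n \<psi> 1 (?v i) r = 0"
    proof (cases "Suc i \<le> K")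
      case True
      then show ?thesis using row[of "Suc i" r, unfolded diff_Suc_1] r by (cases "Suc i < K") auto
    qed auto
  qed auto
qed

text \<open>There are K n unknown coefficients, (K + 1) m Toeplitz equations and e further
  conditions on the constant term. The latter serve to separate a new solution from earlier
  ones.\<close>

lemma psol_exists:
  fixes w :: "nat \<Rightarrow> nat \<Rightarrow> complex"
  assumes "e + Suc K * m < K * n"
  obtains v where "psol m n \<psi> K v" "v \<noteq> (\<lambda>i c. 0)" "\<And>a. a < e \<Longrightarrow> (\<Sum>c<n. w a c * v 0 c) = 0"
proof -
  define A where "A p q = (if p < e then (if q < n then w p q else 0) else toeplitz m n \<psi> (p - e) q)" for p q
  obtain x i where x: "i < K * n" "x i \<noteq> 0" "\<And>p. p < e + Suc K * m \<Longrightarrow> (\<Sum>q<K * n. A p q * x q) = 0"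
    using underdetermined_system[OF assms] by metis
  define v where "v = (\<lambda>i c. if i < K \<and> c < n then x (i * n + c) else 0)"
  show ?thesis
  proof (rule that)
    show "psol m n \<psi> K v"
      unfolding v_def
    proof (rule psol_of_toeplitz_kernel)
      fix p assume "p < Suc K * m"
      then show "(\<Sum>q<K * n. toeplitz m n \<psi> p q * x q) = 0"
        using x(3)[of "e + p"] by (simp add: A_def)
    qed
    have n: "n > 0" "K > 0" using assms by (auto intro: gr0I)
    have "v (i div n) (i mod n) = x i"
      using n x(1) by (simp add: v_def less_mult_imp_div_less)
    then show "v \<noteq> (\<lambda>i c. 0)" using x(2) by metis
    fix a assume "a < e"
    then have "0 = (\<Sum>q<K * n. (if q < n then w a q else 0) * x q)" using x(3)[of a] by (simp add: A_def)
    also have "\<dots> = (\<Sum>q<n. w a q * v 0 q)"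
      using n by (intro sum.mono_neutral_cong_right) (auto simp: v_def)
    finally show "(\<Sum>c<n. w a c * v 0 c) = 0" by simp
  qed
qed

section \<open>The case m < n\<close>

lemma minimal_psol:
  assumes "psol m n \<psi> K v" "v \<noteq> (\<lambda>i c. 0)"
  obtains k v' where "psol m n \<psi> (Suc k) v'" "v' \<noteq> (\<lambda>i c. 0)" "nosol m n \<psi> k" "Suc k \<le> K"
proof -
  define P where "P j \<longleftrightarrow> (\<exists>v. psol m n \<psi> (Suc j) v \<and> v \<noteq> (\<lambda>i c. 0))" for j
  have K: "K \<noteq> 0"
    using assms unfolding psol_def by (metis ext less_eq_nat.simps(1))
  then have PK: "P (K - 1)" using assms by (auto simp: P_def)
  define k where "k = (LEAST j. P j)"
  have "P k" unfolding k_def by (rule LeastI[of P, OF PK])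
  moreover have "k \<le> K - 1" unfolding k_def by (rule Least_le[of P, OF PK])
  moreover have "nosol m n \<psi> k"
  proof (cases k)
    case 0
    then show ?thesis unfolding nosol_def psol_def by (auto simp: fun_eq_iff)
  next
    case (Suc j)
    then have "\<not> P j" using not_less_Least[of j P] by (simp add: k_def)
    then show ?thesis using Suc by (auto simp: P_def nosol_def)
  qed
  ultimately show ?thesis using that K unfolding P_def by force
qed

text \<open>Counting equations gives a solution of degree at most k = m div d, since m < (k + 1) d.
  If j is the minimal degree, semistability demands m <= j d, while j d <= k d <= m; so equality
  holds throughout and d divides m.\<close>

lemma semistable_wide_shape:
  assumes ss: "semistable m n \<psi>" and mn: "0 < m" "m < n"
  defines "d \<equiv> n - m"
  defines "k \<equiv> m div d"
  shows "m = d * k" "n = d * Suc k" "nosol m n \<psi> k"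
proof -
  have d: "0 < d" "n = m + d" using mn by (auto simp: d_def)
  have kd: "d * k \<le> m" "m < Suc k * d"
    unfolding k_def using d(1) by (simp, metis dividend_less_div_times mult_Suc add.commute)
  have "Suc (Suc k) * m < Suc k * n" using kd(2) by (simp add: d(2) algebra_simps)
  then obtain v where "psol m n \<psi> (Suc k) v" "v \<noteq> (\<lambda>i c. 0)"
    using psol_exists[of 0 "Suc k" m n] by auto
  then obtain j v' where j: "psol m n \<psi> (Suc j) v'" "v' \<noteq> (\<lambda>i c. 0)" "nosol m n \<psi> j" "j \<le> k"
    by (rule minimal_psol) auto
  have "\<not> j * n < m * Suc j"
    using not_semistable_psol[OF _ j(1-3)] ss by (auto simp: semistable_def)
  then have "m \<le> j * d" by (simp add: d(2) algebra_simps)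
  moreover have "j * d \<le> k * d" using j(4) by simp
  moreover have "k * d \<le> m" using kd(1) by (simp add: mult.commute)
  ultimately have *: "m = k * d" "j * d = k * d" by linarith+
  then have "j = k" using d(1) by simp
  then show "m = d * k" "n = d * Suc k" "nosol m n \<psi> k"
    using d j * by (auto simp: mult.commute)
qed

text \<open>The direct sum of d Kronecker blocks of size k by k + 1. In each block column i stands
  for a coefficient v_i and row j for M0 v_(j+1), which is also - M1 v_j.\<close>

definition kron_mat :: "nat \<Rightarrow> nat \<Rightarrow> nat \<Rightarrow> complex mat" where
  "kron_mat d k l = mat (d * k) (d * Suc k) (\<lambda>(r, c).
     if r div k = c div Suc k then
       if l = 0 then (if c mod Suc k = Suc (r mod k) then 1 else 0)
       else (if c mod Suc k = r mod k then -1 else 0)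
     else 0)"

definition kron_normal :: "nat \<Rightarrow> nat \<Rightarrow> tensor3" where
  "kron_normal d k = pencil (d * k) (d * Suc k) (kron_mat d k 0) (kron_mat d k (Suc 0))"

lemma kron_mat_carrier [simp]: "kron_mat d k l \<in> carrier_mat (d * k) (d * Suc k)"
  by (simp add: kron_mat_def)

lemma kron_normal_tens [simp]: "kron_normal d k \<in> tens (d * k) (d * Suc k)"
  unfolding kron_normal_def by (rule pencil_tens)

text \<open>The Toeplitz system has (k + 1) n - (k + 2) m = d more unknowns than equations, leaving
  room for up to d - 1 orthogonality conditions. By minimality a nonzero solution has a nonzero
  constant term, so the constant terms stay independent.\<close>

lemma psol_family_exists:
  assumes m: "m = d * k" and n: "n = d * Suc k" and nosol: "nosol m n \<psi> k" and "e \<le> d"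
  shows "\<exists>v. (\<forall>a<e. psol m n \<psi> (Suc k) (v a)) \<and> indep n e (\<lambda>a. v a 0)"
  using \<open>e \<le> d\<close>
proof (induction e)
  case 0
  then show ?case by (simp add: indep_def)
next
  case (Suc e)
  then obtain v where v: "\<forall>a<e. psol m n \<psi> (Suc k) (v a)" "indep n e (\<lambda>a. v a 0)" by auto
  have "e + Suc (Suc k) * m < Suc k * n" using Suc by (simp add: m n algebra_simps)
  then have "\<exists>v'. psol m n \<psi> (Suc k) v' \<and> v' \<noteq> (\<lambda>i c. 0) \<and> (\<forall>a<e. (\<Sum>c<n. cnj (v a 0 c) * v' 0 c) = 0)"
    by (rule psol_exists[where \<psi> = \<psi> and w = "\<lambda>a c. cnj (v a 0 c)"]) blast
  then obtain v' where v': "psol m n \<psi> (Suc k) v'" "v' \<noteq> (\<lambda>i c. 0)"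
    "\<And>a. a < e \<Longrightarrow> (\<Sum>c<n. cnj (v a 0 c) * v' 0 c) = 0"
    by blast
  obtain c0 where c0: "c0 < n" "v' 0 c0 \<noteq> 0"
    using psol_single_first_indep[OF v'(1) nosol v'(2)] .
  have "indep n (Suc e) ((\<lambda>a. v a 0)(e := v' 0))"
    by (rule indep_snoc[OF v(2) c0(2,1) v'(3)])
  moreover have "(\<lambda>a. v a 0)(e := v' 0) = (\<lambda>a. (v(e := v')) a 0)" by auto
  ultimately show ?case
    using v(1) v'(1) by (intro exI[of _ "v(e := v')"]) (auto simp: less_Suc_eq)
qed

lemma kron_normal_form:
  assumes m: "m = d * k" and n: "n = d * Suc k" and d: "0 < d" "0 < k"
    and nosol: "nosol m n \<psi> k" and \<psi>: "\<psi> \<in> tens m n"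
  obtains c B C where "c \<noteq> 0" "(1\<^sub>m 2, B, C) \<in> SLgrp m n"
    "\<psi> = tscale c (act m n (1\<^sub>m 2, B, C) (kron_normal d k))"
proof -
  obtain v where v: "\<forall>a<d. psol m n \<psi> (Suc k) (v a)" and v0: "indep n d (\<lambda>a. v a 0)"
    using psol_family_exists[OF m n nosol order_refl] by blast
  have v0': "\<forall>a<d. x a = 0" if "\<And>c. (\<Sum>a<d. x a * v a 0 c) = 0" for x
    using v0 that unfolding indep_def by blast
  define W where "W = mat m m (\<lambda>(r, p). ap n \<psi> 0 (v (p div k) (Suc (p mod k))) r)"
  define V where "V = mat n n (\<lambda>(c, p). v (p div Suc k) (p mod Suc k) c)"
  have ind: "indep m m (\<lambda>p. ap n \<psi> 0 (v (p div k) (Suc (p mod k))))"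
    "indep n n (\<lambda>p. v (p div Suc k) (p mod Suc k))"
    using psol_coeffs_indep[of m n \<psi> k d v, OF nosol _ v0'] v m n by blast+
  have W: "W \<in> carrier_mat m m" "det W \<noteq> 0" and V: "V \<in> carrier_mat n n" "det V \<noteq> 0"
    using indep_det[OF ind(1)] indep_det[OF ind(2)] by (auto simp: W_def V_def)
  let ?N = "kron_mat d k"
  have N: "?N l \<in> carrier_mat m n" for l using kron_mat_carrier m n by simp
  have eq: "slice m n \<psi> l * V = W * ?N l" if l: "l < 2" for l
  proof (rule eq_matI)
    fix r p assume "r < dim_row (W * ?N l)" "p < dim_col (W * ?N l)"
    then have rp: "r < m" "p < n" using W N[of l] by auto
    define a i where "a = p div Suc k" and "i = p mod Suc k"
    have a: "a < d" "i \<le> k"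
      using rp n by (auto simp: a_def i_def less_mult_imp_div_less less_Suc_eq_le[symmetric] simp del: mult_Suc_right)
    have lhs: "(slice m n \<psi> l * V) $$ (r, p) = ap n \<psi> l (v a i) r"
      using rp by (simp add: V_def scalar_prod_def ap_def lessThan_atLeast0 a_def i_def)
    have vs: "ap n \<psi> 0 (v a 0) r = 0" "ap n \<psi> 1 (v a i) r = - ap n \<psi> 0 (v a (Suc i)) r"
      using v a(1) rp(1) unfolding psol_def by (auto simp: eq_neg_iff_add_eq_0 add.commute)
    have "(W * ?N l) $$ (r, p) = (\<Sum>s<d * k. W $$ (r, s) * ?N l $$ (s, p))"
      using rp W N[of l] m by (simp add: scalar_prod_def lessThan_atLeast0)
    also have "\<dots> = (\<Sum>a'<d. \<Sum>j<k. W $$ (r, a' * k + j) * ?N l $$ (a' * k + j, p))"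
      by (rule sum_div_mod)
    also have "\<dots> = (\<Sum>a'<d. if a' = a then \<Sum>j<k. ap n \<psi> 0 (v a (Suc j)) r *
        (if l = 0 then (if i = Suc j then 1 else 0) else (if i = j then -1 else 0)) else 0)"
    proof (rule sum.cong[OF refl])
      fix a' assume a': "a' \<in> {..<d}"
      have idx: "a' * k + j < d * k" if "j < k" for j
      proof -
        have "a' * k + j < Suc a' * k" using that by simp
        also have "\<dots> \<le> d * k" using a' by (intro mult_le_mono1) auto
        finally show ?thesis .
      qed
      have "W $$ (r, a' * k + j) * ?N l $$ (a' * k + j, p) = (if a' = a then ap n \<psi> 0 (v a (Suc j)) r *
        (if l = 0 then (if i = Suc j then 1 else 0) else (if i = j then -1 else 0)) else 0)" if "j < k" for j
        using that idx[OF that] rp m n by (auto simp: W_def kron_mat_def a_def i_def)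
      then show "(\<Sum>j<k. W $$ (r, a' * k + j) * ?N l $$ (a' * k + j, p)) = (if a' = a then \<Sum>j<k. ap n \<psi> 0 (v a (Suc j)) r *
        (if l = 0 then (if i = Suc j then 1 else 0) else (if i = j then -1 else 0)) else 0)"
        by simp
    qed
    also have "\<dots> = (\<Sum>j<k. ap n \<psi> 0 (v a (Suc j)) r *
        (if l = 0 then (if i = Suc j then 1 else 0) else (if i = j then -1 else 0)))"
      using a by simp
    also have "\<dots> = ap n \<psi> l (v a i) r"
    proof (cases "l = 0")
      case True
      show ?thesis
      proof (cases i)
        case 0
        then show ?thesis using vs True by simp
      next
        case (Suc i')
        then have "(\<Sum>j<k. ap n \<psi> 0 (v a (Suc j)) r * (if l = 0 then (if i = Suc j then 1 else 0) else (if i = j then -1 else 0)))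
          = (\<Sum>j<k. if j = i' then ap n \<psi> 0 (v a (Suc j)) r else 0)"
          using True by (intro sum.cong) auto
        then show ?thesis using Suc True a by simp
      qed
    next
      case False
      then have l1: "l = 1" using l by simp
      have "(\<Sum>j<k. ap n \<psi> 0 (v a (Suc j)) r * (if l = 0 then (if i = Suc j then 1 else 0) else (if i = j then -1 else 0)))
          = (\<Sum>j<k. if j = i then - ap n \<psi> 0 (v a (Suc j)) r else 0)"
        using False by (intro sum.cong) auto
      also have "\<dots> = - ap n \<psi> 0 (v a (Suc i)) r"
      \<comment> \<open>For i = k the normal form has no entry in this column, matching the
        vanishing coefficient of t^(k+1).\<close>
      proof (cases "i < k")
        case False
        then have "v a (Suc i) = (\<lambda>c. 0)" using v a unfolding psol_def by (intro ext) auto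
        then show ?thesis using False by simp
      qed simp
      finally show ?thesis using vs l1 by simp
    qed
    finally show "(slice m n \<psi> l * V) $$ (r, p) = (W * ?N l) $$ (r, p)" using lhs by simp
  qed (use W V N[of l] in auto)
  obtain VI where VI: "VI \<in> carrier_mat n n" "V * VI = 1\<^sub>m n" "det V * det VI = 1"
    using inverse_mat_exists[OF V] by metis
  have sl: "slice m n \<psi> l = W * ?N l * VI" if "l < 2" for l
  proof -
    have "W * ?N l * VI = slice m n \<psi> l * V * VI" by (simp only: eq[OF that])
    also have "\<dots> = slice m n \<psi> l * (V * VI)"
      using V VI by (intro assoc_mult_mat[of _ m n _ n _ n]) auto
    finally show ?thesis using VI by simp
  qed
  have slN: "slice m n (kron_normal d k) 0 = ?N 0" "slice m n (kron_normal d k) (Suc 0) = ?N (Suc 0)"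
    unfolding kron_normal_def m n by (simp_all only: slice_pencil kron_mat_carrier)
  have one: "1 \<cdot>\<^sub>m ?N 0 + 0 \<cdot>\<^sub>m ?N (Suc 0) = ?N 0" "0 \<cdot>\<^sub>m ?N 0 + 1 \<cdot>\<^sub>m ?N (Suc 0) = ?N (Suc 0)"
    by (auto intro!: eq_matI simp: kron_mat_def)
  have "\<psi> = act m n (1\<^sub>m 2, W, transpose_mat VI) (kron_normal d k)"
    by (rule tens_eqI[OF \<psi> act_tens]) (use W VI sl[of 0] sl[of "Suc 0"] in \<open>simp_all add: slice_act slN one\<close>)
  moreover have GL: "(1\<^sub>m 2, W, transpose_mat VI) \<in> GLgrp m n"
    using W VI by (auto simp: GLgrp_def det_transpose)
  have "0 < m" "0 < n" using d m n by auto
  then obtain c A B C where "c \<noteq> 0" "(A, B, C) \<in> SLgrp m n" "A = 1\<^sub>m 2"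
    "\<And>\<psi>. act m n (1\<^sub>m 2, W, transpose_mat VI) \<psi> = tscale c (act m n (A, B, C) \<psi>)"
    using GL_to_SL[OF GL] by metis
  ultimately show ?thesis using that by metis
qed

section \<open>The Toeplitz determinant as an invariant\<close>

definition toeplitz_det :: "nat \<Rightarrow> nat \<Rightarrow> nat \<Rightarrow> tensor3 \<Rightarrow> complex" where
  "toeplitz_det m n N \<psi> = det (mat N N (\<lambda>(p, q). toeplitz m n \<psi> p q))"

lemma continuous_on_toeplitz_det: "continuous_on S (toeplitz_det m n N)"
proof -
  have "continuous_on S (\<lambda>\<psi>. toeplitz m n \<psi> p q)" for p q
    unfolding toeplitz_def by (cases "q div n = p div m"; cases "Suc (q div n) = p div m")
      (simp_all add: continuous_on_coord)
  then show ?thesis unfolding toeplitz_det_def[abs_def] by (intro continuous_on_det)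
qed

lemma toeplitz_det_tscale: "toeplitz_det m n N (tscale c \<psi>) = c ^ N * toeplitz_det m n N \<psi>"
proof -
  have "mat N N (\<lambda>(p, q). toeplitz m n (tscale c \<psi>) p q) = c \<cdot>\<^sub>m mat N N (\<lambda>(p, q). toeplitz m n \<psi> p q)"
    by (intro eq_matI) (auto simp: toeplitz_def tscale_def algebra_simps)
  then show ?thesis by (simp add: toeplitz_det_def)
qed

text \<open>A kernel vector of the Toeplitz matrix is a kernel vector of the pencil of degree below
  K, and the matrix is square when (K + 1) m = K n.\<close>

lemma toeplitz_det_nonzero:
  assumes "nosol m n \<psi> K" "N = Suc K * m" "N = K * n"
  shows "toeplitz_det m n N \<psi> \<noteq> 0"
proof
  let ?T = "mat N N (\<lambda>(p, q). toeplitz m n \<psi> p q)"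
  assume "toeplitz_det m n N \<psi> = 0"
  then obtain x where x: "x \<in> carrier_vec N" "x \<noteq> 0\<^sub>v N" "?T *\<^sub>v x = 0\<^sub>v N"
    using det_0_iff_vec_prod_zero_field[of ?T N] by (auto simp: toeplitz_det_def)
  have "(\<Sum>q<N. toeplitz m n \<psi> p q * x $ q) = 0" if "p < N" for p
  proof -
    have "(?T *\<^sub>v x) $ p = 0" using x(3) that by simp
    then show ?thesis using that x(1) by (simp add: scalar_prod_def lessThan_atLeast0)
  qed
  then have "psol m n \<psi> K (\<lambda>i c. if i < K \<and> c < n then x $ (i * n + c) else 0)"
    using assms(2,3) by (intro psol_of_toeplitz_kernel) simp
  then have zero: "(\<lambda>i c. if i < K \<and> c < n then x $ (i * n + c) else 0) = (\<lambda>i c. 0)"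
    using assms(1) unfolding nosol_def by blast
  have "x $ q = 0" if "q < N" for q
  proof -
    have "n > 0" using that assms(3) by (auto intro: gr0I)
    then have "q div n < K" "q mod n < n" using that assms(3) by (auto simp: less_mult_imp_div_less)
    then show ?thesis using fun_cong[OF fun_cong[OF zero, of "q div n"], of "q mod n"] by simp
  qed
  then show False using x(1,2) by (metis carrier_vecD eq_vecI index_zero_vec)
qed

definition diag_copies :: "nat \<Rightarrow> nat \<Rightarrow> complex mat \<Rightarrow> complex mat" where
  "diag_copies L m B = mat (L * m) (L * m)
     (\<lambda>(p, q). if p div m = q div m then B $$ (p mod m, q mod m) else 0)"

lemma det_diag_copies:
  assumes "B \<in> carrier_mat m m"
  shows "det (diag_copies L m B) = det B ^ L"
proof (induction L)
  case 0
  then show ?case by (simp add: diag_copies_def)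
next
  case (Suc L)
  have "diag_copies (Suc L) m B = four_block_mat (diag_copies L m B) (0\<^sub>m (L * m) m) (0\<^sub>m m (L * m)) B"
  proof (rule eq_matI, goal_cases)
    case (1 p q)
    then have pq: "p < Suc L * m" "q < Suc L * m" using assms by (auto simp: diag_copies_def)
    have split: "x div m = (if x < L * m then x div m else L) \<and> (x < L * m \<longrightarrow> x div m < L) \<and> (\<not> x < L * m \<longrightarrow> x mod m = x - L * m)"
      if "x < Suc L * m" for x
    proof (cases "x < L * m")
      case True
      then show ?thesis by (simp add: less_mult_imp_div_less)
    next
      case False
      then obtain y where y: "x = L * m + y" by (metis le_Suc_ex not_less)
      then have "y < m" using that by simp
      then show ?thesis using y by simp
    qed
    show ?case using split[OF pq(1)] split[OF pq(2)] pq assms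
      by (auto simp: diag_copies_def)
  qed (use assms in \<open>auto simp: diag_copies_def\<close>)
  then have "det (diag_copies (Suc L) m B) = det (diag_copies L m B) * det B"
    by (simp only:) (rule det_four_block_mat_lower_left_zero[of _ "L * m" _ m], use assms in \<open>auto simp: diag_copies_def\<close>)
  then show ?case using Suc by (simp add: mult.commute)
qed

text \<open>B and C act on coefficients of each degree separately, so the Toeplitz matrix is
  multiplied by block diagonal matrices on both sides. The first factor is trivial here, as it would
  mix degrees.\<close>

lemma toeplitz_det_act:
  assumes B: "B \<in> carrier_mat m m" and C: "C \<in> carrier_mat n n"
    and N: "N = L * m" "N = K * n"
  shows "toeplitz_det m n N (act m n (1\<^sub>m 2, B, C) \<psi>) = det B ^ L * det C ^ K * toeplitz_det m n N \<psi>"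
proof -
  let ?T = "\<lambda>\<psi>. mat N N (\<lambda>(p, q). toeplitz m n \<psi> p q)"
  let ?B = "diag_copies L m B" and ?C = "diag_copies K n C"
  have car: "?B \<in> carrier_mat N N" "?C \<in> carrier_mat N N"
    using N by (auto simp: diag_copies_def)
  have "?T (act m n (1\<^sub>m 2, B, C) \<psi>) = ?B * ?T \<psi> * transpose_mat ?C"
  proof (rule eq_matI, goal_cases)
    case (1 p q)
    then have pq: "p < N" "q < N" using car by auto
    define s r i c where "s = p div m" and "r = p mod m" and "i = q div n" and "c = q mod n"
    have "m > 0" "n > 0" using pq N by (auto intro: gr0I)
    then have rc: "s < L" "r < m" "i < K" "c < n"
      using pq N by (auto simp: s_def r_def i_def c_def less_mult_imp_div_less)
    have T: "toeplitz m n \<psi> (s * m + b) (i * n + c') = (if i = s then \<psi> 0 b c' else 0) + (if Suc i = s then \<psi> 1 b c' else 0)"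
      if "b < m" "c' < n" for b c'
      using that by (simp add: toeplitz_def)
    have BT: "(?B * ?T \<psi>) $$ (p, q') = (\<Sum>b<m. B $$ (r, b) * toeplitz m n \<psi> (s * m + b) q')" if "q' < N" for q'
    proof -
      have "(?B * ?T \<psi>) $$ (p, q') = (\<Sum>p'<L * m. ?B $$ (p, p') * toeplitz m n \<psi> p' q')"
        using pq that car N by (simp add: scalar_prod_def lessThan_atLeast0)
      also have "\<dots> = (\<Sum>s'<L. \<Sum>b<m. ?B $$ (p, s' * m + b) * toeplitz m n \<psi> (s' * m + b) q')"
        by (rule sum_div_mod)
      also have "\<dots> = (\<Sum>s'<L. if s' = s then (\<Sum>b<m. B $$ (r, b) * toeplitz m n \<psi> (s * m + b) q') else 0)"
      proof (rule sum.cong[OF refl])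
        fix s' assume s': "s' \<in> {..<L}"
        have "?B $$ (p, s' * m + b) = (if s' = s then B $$ (r, b) else 0)" if "b < m" for b
        proof -
          have "s' * m + b < Suc s' * m" using that by simp
          also have "\<dots> \<le> L * m" using s' by (intro mult_le_mono1) auto
          finally show ?thesis using pq N that by (auto simp: diag_copies_def s_def r_def)
        qed
        then show "(\<Sum>b<m. ?B $$ (p, s' * m + b) * toeplitz m n \<psi> (s' * m + b) q') =
          (if s' = s then (\<Sum>b<m. B $$ (r, b) * toeplitz m n \<psi> (s * m + b) q') else 0)" by simp
      qed
      finally show ?thesis using rc by simp
    qed
    have "(?B * ?T \<psi> * transpose_mat ?C) $$ (p, q) = (\<Sum>q'<K * n. (?B * ?T \<psi>) $$ (p, q') * ?C $$ (q, q'))"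
      using pq car N by (simp add: scalar_prod_def lessThan_atLeast0)
    also have "\<dots> = (\<Sum>i'<K. \<Sum>c'<n. (?B * ?T \<psi>) $$ (p, i' * n + c') * ?C $$ (q, i' * n + c'))"
      by (rule sum_div_mod)
    also have "\<dots> = (\<Sum>i'<K. if i' = i then (\<Sum>c'<n. (\<Sum>b<m. B $$ (r, b) * toeplitz m n \<psi> (s * m + b) (i * n + c')) * C $$ (c, c')) else 0)"
    proof (rule sum.cong[OF refl])
      fix i' assume i': "i' \<in> {..<K}"
      have "?C $$ (q, i' * n + c') = (if i' = i then C $$ (c, c') else 0) \<and> i' * n + c' < N" if "c' < n" for c'
      proof -
        have "i' * n + c' < Suc i' * n" using that by simp
        also have "\<dots> \<le> K * n" using i' by (intro mult_le_mono1) auto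
        finally show ?thesis using pq N(2) that by (auto simp: diag_copies_def i_def c_def)
      qed
      then show "(\<Sum>c'<n. (?B * ?T \<psi>) $$ (p, i' * n + c') * ?C $$ (q, i' * n + c')) =
        (if i' = i then (\<Sum>c'<n. (\<Sum>b<m. B $$ (r, b) * toeplitz m n \<psi> (s * m + b) (i * n + c')) * C $$ (c, c')) else 0)"
        using BT by simp
    qed
    also have "\<dots> = (\<Sum>c'<n. (\<Sum>b<m. B $$ (r, b) * ((if i = s then \<psi> 0 b c' else 0) + (if Suc i = s then \<psi> 1 b c' else 0))) * C $$ (c, c'))"
      using rc by (simp add: T)
    also have "\<dots> = (\<Sum>b<m. \<Sum>c'<n. B $$ (r, b) * C $$ (c, c') * ((if i = s then \<psi> 0 b c' else 0) + (if Suc i = s then \<psi> 1 b c' else 0)))"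
      unfolding sum_distrib_right by (subst sum.swap) (simp add: mult_ac)
    also have "\<dots> = toeplitz m n (act m n (1\<^sub>m 2, B, C) \<psi>) p q"
      using rc by (auto simp: toeplitz_def act_def numeral_2_eq_2 s_def[symmetric] r_def[symmetric] i_def[symmetric] c_def[symmetric])
    finally show ?case using pq by simp
  qed (use car in auto)
  moreover have "det (?B * ?T \<psi> * transpose_mat ?C) = det ?B * det (?T \<psi>) * det ?C"
    using car by (simp add: det_mult[of _ N] det_transpose[of _ N])
  ultimately show ?thesis
    using B C by (simp add: toeplitz_det_def det_diag_copies)
qed

section \<open>Triviality of characters of SL2\<close>

definition mat22 :: "complex \<Rightarrow> complex \<Rightarrow> complex \<Rightarrow> complex \<Rightarrow> complex mat" where
  "mat22 a b c d = mat 2 2 (\<lambda>(i, j). if i = 0 then (if j = 0 then a else b) else (if j = 0 then c else d))"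

lemma mat22_carrier [simp]: "mat22 a b c d \<in> carrier_mat 2 2"
  by (simp add: mat22_def)

lemma mat22_index [simp]: "mat22 a b c d $$ (0, 0) = a" "mat22 a b c d $$ (0, Suc 0) = b"
  "mat22 a b c d $$ (Suc 0, 0) = c" "mat22 a b c d $$ (Suc 0, Suc 0) = d"
  by (simp_all add: mat22_def)

lemma det_mat22 [simp]: "det (mat22 a b c d) = a * d - b * c"
  by (simp add: det_2x2)

lemma mat22_mult: "mat22 a b c d * mat22 a' b' c' d' =
  mat22 (a * a' + b * c') (a * b' + b * d') (c * a' + d * c') (c * b' + d * d')"
  by (intro eq_matI) (auto simp: mat22_def scalar_prod_def numeral_2_eq_2 less_Suc_eq)

lemma mat22_eta:
  assumes "A \<in> carrier_mat 2 2"
  shows "A = mat22 (A $$ (0, 0)) (A $$ (0, 1)) (A $$ (1, 0)) (A $$ (1, 1))"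
  using assms by (intro eq_matI) (auto simp: mat22_def numeral_2_eq_2 less_Suc_eq)

lemma one_mat22: "1\<^sub>m 2 = mat22 1 0 0 1"
  by (intro eq_matI) (auto simp: mat22_def numeral_2_eq_2 less_Suc_eq)

text \<open>\<open>SL\<^sub>2\<close> is generated by elementary matrices, and each of these is a commutator with
  \<open>diag(2, 1/2)\<close>.\<close>

lemma SL2_character_trivial:
  fixes \<chi> :: "complex mat \<Rightarrow> complex"
  assumes mult: "\<And>A B. A \<in> carrier_mat 2 2 \<Longrightarrow> det A = 1 \<Longrightarrow> B \<in> carrier_mat 2 2 \<Longrightarrow> det B = 1 \<Longrightarrow>
      \<chi> (A * B) = \<chi> A * \<chi> B"
    and one: "\<chi> (1\<^sub>m 2) = 1"
    and A: "A \<in> carrier_mat 2 2" "det A = 1"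
  shows "\<chi> A = 1"
proof -
  have m: "\<chi> (mat22 a b c d * mat22 a' b' c' d') = \<chi> (mat22 a b c d) * \<chi> (mat22 a' b' c' d')"
    if "a * d - b * c = 1" "a' * d' - b' * c' = 1" for a b c d a' b' c' d'
    using that by (intro mult) simp_all
  have T: "\<chi> (mat22 2 0 0 (1/2)) * \<chi> (mat22 (1/2) 0 0 2) = 1"
    using m[of 2 "1/2" 0 0 "1/2" 2 0 0] by (simp add: mat22_mult one[unfolded one_mat22])
  have E: "\<chi> (mat22 1 s 0 1) = 1" for s
  proof -
    let ?E = "\<lambda>s. \<chi> (mat22 1 s 0 1)"
    \<comment> \<open>With u = s/3, conjugation turns the parameter u into 4 u, so the elements with
      parameters 4 u and u have equal character. Their quotient has parameter 3 u = s.\<close>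
    let ?s = "s / 3"
    have "mat22 2 0 0 (1/2) * mat22 1 ?s 0 1 * mat22 (1/2) 0 0 2 = mat22 1 (4 * ?s) 0 1"
      by (simp add: mat22_mult)
    moreover have "\<chi> (mat22 2 0 0 (1/2) * mat22 1 ?s 0 1 * mat22 (1/2) 0 0 2) = \<chi> (mat22 2 0 0 (1/2)) * ?E ?s * \<chi> (mat22 (1/2) 0 0 2)"
      by (subst mult, simp_all add: m det_mult[of _ 2] mult_carrier_mat[of _ 2 2 _ 2])
    ultimately have "?E (4 * ?s) = (\<chi> (mat22 2 0 0 (1/2)) * \<chi> (mat22 (1/2) 0 0 2)) * ?E ?s"
      by (simp only: mult_ac)
    then have 1: "?E (4 * ?s) = ?E ?s" by (simp only: T mult_1)
    have 2: "?E (4 * ?s) = ?E s * ?E ?s"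
      using m[of 1 1 s 0 1 1 ?s 0] by (simp add: mat22_mult add.commute)
    have "?E ?s * ?E (- ?s) = 1"
      using m[of 1 1 ?s 0 1 1 "- ?s" 0] by (simp add: mat22_mult one[unfolded one_mat22])
    then have "?E ?s \<noteq> 0" by (metis mult_zero_left zero_neq_one)
    then show ?thesis using 1 2 by simp
  qed
  have F: "\<chi> (mat22 1 0 s 1) = 1" for s
  proof -
    let ?E = "\<lambda>s. \<chi> (mat22 1 0 s 1)"
    let ?s = "s / 3"
    have "mat22 (1/2) 0 0 2 * mat22 1 0 ?s 1 * mat22 2 0 0 (1/2) = mat22 1 0 (4 * ?s) 1"
      by (simp add: mat22_mult)
    moreover have "\<chi> (mat22 (1/2) 0 0 2 * mat22 1 0 ?s 1 * mat22 2 0 0 (1/2)) = \<chi> (mat22 (1/2) 0 0 2) * ?E ?s * \<chi> (mat22 2 0 0 (1/2))"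
      by (subst mult, simp_all add: m det_mult[of _ 2] mult_carrier_mat[of _ 2 2 _ 2])
    ultimately have "?E (4 * ?s) = (\<chi> (mat22 2 0 0 (1/2)) * \<chi> (mat22 (1/2) 0 0 2)) * ?E ?s"
      by (simp only: mult_ac)
    then have 1: "?E (4 * ?s) = ?E ?s" by (simp only: T mult_1)
    have 2: "?E (4 * ?s) = ?E s * ?E ?s"
      using m[of 1 1 0 s 1 1 0 ?s] by (simp add: mat22_mult add.commute)
    have "?E ?s * ?E (- ?s) = 1"
      using m[of 1 1 0 ?s 1 1 0 "- ?s"] by (simp add: mat22_mult one[unfolded one_mat22])
    then have "?E ?s \<noteq> 0" by (metis mult_zero_left zero_neq_one)
    then show ?thesis using 1 2 by simp
  qed
  have gen: "\<chi> (mat22 a b c d) = 1" if "c \<noteq> 0" "a * d - b * c = 1" for a b c d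
  proof -
    \<comment> \<open>These make the matrix a product of an upper, a lower and an upper elementary
      matrix.\<close>
    define x y where "x = (a - 1) / c" and "y = (d - 1) / c"
    have xy: "a = 1 + x * c" "d = c * y + 1" using that by (simp_all add: x_def y_def)
    have "b * c = (y + x * (c * y + 1)) * c" using that(2) by (simp add: xy algebra_simps)
    then have b: "b = y + x * (c * y + 1)" using that(1) by simp
    have "mat22 a b c d = mat22 1 x 0 1 * (mat22 1 0 c 1 * mat22 1 y 0 1)"
      by (simp add: mat22_mult xy b)
    also have "\<chi> \<dots> = \<chi> (mat22 1 x 0 1) * (\<chi> (mat22 1 0 c 1) * \<chi> (mat22 1 y 0 1))"
      by (subst mult, simp_all add: m det_mult[of _ 2] mult_carrier_mat[of _ 2 2 _ 2])
    finally show ?thesis by (simp only: E F mult_1)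
  qed
  define a b c d where "a = A $$ (0, 0)" and "b = A $$ (0, 1)" and "c = A $$ (1, 0)" and "d = A $$ (1, 1)"
  have A': "A = mat22 a b c d" "a * d - b * c = 1"
    using mat22_eta[OF A(1)] det_2x2[OF A(1)] A(2) by (simp_all add: a_def b_def c_def d_def)
  show ?thesis
  proof (cases "c = 0")
    case True
    then have "a \<noteq> 0" using A'(2) by auto
    \<comment> \<open>Adding the first row to the second makes the lower left entry
      \<open>a\<close>, which is nonzero since \<open>a * d = 1\<close>.\<close>
    have "\<chi> (mat22 1 0 1 1) * \<chi> A = \<chi> (mat22 a b a (b + d))"
      using m[of 1 1 0 1 a d b c] A' True by (simp add: mat22_mult)
    also have "\<dots> = 1" using \<open>a \<noteq> 0\<close> A'(2) True by (intro gen) (auto simp: algebra_simps)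
    finally show ?thesis by (simp only: F mult_1)
  next
    case False
    then show ?thesis using gen A' by simp
  qed
qed

lemma closed_orbit_wide:
  assumes mn: "0 < m" "m < n" and ss: "semistable m n \<psi>"
  shows "closed (orbit m n \<psi>)"
proof -
  define d k where "d = n - m" and "k = m div d"
  have mk: "m = d * k" and nk: "n = d * Suc k" and d: "0 < d"
    using semistable_wide_shape[OF ss mn] mn by (simp_all add: d_def k_def)
  have k: "0 < k" using mk mn by (auto intro: gr0I)
  have nosol: "nosol m n \<phi> k" if "semistable m n \<phi>" for \<phi>
    using semistable_wide_shape[OF that mn] by (simp add: d_def k_def)
  define \<nu> where "\<nu> = kron_normal d k"
  have \<nu>: "\<nu> \<in> tens m n" unfolding \<nu>_def mk nk by (rule kron_normal_tens)
  have normal: "\<exists>c B C. c \<noteq> 0 \<and> (1\<^sub>m 2, B, C) \<in> SLgrp m n \<and> \<phi> = tscale c (act m n (1\<^sub>m 2, B, C) \<nu>)"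
    if "semistable m n \<phi>" for \<phi>
    using kron_normal_form[OF mk nk d k nosol[OF that]] that unfolding \<nu>_def semistable_def by metis
  then have equiv: "equivalent m n \<phi> \<nu>" if "semistable m n \<phi>" for \<phi>
    using that unfolding equivalent_def by blast
  have ss\<nu>: "semistable m n \<nu>" using semistable_equivalent[OF equiv[OF ss] \<nu>] ss by simp
  define N where "N = Suc k * m"
  have N: "N = Suc k * m" "N = k * n" by (simp_all add: N_def mk nk algebra_simps)
  define D where "D = toeplitz_det m n N"
  have D\<nu>: "D \<nu> \<noteq> 0" unfolding D_def by (rule toeplitz_det_nonzero[OF nosol[OF ss\<nu>] N])
  have D1: "D (act m n (1\<^sub>m 2, B, C) \<phi>) = D \<phi>" if "(1\<^sub>m 2, B, C) \<in> SLgrp m n" for B C \<phi>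
    using that toeplitz_det_act[OF _ _ N] by (simp add: D_def SLgrp_def)
  have Dsc: "D (tscale c \<phi>) = c ^ N * D \<phi>" for c \<phi> by (simp add: D_def toeplitz_det_tscale)
  let ?a = "\<lambda>A. (A, 1\<^sub>m m, 1\<^sub>m n)"
  \<comment> \<open>Multiplicativity: by the normal form A' moves \<nu> to c times (1, B, C) \<nu>.
    Since (1, B, C) commutes with (A, 1, 1) and preserves \<open>D\<close>, the same factor
    \<open>c ^ N\<close> appears whether or not A is applied afterwards.\<close>
  define \<chi> where "\<chi> A = D (act m n (?a A) \<nu>) / D \<nu>" for A
  have "\<chi> A = 1" if A: "A \<in> carrier_mat 2 2" "det A = 1" for A
  proof (rule SL2_character_trivial[OF _ _ A])
    show "\<chi> (1\<^sub>m 2) = 1" using D\<nu> \<nu> by (simp add: \<chi>_def act_one)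
    fix A A' :: "complex mat" assume A: "A \<in> carrier_mat 2 2" "det A = 1" "A' \<in> carrier_mat 2 2" "det A' = (1 :: complex)"
    have "?a A' \<in> SLgrp m n" using A by (simp add: SLgrp_def)
    then have "equivalent m n (act m n (?a A') \<nu>) \<nu>"
      unfolding equivalent_def by (intro exI[of _ 1] exI[of _ "?a A'"]) simp
    then have "semistable m n (act m n (?a A') \<nu>)" using semistable_equivalent ss\<nu> \<nu> by blast
    then obtain c B C where c: "(1\<^sub>m 2, B, C) \<in> SLgrp m n" "act m n (?a A') \<nu> = tscale c (act m n (1\<^sub>m 2, B, C) \<nu>)"
      using normal by metis
    then have BC: "B \<in> carrier_mat m m" "C \<in> carrier_mat n n" by (auto simp: SLgrp_def)
    have "act m n (?a (A * A')) \<nu> = act m n (?a A) (act m n (?a A') \<nu>)" using A by (simp add: act_act)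
    also have "\<dots> = tscale c (act m n (1\<^sub>m 2, B, C) (act m n (?a A) \<nu>))"
      using A BC by (simp add: c act_tscale act_act)
    finally have "D (act m n (?a (A * A')) \<nu>) = c ^ N * D (act m n (?a A) \<nu>)"
      by (simp add: Dsc D1[OF c(1)])
    moreover have "D (act m n (?a A') \<nu>) = c ^ N * D \<nu>" by (simp add: c Dsc D1[OF c(1)])
    ultimately show "\<chi> (A * A') = \<chi> A * \<chi> A'" using D\<nu> by (simp add: \<chi>_def)
  qed
  then have D2: "D (act m n (?a A) \<nu>) = D \<nu>" if "A \<in> carrier_mat 2 2" "det A = 1" for A
    using that D\<nu> by (simp add: \<chi>_def)
  have "closed (orbit m n \<nu>)"
  proof (rule closed_orbit_criterion[OF ss\<nu> equiv _ _ D\<nu> Dsc])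
    show "continuous_on UNIV D" unfolding D_def by (rule continuous_on_toeplitz_det)
  next
    fix g assume g: "g \<in> SLgrp m n"
    obtain A B C where g': "g = (A, B, C)" by (cases g)
    then have c: "A \<in> carrier_mat 2 2" "B \<in> carrier_mat m m" "C \<in> carrier_mat n n"
      "det A = 1" "det B = 1" "det C = 1" using g by (auto simp: SLgrp_def)
    then have "act m n g \<nu> = act m n (1\<^sub>m 2, B, C) (act m n (?a A) \<nu>)" by (simp add: g' act_act)
    then show "D (act m n g \<nu>) = D \<nu>" using c by (simp add: D1 D2 SLgrp_def)
  next
    fix z :: complex assume z: "z ^ N = 1"
    then have z0: "z \<noteq> 0" using N mn k by (auto simp: power_0_left)
    \<comment> \<open>The scalars multiply to z, and their determinants are z^((k+1) m) = z^N and
      z^(-k n) = z^(-N), both 1.\<close>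
    let ?g = "(1\<^sub>m 2, z ^ Suc k \<cdot>\<^sub>m 1\<^sub>m m, inverse z ^ k \<cdot>\<^sub>m 1\<^sub>m n)"
    have "(z ^ Suc k) ^ m = 1" using z N(1) by (simp only: power_mult[symmetric])
    moreover have "(inverse z ^ k) ^ n = 1"
      using z N(2) by (simp only: power_mult[symmetric] power_inverse inverse_1)
    ultimately have "?g \<in> SLgrp m n" by (simp add: SLgrp_def)
    moreover have "act m n ?g \<nu> = tscale z \<nu>"
    proof -
      have "1 * z ^ Suc k * inverse z ^ k = z"
        using z0 by (simp add: power_inverse)
      moreover have "1 \<cdot>\<^sub>m 1\<^sub>m 2 = (1\<^sub>m 2 :: complex mat)" by (intro eq_matI) auto
      ultimately show ?thesis
        using act_smult[of "1\<^sub>m 2" "1\<^sub>m m" m "1\<^sub>m n" n 1 "z ^ Suc k" "inverse z ^ k" \<nu>]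
        by (simp only: act_one[OF \<nu>] one_carrier_mat)
    qed
    ultimately show "tscale z \<nu> \<in> orbit m n \<nu>" unfolding orbit_def by (metis image_eqI)
  qed
  then show ?thesis by (rule closed_orbit_equivalent[OF equiv[OF ss] \<nu>])
qed

section \<open>Square pencils of size at most three\<close>

text \<open>The determinant over C[t] vanishes at every point, hence is the zero polynomial. A
  kernel vector then exists over C[t] itself, and its coefficients form the solution.\<close>

lemma singular_pencil_psol:
  assumes sing: "\<And>x y. dform n \<psi> x y = 0"
  obtains K v where "psol n n \<psi> K v" "v \<noteq> (\<lambda>i c. 0)"
proof -
  define P where "P = mat n n (\<lambda>(r, c). [:\<psi> 0 r c, \<psi> (Suc 0) r c:])"
  have P: "P \<in> carrier_mat n n" by (simp add: P_def)
  have "poly (det P) t = 0" for t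
  proof -
    have "poly (det P) t = det (map_mat (\<lambda>p. poly p t) P)" by (rule comm_ring_hom.hom_det[OF poly_hom.comm_ring_hom_axioms, symmetric])
    also have "map_mat (\<lambda>p. poly p t) P = 1 \<cdot>\<^sub>m slice n n \<psi> 0 + t \<cdot>\<^sub>m slice n n \<psi> (Suc 0)"
      by (intro eq_matI) (auto simp: P_def)
    finally show ?thesis using sing[of 1 t] by (simp add: dform_def)
  qed
  then have "det P = 0" using poly_all_0_iff_0 by blast
  then obtain v where v: "v \<in> carrier_vec n" "v \<noteq> 0\<^sub>v n" "P *\<^sub>v v = 0\<^sub>v n"
    using det_0_iff_vec_prod_zero[OF P] by blast
  \<comment> \<open>A crude strict bound for the degrees of all entries.\<close>
  define K where "K = Suc (\<Sum>c<n. degree (v $ c))"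
  define u where "u i c = (if c < n then coeff (v $ c) i else 0)" for i c
  have u: "\<exists>i c. u i c \<noteq> 0"
  proof -
    obtain c where "c < n" "v $ c \<noteq> 0"
      using v(1,2) by (metis carrier_vecD eq_vecI index_zero_vec)
    then show ?thesis
      by (intro exI[of _ "degree (v $ c)"] exI[of _ c]) (simp add: u_def)
  qed
  have row: "(\<Sum>c<n. [:\<psi> 0 r c, \<psi> (Suc 0) r c:] * v $ c) = 0" if "r < n" for r
  proof -
    have "(P *\<^sub>v v) $ r = 0" using v(3) that by simp
    then show ?thesis using that v(1) by (simp add: P_def scalar_prod_def lessThan_atLeast0)
  qed
  have coeffs: "coeff ([:a, b:] * p) 0 = a * coeff p 0" "coeff ([:a, b:] * p) (Suc i) = a * coeff p (Suc i) + b * coeff p i"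
    for a b :: complex and p i by simp_all
  have "psol n n \<psi> K u"
    unfolding psol_def
  proof (intro conjI allI impI)
    fix i c assume ic: "K \<le> i \<or> n \<le> c"
    show "u i c = 0"
    proof (cases "c < n")
      case True
      then have "degree (v $ c) \<le> (\<Sum>c<n. degree (v $ c))" by (intro member_le_sum) auto
      then show ?thesis using ic True by (simp add: u_def K_def coeff_eq_0)
    qed (simp add: u_def)
  next
    fix r assume r: "r < n"
    have "coeff (\<Sum>c<n. [:\<psi> 0 r c, \<psi> (Suc 0) r c:] * v $ c) 0 = 0" by (simp only: row[OF r] coeff_0)
    then show "ap n \<psi> 0 (u 0) r = 0" unfolding coeff_sum coeffs by (simp add: ap_def u_def)
  next
    fix i r assume r: "r < n"
    have "coeff (\<Sum>c<n. [:\<psi> 0 r c, \<psi> (Suc 0) r c:] * v $ c) (Suc i) = 0" by (simp only: row[OF r] coeff_0)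
    then show "ap n \<psi> 0 (u (Suc i)) r + ap n \<psi> 1 (u i) r = 0"
      unfolding coeff_sum coeffs by (simp add: ap_def u_def sum.distrib)
  qed
  then show ?thesis using u that by (metis (no_types))
qed

text \<open>For m = n the inequality \<open>k * n < m * Suc k\<close> holds for every k, so any
  polynomial kernel vector whatsoever destabilises.\<close>

lemma semistable_dform_nonzero:
  assumes "semistable n n \<psi>" "0 < n"
  obtains x y where "dform n \<psi> x y \<noteq> 0"
proof (rule ccontr)
  assume "\<not> thesis"
  then have "dform n \<psi> x y = 0" for x y using that by blast
  then obtain K v where "psol n n \<psi> K v" "v \<noteq> (\<lambda>i c. 0)" using singular_pencil_psol by blast
  then obtain k v' where "psol n n \<psi> (Suc k) v'" "v' \<noteq> (\<lambda>i c. 0)" "nosol n n \<psi> k"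
    using minimal_psol by blast
  then have "\<not> semistable n n \<psi>"
    using assms by (intro not_semistable_psol[where k = k]) (auto simp: semistable_def)
  then show False using assms by simp
qed

text \<open>The part of the Jordan shape that is used: triangularity gives positive torus weights
  off the diagonal, and distinct eigenvalues force a diagonal matrix.\<close>

definition jordan_like :: "nat \<Rightarrow> complex mat \<Rightarrow> bool" where
  "jordan_like n T \<longleftrightarrow> T \<in> carrier_mat n n \<and>
     (\<forall>i<n. \<forall>j<n. i \<noteq> j \<longrightarrow> T $$ (i, j) \<noteq> 0 \<longrightarrow> i < j \<and> T $$ (i, i) = T $$ (j, j))"

lemma jordan_like_jordan_matrix: "jordan_like (sum_list (map fst n_as)) (jordan_matrix n_as)"
proof (induction n_as)
  case Nil
  have "jordan_matrix ([] :: (nat \<times> complex) list) \<in> carrier_mat 0 0" by (rule carrier_matI) simp_all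
  then show ?case unfolding jordan_like_def list.map sum_list.Nil by (intro conjI) simp_all
next
  case (Cons na n_as)
  obtain k a where na: "na = (k, a)" by (cases na)
  let ?N = "sum_list (map fst n_as)"
  have IH: "jordan_like ?N (jordan_matrix n_as)" by fact
  show ?case
    unfolding na jordan_like_def
  proof (intro conjI allI impI)
    show "jordan_matrix ((k, a) # n_as) \<in> carrier_mat (sum_list (map fst ((k, a) # n_as))) (sum_list (map fst ((k, a) # n_as)))"
      unfolding carrier_mat_def by simp
    fix i j assume ij: "i < sum_list (map fst ((k, a) # n_as))" "j < sum_list (map fst ((k, a) # n_as))" "i \<noteq> j"
      and nz: "jordan_matrix ((k, a) # n_as) $$ (i, j) \<noteq> 0"
    consider "i < k" "j < k" | "k \<le> i" "k \<le> j" | "i < k" "k \<le> j" | "k \<le> i" "j < k" by linarith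
    then have "i < j \<and> jordan_matrix ((k, a) # n_as) $$ (i, i) = jordan_matrix ((k, a) # n_as) $$ (j, j)"
    proof cases
      case 1
      then show ?thesis using nz ij by (auto simp: jordan_matrix_Cons split: if_splits)
    next
      case 2
      then have "i - k < ?N" "j - k < ?N" "i - k \<noteq> j - k" using ij by auto
      moreover have "jordan_matrix n_as $$ (i - k, j - k) \<noteq> 0" using nz 2 ij by (simp add: jordan_matrix_Cons)
      ultimately have "i - k < j - k \<and> jordan_matrix n_as $$ (i - k, i - k) = jordan_matrix n_as $$ (j - k, j - k)"
        using IH unfolding jordan_like_def by blast
      moreover then have "i < j" by linarith
      ultimately show ?thesis using 2 ij by (simp add: jordan_matrix_Cons)
    qed (use nz ij in \<open>simp_all add: jordan_matrix_Cons\<close>)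
    then show "i < j" "jordan_matrix ((k, a) # n_as) $$ (i, i) = jordan_matrix ((k, a) # n_as) $$ (j, j)" by auto
  qed
qed

text \<open>Some member of the pencil is invertible. It is made the first slice, multiplied away to
  the identity, and the remaining freedom is conjugation of the second slice.\<close>

lemma semistable_square_normal_form:
  assumes ss: "semistable n n \<psi>" and n: "0 < n"
  obtains T where "jordan_like n T" "equivalent n n (pencil n n (1\<^sub>m n) T) \<psi>"
proof -
  obtain x y where xy: "dform n \<psi> x y \<noteq> 0" using semistable_dform_nonzero[OF ss n] .
  let ?M = "slice n n \<psi>"
  have \<psi>: "pencil n n (?M 0) (?M (Suc 0)) = \<psi>" using ss by (simp add: semistable_def pencil_slice)
  define S0 where "S0 = x \<cdot>\<^sub>m ?M 0 + y \<cdot>\<^sub>m ?M (Suc 0)"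
  \<comment> \<open>The conjugate coefficients complete (x, y) to a matrix of determinant |x|^2 +
    |y|^2, which avoids a case distinction.\<close>
  define S1 where "S1 = (- cnj y) \<cdot>\<^sub>m ?M 0 + cnj x \<cdot>\<^sub>m ?M (Suc 0)"
  have S: "S0 \<in> carrier_mat n n" "S1 \<in> carrier_mat n n" "det S0 \<noteq> 0"
    using xy by (auto simp: S0_def S1_def dform_def)
  have "x * cnj x - y * (- cnj y) \<noteq> 0"
  proof
    assume "x * cnj x - y * (- cnj y) = 0"
    then have "of_real ((cmod x)\<^sup>2 + (cmod y)\<^sup>2) = (0 :: complex)"
      unfolding of_real_add complex_norm_square by simp
    then have "(cmod x)\<^sup>2 + (cmod y)\<^sup>2 = 0" using of_real_eq_0_iff by blast
    then have "x = 0" "y = 0" by auto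
    then have "S0 = 0 \<cdot>\<^sub>m S0" unfolding S0_def by (intro eq_matI) auto
    then have "det S0 = 0 ^ n * det S0" using S(1) by (metis carrier_matD(2) det_smult)
    then show False using S(3) n by (simp add: power_0_left)
  qed
  then have e1: "equivalent n n (pencil n n S0 S1) \<psi>"
    using equivalent_pencil_combination[OF _ n n slice_carrier(1) slice_carrier(1), of x "cnj x" y "- cnj y" \<psi> 0 \<psi> "Suc 0"] \<psi>
    by (simp add: S0_def S1_def)
  obtain SI where SI: "SI \<in> carrier_mat n n" "SI * S0 = 1\<^sub>m n" "det S0 * det SI = 1"
    using inverse_mat_exists[OF S(1,3)] by metis
  define T' where "T' = SI * S1"
  have T': "T' \<in> carrier_mat n n" using SI S by (simp add: T'_def)
  have "det SI \<noteq> 0" using SI(3) by auto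
  then have "equivalent n n (pencil n n (SI * S0 * 1\<^sub>m n) (SI * S1 * 1\<^sub>m n)) (pencil n n S0 S1)"
    using SI S n by (intro equivalent_pencil_sandwich) auto
  then have e2: "equivalent n n (pencil n n (1\<^sub>m n) T') (pencil n n S0 S1)"
    using SI S T' by (simp add: T'_def)
  obtain as where "char_poly T' = (\<Prod>a\<leftarrow>as. [:- a, 1:])" using char_poly_factorized[OF T'] by blast
  then obtain n_as where "jordan_nf T' n_as" using jordan_nf_exists[OF T'] by blast
  then have "similar_mat T' (jordan_matrix n_as)" by (simp add: jordan_nf_def)
  then obtain N P Q where PQ: "{T', jordan_matrix n_as, P, Q} \<subseteq> carrier_mat N N" "P * Q = 1\<^sub>m N" "Q * P = 1\<^sub>m N"
    "T' = P * jordan_matrix n_as * Q" using similar_matD[of T' "jordan_matrix n_as"] by blast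
  define T where "T = jordan_matrix n_as"
  have N: "N = n" using PQ(1) T' by auto
  have PQ': "P \<in> carrier_mat n n" "Q \<in> carrier_mat n n" "T \<in> carrier_mat n n" using PQ N by (auto simp: T_def)
  have "det P * det Q = 1" using det_mult[OF PQ'(1,2)] PQ(2) N by simp
  then have dPQ: "det P \<noteq> 0" "det Q \<noteq> 0" by auto
  have "equivalent n n (pencil n n (P * 1\<^sub>m n * Q) (P * T * Q)) (pencil n n (1\<^sub>m n) T)"
    using dPQ PQ' n by (intro equivalent_pencil_sandwich) auto
  then have "equivalent n n (pencil n n (1\<^sub>m n) T') (pencil n n (1\<^sub>m n) T)"
    using PQ PQ' N by (simp add: T_def)
  then have e3: "equivalent n n (pencil n n (1\<^sub>m n) T) (pencil n n (1\<^sub>m n) T')"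
    by (rule equivalent_sym) simp
  have "sum_list (map fst n_as) = n" using PQ'(3) by (auto simp: T_def)
  then have "jordan_like n T" using jordan_like_jordan_matrix[of n_as] by (simp add: T_def)
  then show ?thesis using that equivalent_trans[OF e3 equivalent_trans[OF e2 e1]] by blast
qed

text \<open>An eigenvalue of multiplicity more than \<open>n/2\<close> is moved to \<open>0\<close>; the resulting
  determinant \<open>x^h\<close> times a form of degree \<open>n - h\<close> is destabilised by \<open>diag(t, 1/t)\<close>.\<close>

lemma not_semistable_repeated_eigenvalue:
  assumes T: "jordan_like n T" and h: "n < 2 * card {i. i < n \<and> T $$ (i, i) = z}"
  shows "\<not> semistable n n (pencil n n (1\<^sub>m n) T)"
proof -
  define Z where "Z = {i. i < n \<and> T $$ (i, i) = z}"
  define h where "h = int (card Z)"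
  have Z: "finite Z" "Z \<subseteq> {..<n}" by (auto simp: Z_def)
  have hn: "int n < 2 * h" "h \<le> int n"
    using assms(2) card_mono[OF _ Z(2)] by (auto simp: h_def Z_def)
  then have n: "0 < n" by auto
  define U where "U = (- z) \<cdot>\<^sub>m 1\<^sub>m n + 1 \<cdot>\<^sub>m T"
  define \<psi> where "\<psi> = pencil n n (1 \<cdot>\<^sub>m 1\<^sub>m n + 0 \<cdot>\<^sub>m T) U"
  have Tc: "T \<in> carrier_mat n n" using T by (simp add: jordan_like_def)
  have e: "equivalent n n \<psi> (pencil n n (1\<^sub>m n) T)"
    unfolding \<psi>_def U_def using n Tc by (intro equivalent_pencil_combination) auto
  \<comment> \<open>On the nonzero diagonal entries \<alpha> and \<open>s\<close> give total weight
    at least 2 h - n > 0. The remaining parts of \<beta> and \<gamma> cancel on the diagonal and add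
    4 n (c - r) above it, which outweighs every negative contribution.\<close>
  define s where "s c = (if c \<in> Z then - 2 * (int n - h) else 2 * h)" for c
  let ?\<alpha> = "\<lambda>i :: nat. if i = 0 then int n else - int n"
  let ?\<beta> = "\<lambda>r. 2 * int n * (int n - 1 - 2 * int r)"
  let ?\<gamma> = "\<lambda>c. s c - 2 * int n * (int n - 1 - 2 * int c)"
  have lin: "(\<Sum>r<l. l' - 1 - 2 * int r) = int l * (l' - int l)" for l l'
    by (induction l) (auto simp: algebra_simps)
  have sum_s: "(\<Sum>c<n. s c) = 0"
  proof -
    have "(\<Sum>c<n. s c) = (\<Sum>c\<in>Z. - 2 * (int n - h)) + (\<Sum>c\<in>{..<n} - Z. 2 * h)"
      using Z by (subst sum.subset_diff[OF Z(2)]) (auto simp: s_def)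
    also have "\<dots> = h * (- 2 * (int n - h)) + (int n - h) * (2 * h)"
      using Z card_mono[OF _ Z(2)] by (simp add: h_def card_Diff_subset of_nat_diff)
    finally show ?thesis by (simp add: algebra_simps)
  qed
  have "\<not> semistable n n \<psi>"
  proof (rule not_semistable_torus[where \<alpha> = ?\<alpha> and \<beta> = ?\<beta> and \<gamma> = ?\<gamma>])
    show "\<psi> \<in> tens n n" by (simp add: \<psi>_def)
    have \<beta>: "(\<Sum>r<n. ?\<beta> r) = 2 * int n * (\<Sum>r<n. int n - 1 - 2 * int r)" by (rule sum_distrib_left[symmetric])
    then show "(\<Sum>r<n. ?\<beta> r) = 0" by (simp only: lin) simp
    show "(\<Sum>c<n. ?\<gamma> c) = 0" by (subst sum_subtractf) (simp only: sum_s \<beta> lin, simp)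
    fix i r c assume nz: "\<psi> i r c \<noteq> 0"
    then have i: "i < 2" "r < n" "c < n" unfolding \<psi>_def pencil_def by (auto split: if_splits)
    have sc: "- 2 * (int n - h) \<le> s c" using hn by (auto simp: s_def)
    show "0 < ?\<alpha> i + ?\<beta> r + ?\<gamma> c"
    proof (cases "r = c")
      case True
      show ?thesis
      proof (cases "i = 0")
        case True
        then show ?thesis using sc hn \<open>r = c\<close> by simp
      next
        case False
        then have "c \<notin> Z" using nz i True Tc by (auto simp: \<psi>_def pencil_def U_def Z_def)
        then show ?thesis using False True hn by (simp add: s_def)
      qed
    next
      case False
      then have i0: "i \<noteq> 0" using nz i Tc by (auto simp: \<psi>_def pencil_def split: if_splits)
      then have "T $$ (r, c) \<noteq> 0" using nz i Tc False by (auto simp: \<psi>_def pencil_def U_def)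
      then have "r < c" using T i False by (auto simp: jordan_like_def)
      then have "int n * 1 \<le> int n * (int c - int r)" by (intro mult_left_mono) auto
      moreover define X where "X = int n * (int c - int r)"
      ultimately have "int n \<le> X" by simp
      moreover have "2 * h - 2 * int n \<le> s c" using sc by (simp add: algebra_simps)
      moreover have "0 < int n" using n by simp
      ultimately have "0 < - int n + (s c + 4 * X)" using hn(1) by arith
      moreover have "?\<beta> r + ?\<gamma> c = s c + 4 * X" by (simp add: X_def algebra_simps)
      moreover have "?\<alpha> i = - int n" using i0 by simp
      ultimately show ?thesis by (simp only: add.assoc)
    qed
  qed simp
  then show ?thesis using semistable_equivalent[OF e] by simp
qed

text \<open>A repeated eigenvalue has multiplicity at least 2, and 2 > n/2 for n <= 3. So the
  eigenvalues are distinct and no off-diagonal entry survives.\<close>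

lemma semistable_small_diagonal:
  assumes ss: "semistable n n \<psi>" and n: "0 < n" "n \<le> 3"
  obtains t where "inj_on t {..<n}" "equivalent n n (pencil n n (1\<^sub>m n) (mat_diag n t)) \<psi>"
proof -
  obtain T where T: "jordan_like n T" "equivalent n n (pencil n n (1\<^sub>m n) T) \<psi>"
    using semistable_square_normal_form[OF ss n(1)] .
  have ssT: "semistable n n (pencil n n (1\<^sub>m n) T)"
    using semistable_equivalent[OF T(2)] ss by (simp add: semistable_def)
  define t where "t i = T $$ (i, i)" for i
  have inj: "inj_on t {..<n}"
  proof (rule inj_onI, rule ccontr)
    fix i j assume ij: "i \<in> {..<n}" "j \<in> {..<n}" "t i = t j" "i \<noteq> j"
    let ?Z = "{l. l < n \<and> T $$ (l, l) = t i}"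
    have "{i, j} \<subseteq> ?Z" using ij by (auto simp: t_def)
    then have "card {i, j} \<le> card ?Z" by (intro card_mono) auto
    then have "n < 2 * card ?Z" using ij n by simp
    then show False using not_semistable_repeated_eigenvalue[OF T(1)] ssT by blast
  qed
  have Tc: "T \<in> carrier_mat n n" using T by (simp add: jordan_like_def)
  have "T $$ (i, j) = 0" if "i < n" "j < n" "i \<noteq> j" for i j
    using T(1) that inj unfolding jordan_like_def inj_on_def t_def by blast
  then have "T = mat_diag n t" using Tc by (intro eq_matI) (auto simp: mat_diag_def t_def)
  then show ?thesis using that inj T(2) by blast
qed

section \<open>Diagonal pencils and scalars preserving an orbit\<close>

lemma mat_diag_smult_add: "a \<cdot>\<^sub>m mat_diag n f + b \<cdot>\<^sub>m mat_diag n g = mat_diag n (\<lambda>i. a * f i + b * g i)"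
  for a :: complex
  by (intro eq_matI) (auto simp: mat_diag_def)

lemma mat_diag_cong: "(\<And>i. i < n \<Longrightarrow> f i = g i) \<Longrightarrow> mat_diag n f = mat_diag n g"
  by (intro eq_matI) (auto simp: mat_diag_def)

lemma dform_pencil_mat_diag:
  "dform n (pencil n n (mat_diag n f) (mat_diag n g)) x y = (\<Prod>i<n. x * f i + y * g i)"
  by (simp add: dform_def slice_pencil mat_diag_smult_add det_mat_diag)

text \<open>Scaling commutes with the action. Hence generators of a group of roots of unity suffice
  when checking which scalars preserve an orbit.\<close>

lemma orbit_tscale_mult:
  assumes "tscale a \<psi> \<in> orbit m n \<psi>" "tscale b \<psi> \<in> orbit m n \<psi>"
  shows "tscale (a * b) \<psi> \<in> orbit m n \<psi>"
proof -
  obtain g h where gh: "g \<in> SLgrp m n" "tscale a \<psi> = act m n g \<psi>" "h \<in> SLgrp m n" "tscale b \<psi> = act m n h \<psi>"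
    using assms unfolding orbit_def by blast
  have "tscale (a * b) \<psi> = tscale b (act m n g \<psi>)" by (simp add: gh(2)[symmetric] mult.commute)
  also have "\<dots> = act m n g (act m n h \<psi>)" by (simp add: act_tscale[symmetric] gh(4))
  finally show ?thesis using SLgrp_mult[OF gh(1,3)] unfolding orbit_def by (metis image_eqI)
qed

lemma fourth_root_of_unity_cases:
  assumes "(z :: complex) ^ 4 = 1"
  shows "z = 1 \<or> z = -1 \<or> z = \<i> \<or> z = - \<i>"
proof -
  have "(z - 1) * (z + 1) * ((z - \<i>) * (z + \<i>)) = z ^ 4 - 1"
    by (simp add: algebra_simps power4_eq_xxxx)
  then have "z - 1 = 0 \<or> z + 1 = 0 \<or> z - \<i> = 0 \<or> z + \<i> = 0" using assms by simp
  then show ?thesis by (simp add: eq_neg_iff_add_eq_0)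
qed

lemma orbit_tscale_fourth_roots:
  assumes "\<psi> \<in> tens m n" "tscale \<i> \<psi> \<in> orbit m n \<psi>" "z ^ 4 = 1"
  shows "tscale z \<psi> \<in> orbit m n \<psi>"
proof -
  have 1: "tscale (-1) \<psi> \<in> orbit m n \<psi>" using orbit_tscale_mult[OF assms(2,2)] by simp
  then have "tscale (- \<i>) \<psi> \<in> orbit m n \<psi>" using orbit_tscale_mult[OF 1 assms(2)] by simp
  then show ?thesis
    using fourth_root_of_unity_cases[OF assms(3)] 1 assms(2) mem_orbit_self[OF assms(1)] by auto
qed

text \<open>The normal form is the GHZ tensor e0 e0 e0 + e1 e1 e1. Its invariant is Cayley's
  hyperdeterminant, obtained as the discriminant of the determinant form.\<close>

lemma closed_orbit_2:
  assumes ss: "semistable 2 2 \<psi>"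
  shows "closed (orbit 2 2 \<psi>)"
proof -
  define \<nu> where "\<nu> = pencil 2 2 (mat_diag 2 (\<lambda>i. if i = 0 then 1 else 0)) (mat_diag 2 (\<lambda>i. if i = 0 then 0 else 1))"
  have \<nu>: "\<nu> \<in> tens 2 2" by (simp add: \<nu>_def)
  have equiv: "equivalent 2 2 \<phi> \<nu>" if ss\<phi>: "semistable 2 2 \<phi>" for \<phi>
  proof -
    obtain t where t: "inj_on t {..<2}" and e: "equivalent 2 2 (pencil 2 2 (1\<^sub>m 2) (mat_diag 2 t)) \<phi>"
      using semistable_small_diagonal[OF ss\<phi>] by auto
    have \<phi>: "\<phi> \<in> tens 2 2" using ss\<phi> by (simp add: semistable_def)
    define \<delta> where "\<delta> = t 0 - t 1"
    have \<delta>: "\<delta> \<noteq> 0" using inj_on_eq_iff[OF t, of 0 1] by (simp add: \<delta>_def)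
    have t0: "t 0 = \<delta> + t 1" by (simp add: \<delta>_def)
    let ?T = "mat_diag 2 t"
    \<comment> \<open>The two combinations are the Lagrange interpolation polynomials at t 0 and t
      1, evaluated at the diagonal matrix; they give the coordinate projections.\<close>
    have "(- t 1 / \<delta>) * (- 1 / \<delta>) - (1 / \<delta>) * (t 0 / \<delta>) = - 1 / \<delta>"
      using \<delta> by (simp add: t0 field_simps)
    then have "equivalent 2 2 (pencil 2 2 ((- t 1 / \<delta>) \<cdot>\<^sub>m 1\<^sub>m 2 + (1 / \<delta>) \<cdot>\<^sub>m ?T) ((t 0 / \<delta>) \<cdot>\<^sub>m 1\<^sub>m 2 + (- 1 / \<delta>) \<cdot>\<^sub>m ?T)) (pencil 2 2 (1\<^sub>m 2) ?T)"
      using \<delta> by (intro equivalent_pencil_combination) auto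
    also have "pencil 2 2 ((- t 1 / \<delta>) \<cdot>\<^sub>m 1\<^sub>m 2 + (1 / \<delta>) \<cdot>\<^sub>m ?T) ((t 0 / \<delta>) \<cdot>\<^sub>m 1\<^sub>m 2 + (- 1 / \<delta>) \<cdot>\<^sub>m ?T) = \<nu>"
      unfolding \<nu>_def mat_diag_one[symmetric] mat_diag_smult_add
      using \<delta> by (intro arg_cong2[of _ _ _ _ "pencil 2 2"] mat_diag_cong) (auto simp: numeral_2_eq_2 less_Suc_eq t0 field_simps)
    finally show ?thesis using equivalent_sym[OF equivalent_trans[OF _ e] \<phi>] by blast
  qed
  have ss\<nu>: "semistable 2 2 \<nu>" using semistable_equivalent[OF equiv[OF ss] \<nu>] ss by simp
  have F\<nu>: "dform 2 \<nu> x y = x * y" for x y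
    unfolding \<nu>_def dform_pencil_mat_diag by (simp add: numeral_2_eq_2)
  \<comment> \<open>The first bracket recovers the coefficient of x y from values of the
    form.\<close>
  define D where "D \<phi> = (dform 2 \<phi> 1 1 - dform 2 \<phi> 1 0 - dform 2 \<phi> 0 1)\<^sup>2 - 4 * dform 2 \<phi> 1 0 * dform 2 \<phi> 0 1" for \<phi>
  have D\<nu>: "D \<nu> = 1" by (simp add: D_def F\<nu>)
  have "closed (orbit 2 2 \<nu>)"
  proof (rule closed_orbit_criterion[OF ss\<nu> equiv, where D = D and N = 4])
    show "continuous_on UNIV D"
      unfolding D_def[abs_def] by (intro continuous_intros continuous_on_dform)
    show "D \<nu> \<noteq> 0" by (simp add: D\<nu>)
    show "D (tscale c \<phi>) = c ^ 4 * D \<phi>" for c \<phi>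
      unfolding D_def dform_tscale by (simp add: algebra_simps power2_eq_square power4_eq_xxxx)
  next
    fix g assume g: "g \<in> SLgrp 2 2"
    obtain A B C where g': "g = (A, B, C)" by (cases g)
    then have c: "A \<in> carrier_mat 2 2" "B \<in> carrier_mat 2 2" "C \<in> carrier_mat 2 2"
      "det A = 1" "det B = 1" "det C = 1" using g by (auto simp: SLgrp_def)
    define p q r s where "p = A $$ (0, 0)" and "q = A $$ (0, 1)" and "r = A $$ (1, 0)" and "s = A $$ (1, 1)"
    have det: "p * s - q * r = 1" using det_2x2[OF c(1)] c(4) by (simp add: p_def q_def r_def s_def)
    have F: "dform 2 (act 2 2 g \<nu>) x y = (x * p + y * r) * (x * q + y * s)" for x y
      using c by (simp only: g' dform_act F\<nu> p_def q_def r_def s_def) simp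
    have "D (act 2 2 g \<nu>) = (p * s - q * r)\<^sup>2"
      unfolding D_def F by (simp add: algebra_simps power2_eq_square)
    then show "D (act 2 2 g \<nu>) = D \<nu>" using det D\<nu> by simp
  next
    fix z :: complex assume z: "z ^ 4 = 1"
    \<comment> \<open>The factor \<i> gives the swap determinant 1. Swapping in all three tensor
      factors fixes \<nu> and leaves \<i>^3 = - \<i>.\<close>
    let ?P = "mat22 0 \<i> \<i> 0"
    have P: "(?P, ?P, ?P) \<in> SLgrp 2 2" by (simp add: SLgrp_def)
    have act: "act 2 2 (?P, ?P, ?P) \<nu> = tscale (- \<i>) \<nu>"
      by (intro ext) (auto simp: act_def tscale_def \<nu>_def pencil_def mat_diag_def mat22_def numeral_2_eq_2 less_Suc_eq)
    have "tscale (- \<i>) \<nu> \<in> orbit 2 2 \<nu>" using P act unfolding orbit_def by (metis image_eqI)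
    from orbit_tscale_mult[OF orbit_tscale_mult[OF this this] this]
    have "tscale \<i> \<nu> \<in> orbit 2 2 \<nu>" by simp
    then show "tscale z \<nu> \<in> orbit 2 2 \<nu>" by (rule orbit_tscale_fourth_roots[OF \<nu> _ z])
  qed
  then show ?thesis by (rule closed_orbit_equivalent[OF equiv[OF ss] \<nu>])
qed

text \<open>These are the coefficients of x y (x + y) after a linear substitution. The discriminant
  of a quadratic times a linear form is the discriminant of the quadratic times the squared
  resultant, here with exponents 2 and 4.\<close>

lemma cubic_discriminant_product:
  fixes p q r s :: complex
  defines "a \<equiv> p * q * (p + q)" and "d \<equiv> r * s * (r + s)"
  defines "b \<equiv> p * q * (r + s) + (p * s + r * q) * (p + q)" and "c \<equiv> r * s * (p + q) + (p * s + r * q) * (r + s)"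
  shows "b^2 * c^2 - 4 * a * c^3 - 4 * b^3 * d - 27 * a^2 * d^2 + 18 * a * b * c * d = (p * s - q * r) ^ 6"
proof -
  define A B C D E where "A = p * q" and "B = p * s + r * q" and "C = r * s" and "D = p + q" and "E = r + s"
  have "a = A * D" "b = A * E + B * D" "c = C * D + B * E" "d = C * E"
    by (simp_all add: a_def b_def c_def d_def A_def B_def C_def D_def E_def)
  then have "b^2 * c^2 - 4 * a * c^3 - 4 * b^3 * d - 27 * a^2 * d^2 + 18 * a * b * c * d
    = (B^2 - 4 * A * C) * (A * E^2 - B * D * E + C * D^2)^2"
    by (simp add: algebra_simps power2_eq_square power3_eq_cube)
  moreover have "B^2 - 4 * A * C = (p * s - q * r)^2"
    unfolding A_def B_def C_def by (simp add: algebra_simps power2_eq_square power3_eq_cube power4_eq_xxxx)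
  moreover have "A * E^2 - B * D * E + C * D^2 = - ((p * s - q * r)^2)"
    unfolding A_def B_def C_def D_def E_def by (simp add: algebra_simps power2_eq_square power3_eq_cube power4_eq_xxxx)
  ultimately show ?thesis by (simp flip: power_mult power_add)
qed

lemma closed_orbit_3:
  assumes ss: "semistable 3 3 \<psi>"
  shows "closed (orbit 3 3 \<psi>)"
proof -
  have less3: "i < 3 \<longleftrightarrow> i = 0 \<or> i = 1 \<or> i = 2" for i :: nat by auto
  define f where "f i = (if i = (1 :: nat) then 0 else 1 :: complex)" for i
  define g where "g i = (if i = (0 :: nat) then 0 else 1 :: complex)" for i
  define \<nu> where "\<nu> = pencil 3 3 (mat_diag 3 f) (mat_diag 3 g)"
  have \<nu>: "\<nu> \<in> tens 3 3" by (simp add: \<nu>_def)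
  have equiv: "equivalent 3 3 \<phi> \<nu>" if ss\<phi>: "semistable 3 3 \<phi>" for \<phi>
  proof -
    obtain t where t: "inj_on t {..<3}" and e: "equivalent 3 3 (pencil 3 3 (1\<^sub>m 3) (mat_diag 3 t)) \<phi>"
      using semistable_small_diagonal[OF ss\<phi>] by auto
    have \<phi>: "\<phi> \<in> tens 3 3" using ss\<phi> by (simp add: semistable_def)
    have tne: "t 0 \<noteq> t 1" "t 0 \<noteq> t 2" "t 1 \<noteq> t 2" using inj_on_eq_iff[OF t, of 0 1] inj_on_eq_iff[OF t, of 0 2] inj_on_eq_iff[OF t, of 1 2] by simp_all
    \<comment> \<open>The multiples of T - t 1 and T - t 0 are scaled so that both take the value 1
      at index 2.\<close>
    define p q where "p = 1 / (t 2 - t 1)" and "q = 1 / (t 2 - t 0)"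
    have pq: "p \<noteq> 0" "q \<noteq> 0" "p * (t 2 - t 1) = 1" "q * (t 2 - t 0) = 1" using tne by (auto simp: p_def q_def)
    let ?T = "mat_diag 3 t"
    have "(- p * t 1) * q - p * (- q * t 0) = p * q * (t 0 - t 1)" by (simp add: algebra_simps)
    then have "equivalent 3 3 (pencil 3 3 ((- p * t 1) \<cdot>\<^sub>m 1\<^sub>m 3 + p \<cdot>\<^sub>m ?T) ((- q * t 0) \<cdot>\<^sub>m 1\<^sub>m 3 + q \<cdot>\<^sub>m ?T)) (pencil 3 3 (1\<^sub>m 3) ?T)"
      using pq tne by (intro equivalent_pencil_combination) auto
    then have e1: "equivalent 3 3 (pencil 3 3 (mat_diag 3 (\<lambda>i. p * (t i - t 1))) (mat_diag 3 (\<lambda>i. q * (t i - t 0)))) (pencil 3 3 (1\<^sub>m 3) ?T)"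
      unfolding mat_diag_one[symmetric] mat_diag_smult_add by (simp add: algebra_simps)
    \<comment> \<open>Rescaling rows 0 and 1 turns the one remaining nonzero value at each of these
      indices into 1.\<close>
    define b where "b i = (if i = 0 then 1 / (p * (t 0 - t 1)) else if i = (1 :: nat) then 1 / (q * (t 1 - t 0)) else 1)" for i
    let ?M0 = "mat_diag 3 (\<lambda>i. p * (t i - t 1))" and ?M1 = "mat_diag 3 (\<lambda>i. q * (t i - t 0))"
    have "equivalent 3 3 (pencil 3 3 (mat_diag 3 b * ?M0 * 1\<^sub>m 3) (mat_diag 3 b * ?M1 * 1\<^sub>m 3)) (pencil 3 3 ?M0 ?M1)"
      using pq tne by (intro equivalent_pencil_sandwich) (auto simp: det_mat_diag b_def)
    also have "mat_diag 3 b * ?M0 * 1\<^sub>m 3 = mat_diag 3 f"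
      unfolding mat_diag_one[symmetric] mat_diag_diag
      using pq tne by (intro mat_diag_cong) (auto simp: less3 b_def f_def)
    also have "mat_diag 3 b * ?M1 * 1\<^sub>m 3 = mat_diag 3 g"
      unfolding mat_diag_one[symmetric] mat_diag_diag
      using pq tne by (intro mat_diag_cong) (auto simp: less3 b_def g_def)
    finally have "equivalent 3 3 \<nu> \<phi>" using equivalent_trans e1 e unfolding \<nu>_def by blast
    then show ?thesis by (rule equivalent_sym[OF _ \<phi>])
  qed
  have ss\<nu>: "semistable 3 3 \<nu>" using semistable_equivalent[OF equiv[OF ss] \<nu>] ss by simp
  have F\<nu>: "dform 3 \<nu> x y = x * y * (x + y)" for x y
    unfolding \<nu>_def dform_pencil_mat_diag by (simp add: numeral_3_eq_3 f_def g_def)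
  \<comment> \<open>The cubic discriminant, with the middle coefficients recovered from values at
    (1, 1) and (1, -1): half the difference is b + d, half the sum is a + c. It has degree 4 in the
    coefficients, hence 12 in the tensor.\<close>
  define D where "D \<phi> = (let a = dform 3 \<phi> 1 0; d = dform 3 \<phi> 0 1; e = dform 3 \<phi> 1 1; e' = dform 3 \<phi> 1 (-1);
      b = (e - e') / 2 - d; c = (e + e') / 2 - a in
      b^2 * c^2 - 4 * a * c^3 - 4 * b^3 * d - 27 * a^2 * d^2 + 18 * a * b * c * d)" for \<phi>
  have DF: "D \<phi> = (p * s - q * r) ^ 6"
    if F: "\<And>x y. dform 3 \<phi> x y = (x * p + y * r) * (x * q + y * s) * ((x * p + y * r) + (x * q + y * s))" for \<phi> p q r s
  proof -
    have b: "(dform 3 \<phi> 1 1 - dform 3 \<phi> 1 (-1)) / 2 - r * s * (r + s) = p * q * (r + s) + (p * s + r * q) * (p + q)"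
      and c: "(dform 3 \<phi> 1 1 + dform 3 \<phi> 1 (-1)) / 2 - p * q * (p + q) = r * s * (p + q) + (p * s + r * q) * (r + s)"
      and ad: "dform 3 \<phi> 1 0 = p * q * (p + q)" "dform 3 \<phi> 0 1 = r * s * (r + s)"
      unfolding F by (simp_all add: field_simps)
    show ?thesis unfolding D_def Let_def ad b c by (rule cubic_discriminant_product)
  qed
  have D\<nu>: "D \<nu> = 1" using DF[of \<nu> 1 0 0 1] F\<nu> by simp
  have "closed (orbit 3 3 \<nu>)"
  proof (rule closed_orbit_criterion[OF ss\<nu> equiv, where D = D and N = 12])
    show "continuous_on UNIV D"
      unfolding D_def[abs_def] Let_def by (intro continuous_intros continuous_on_dform) auto
    show "D \<nu> \<noteq> 0" by (simp add: D\<nu>)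
    show "D (tscale c \<phi>) = c ^ 12 * D \<phi>" for c \<phi>
    proof -
      have e: "(c ^ 3 * u - c ^ 3 * v) / 2 - c ^ 3 * w = c ^ 3 * ((u - v) / 2 - w)"
        "(c ^ 3 * u + c ^ 3 * v) / 2 - c ^ 3 * w = c ^ 3 * ((u + v) / 2 - w)" for u v w
        by (simp_all add: field_simps)
      have "(k * b)^2 * (k * c)^2 - 4 * (k * a) * (k * c)^3 - 4 * (k * b)^3 * (k * d) - 27 * (k * a)^2 * (k * d)^2 + 18 * (k * a) * (k * b) * (k * c) * (k * d)
        = k ^ 4 * (b^2 * c^2 - 4 * a * c^3 - 4 * b^3 * d - 27 * a^2 * d^2 + 18 * a * b * c * d)" for k a b c d :: complex
        by (simp add: algebra_simps power2_eq_square power3_eq_cube power4_eq_xxxx)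
      then show ?thesis unfolding D_def Let_def dform_tscale e by (simp flip: power_mult)
    qed
  next
    fix h assume h: "h \<in> SLgrp 3 3"
    obtain A B C where h': "h = (A, B, C)" by (cases h)
    then have c: "A \<in> carrier_mat 2 2" "B \<in> carrier_mat 3 3" "C \<in> carrier_mat 3 3"
      "det A = 1" "det B = 1" "det C = 1" using h by (auto simp: SLgrp_def)
    have "D (act 3 3 h \<nu>) = (A $$ (0, 0) * A $$ (1, 1) - A $$ (0, 1) * A $$ (1, 0)) ^ 6"
      using c by (intro DF) (simp only: h' dform_act F\<nu>, simp)
    then show "D (act 3 3 h \<nu>) = D \<nu>" using D\<nu> c(4) det_2x2[OF c(1)] by simp
  next
    fix z :: complex assume z: "z ^ 12 = 1"
    have cube: "tscale w \<nu> \<in> orbit 3 3 \<nu>" if w: "w ^ 3 = 1" for w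
    proof -
      have "(1\<^sub>m 2, w \<cdot>\<^sub>m 1\<^sub>m 3, 1\<^sub>m 3) \<in> SLgrp 3 3" using w by (simp add: SLgrp_def)
      moreover have "act 3 3 (1\<^sub>m 2, w \<cdot>\<^sub>m 1\<^sub>m 3, 1\<^sub>m 3) \<nu> = tscale w \<nu>"
      proof -
        have "1 \<cdot>\<^sub>m 1\<^sub>m l = (1\<^sub>m l :: complex mat)" for l by (intro eq_matI) auto
        then show ?thesis
          using act_smult[of "1\<^sub>m 2" "1\<^sub>m 3" 3 "1\<^sub>m 3" 3 1 w 1 \<nu>] by (simp add: act_one[OF \<nu>])
      qed
      ultimately show ?thesis unfolding orbit_def by (metis image_eqI)
    qed
    \<comment> \<open>A signed exchange of indices 0 and 1 with determinant 1. Acting on both sides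
      of a diagonal matrix its sign cancels, so together with the exchange of slices only the factor
      \<i> remains.\<close>
    define R where "R = four_block_mat (mat22 0 (-1) 1 0) (0\<^sub>m 2 1) (0\<^sub>m 1 2) (1\<^sub>m 1)"
    have R: "R \<in> carrier_mat 3 3"
      unfolding R_def using four_block_carrier_mat[of "mat22 0 (-1) 1 0" 2 2 "1\<^sub>m 1" 1 1] by simp
    have Rij: "R $$ (i, j) = (if (i, j) = (0, 1) then -1 else if (i, j) = (1, 0) \<or> (i, j) = (2, 2) then 1 else 0)"
      if "i < 3" "j < 3" for i j
      using that unfolding less3 by (auto simp: mat22_def R_def)
    have "det R = det (mat22 0 (-1) 1 0) * det (1\<^sub>m 1 :: complex mat)"
      unfolding R_def by (rule det_four_block_mat_lower_left_zero[of _ 2 _ 1]) auto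
    then have "(mat22 0 \<i> \<i> 0, R, R) \<in> SLgrp 3 3" using R by (simp add: SLgrp_def)
    moreover have "act 3 3 (mat22 0 \<i> \<i> 0, R, R) \<nu> = tscale \<i> \<nu>"
    proof (rule tens_eqI[OF act_tens tscale_tens[OF \<nu>]])
      have RR: "R * mat_diag 3 k * transpose_mat R = mat_diag 3 (\<lambda>i. if i = 0 then k 1 else if i = 1 then k 0 else k i)" for k
      proof (rule eq_matI, goal_cases)
        case (1 i j)
        then have ij: "i = 0 \<or> i = 1 \<or> i = 2" "j = 0 \<or> j = 1 \<or> j = 2" by (auto simp: mat_diag_def)
        have "(R * mat_diag 3 k * transpose_mat R) $$ (i, j) = (\<Sum>c<3. R $$ (i, c) * k c * R $$ (j, c))"
          using ij R R[THEN carrier_matD(1)] R[THEN carrier_matD(2)]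
          by (subst mat_diag_mult_right[OF R]) (auto simp: scalar_prod_def lessThan_atLeast0)
        also have "\<dots> = mat_diag 3 (\<lambda>i. if i = 0 then k 1 else if i = 1 then k 0 else k i) $$ (i, j)"
          using ij by (auto simp: Rij mat_diag_def eval_nat_numeral)
        finally show ?case .
      qed (use R in \<open>auto simp: mat_diag_def\<close>)
      have sl: "slice 3 3 \<nu> 0 = mat_diag 3 f" "slice 3 3 \<nu> (Suc 0) = mat_diag 3 g"
        unfolding \<nu>_def by (simp_all add: slice_pencil)
      have slt: "slice 3 3 (tscale \<i> \<nu>) l = \<i> \<cdot>\<^sub>m slice 3 3 \<nu> l" for l
        by (intro eq_matI) (auto simp: tscale_def)
      show "slice 3 3 (act 3 3 (mat22 0 \<i> \<i> 0, R, R) \<nu>) 0 = slice 3 3 (tscale \<i> \<nu>) 0"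
        using R by (simp add: slice_act slt sl mat_diag_smult_add RR) (auto intro!: eq_matI simp: mat_diag_def f_def g_def)
      show "slice 3 3 (act 3 3 (mat22 0 \<i> \<i> 0, R, R) \<nu>) (Suc 0) = slice 3 3 (tscale \<i> \<nu>) (Suc 0)"
        using R by (simp add: slice_act slt sl mat_diag_smult_add RR) (auto intro!: eq_matI simp: mat_diag_def f_def g_def)
    qed
    ultimately have i: "tscale \<i> \<nu> \<in> orbit 3 3 \<nu>" unfolding orbit_def by (metis image_eqI)
    \<comment> \<open>A twelfth root of unity is split as z = z^9 z^4, a fourth root times a cube
      root of unity.\<close>
    have z9: "(z ^ 9) ^ 4 = (z ^ 12) ^ 3" "(z ^ 4) ^ 3 = z ^ 12" "z ^ 9 * z ^ 4 = z ^ 12 * z"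
      by (simp_all flip: power_mult power_add power_Suc2)
    have "tscale (z ^ 9) \<nu> \<in> orbit 3 3 \<nu>" using z9 z by (intro orbit_tscale_fourth_roots[OF \<nu> i]) (simp only: power_one)
    moreover have "tscale (z ^ 4) \<nu> \<in> orbit 3 3 \<nu>" using z9 z by (intro cube) (simp only:)
    ultimately have "tscale (z ^ 9 * z ^ 4) \<nu> \<in> orbit 3 3 \<nu>" by (rule orbit_tscale_mult)
    then show "tscale z \<nu> \<in> orbit 3 3 \<nu>" using z9 z by simp
  qed
  then show ?thesis by (rule closed_orbit_equivalent[OF equiv[OF ss] \<nu>])
qed

section \<open>Strictly semistable square pencils\<close>

text \<open>The superdiagonal carries y in the block with diagonal x and vice versa, so it is
  nonzero exactly at the root where that diagonal vanishes. For odd n a single entry x + y is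
  appended.\<close>

definition witness_entry :: "nat \<Rightarrow> complex \<Rightarrow> complex \<Rightarrow> nat \<Rightarrow> nat \<Rightarrow> complex" where
  "witness_entry k x y r c =
     (if r = c then (if r < k then x else if r < 2 * k then y else x + y)
      else if Suc r = c then (if c < k then y else if k \<le> r \<and> c < 2 * k then x else 0)
      else 0)"

text \<open>A pencil with determinant \<open>x^k y^k (x + y)^(n - 2k)\<close>, \<open>k = n div 2\<close>, and a single Jordan
  block for each of the roots \<open>x = 0\<close> and \<open>y = 0\<close>.\<close>

definition witness :: "nat \<Rightarrow> tensor3" where
  "witness n = pencil n n (mat n n (\<lambda>(r, c). witness_entry (n div 2) 1 0 r c))
     (mat n n (\<lambda>(r, c). witness_entry (n div 2) 0 1 r c))"

lemma witness_entry_linear: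
  "x * witness_entry k 1 0 r c + y * witness_entry k 0 1 r c = witness_entry k x y r c"
  by (auto simp: witness_entry_def)

lemma witness_slices:
  "x \<cdot>\<^sub>m slice n n (witness n) 0 + y \<cdot>\<^sub>m slice n n (witness n) (Suc 0)
    = mat n n (\<lambda>(r, c). witness_entry (n div 2) x y r c)"
  by (intro eq_matI) (auto simp: witness_def slice_pencil witness_entry_linear)

lemma witness_tens: "witness n \<in> tens n n"
  by (simp add: witness_def)

lemma dform_witness:
  "dform n (witness n) x y = x ^ (n div 2) * y ^ (n div 2) * (x + y) ^ (n - 2 * (n div 2))"
proof -
  let ?k = "n div 2"
  let ?M = "mat n n (\<lambda>(r, c). witness_entry ?k x y r c)"
  let ?d = "\<lambda>i. if i < ?k then x else if i < 2 * ?k then y else x + y"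
  have "dform n (witness n) x y = prod_list (diag_mat ?M)"
    unfolding dform_def witness_slices
    by (rule det_upper_triangular[of _ n]) (auto simp: witness_entry_def)
  also have "\<dots> = (\<Prod>i = 0..<n. ?d i)"
    unfolding prod_list_diag_prod by (simp add: witness_entry_def)
  also have "\<dots> = (\<Prod>i = 0..<?k. ?d i) * (\<Prod>i = ?k..<2 * ?k. ?d i) * (\<Prod>i = 2 * ?k..<n. ?d i)"
    using prod.atLeastLessThan_concat[of 0 ?k "2 * ?k" ?d] prod.atLeastLessThan_concat[of 0 "2 * ?k" n ?d]
    by simp
  also have "\<dots> = x ^ ?k * y ^ ?k * (x + y) ^ (n - 2 * ?k)"
  proof -
    have "(\<Prod>i = 0..<?k. ?d i) = (\<Prod>i = 0..<?k. x)" "(\<Prod>i = ?k..<2 * ?k. ?d i) = (\<Prod>i = ?k..<2 * ?k. y)"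
      "(\<Prod>i = 2 * ?k..<n. ?d i) = (\<Prod>i = 2 * ?k..<n. x + y)"
      by (intro prod.cong; auto)+
    then show ?thesis by (simp only: prod_constant card_atLeastLessThan) simp
  qed
  finally show ?thesis .
qed

text \<open>A linear form is small relative to its coefficients at no more than one of the four
  points \<open>(1, 0)\<close>, \<open>(0, 1)\<close>, \<open>(1, 1)\<close>, \<open>(1, -1)\<close>, so three forms leave a common good point.\<close>

lemma common_good_point:
  fixes p q :: "nat \<Rightarrow> complex"
  defines "good \<equiv> \<lambda>i x y. max (cmod (p i)) (cmod (q i)) \<le> 2 * cmod (x * p i + y * q i)"
  obtains x y where "(x, y) \<in> {(1, 0), (0, 1), (1, 1), (1, -1)}" "good 0 x y" "good 1 x y" "good 2 x y"
proof -
  have pair: "good i 1 0 \<or> good i 0 1" "good i 1 0 \<or> good i 1 1" "good i 1 0 \<or> good i 1 (-1)"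
    "good i 0 1 \<or> good i 1 1" "good i 0 1 \<or> good i 1 (-1)" "good i 1 1 \<or> good i 1 (-1)" for i
  proof -
    have "cmod (p i) \<le> cmod (p i + q i) + cmod (q i)" "cmod (q i) \<le> cmod (p i + q i) + cmod (p i)"
      "cmod (p i) \<le> cmod (p i - q i) + cmod (q i)" "cmod (q i) \<le> cmod (p i - q i) + cmod (p i)"
      using norm_triangle_ineq4[of "p i + q i" "q i"] norm_triangle_ineq4[of "p i + q i" "p i"]
        norm_triangle_ineq[of "p i - q i" "q i"] norm_triangle_ineq4[of "p i" "p i - q i"] by simp_all
    moreover have "2 * cmod (p i) \<le> cmod (p i + q i) + cmod (p i - q i)" "2 * cmod (q i) \<le> cmod (p i + q i) + cmod (p i - q i)"
      using norm_triangle_ineq[of "p i + q i" "p i - q i"] norm_triangle_ineq4[of "p i + q i" "p i - q i"]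
      by (simp_all add: norm_mult flip: mult_2)
    moreover have "0 \<le> cmod (p i)" "0 \<le> cmod (q i)" by simp_all
    ultimately show "good i 1 0 \<or> good i 0 1" "good i 1 0 \<or> good i 1 1" "good i 1 0 \<or> good i 1 (-1)"
      "good i 0 1 \<or> good i 1 1" "good i 0 1 \<or> good i 1 (-1)" "good i 1 1 \<or> good i 1 (-1)"
      unfolding good_def by (auto simp: max_def)
  qed
  have "(good 0 1 0 \<and> good 1 1 0 \<and> good 2 1 0) \<or> (good 0 0 1 \<and> good 1 0 1 \<and> good 2 0 1) \<or>
    (good 0 1 1 \<and> good 1 1 1 \<and> good 2 1 1) \<or> (good 0 1 (-1) \<and> good 1 1 (-1) \<and> good 2 1 (-1))"
    using pair[of 0] pair[of 1] pair[of 2] by argo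
  then show ?thesis using that by blast
qed

text \<open>The form is a product of powers of linear forms with pairwise determinants 1 up to sign,
  so no two can be small together at a common good point. That point depends on the group element;
  summing over all four candidates gives one bound for the whole orbit.\<close>

lemma dform_witness_orbit_bound:
  assumes g: "g \<in> SLgrp n n" and n: "2 \<le> n"
  shows "(1 / 8) ^ Suc (n div 2) \<le> cmod (dform n (act n n g (witness n)) 1 0) + cmod (dform n (act n n g (witness n)) 0 1)
    + cmod (dform n (act n n g (witness n)) 1 1) + cmod (dform n (act n n g (witness n)) 1 (-1))"
proof -
  define k where "k = n div 2"
  obtain A B C where g': "g = (A, B, C)" by (cases g)
  then have c: "A \<in> carrier_mat 2 2" "B \<in> carrier_mat n n" "C \<in> carrier_mat n n"
    "det A = 1" "det B = 1" "det C = 1" using g by (auto simp: SLgrp_def)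
  define p q where "p i = (if i = 0 then A $$ (0, 0) else if i = (1 :: nat) then A $$ (0, 1) else A $$ (0, 0) + A $$ (0, 1))"
    and "q i = (if i = 0 then A $$ (1, 0) else if i = (1 :: nat) then A $$ (1, 1) else A $$ (1, 0) + A $$ (1, 1))" for i
  have d: "p 0 * q 1 - p 1 * q 0 = 1" "p 0 * q 2 - p 2 * q 0 = 1" "p 2 * q 1 - p 1 * q 2 = 1"
    using det_2x2[OF c(1)] c(4) by (simp_all add: p_def q_def algebra_simps)
  let ?l = "\<lambda>i x y. x * p i + y * q i"
  have F: "dform n (act n n g (witness n)) x y = ?l 0 x y ^ k * ?l 1 x y ^ k * ?l 2 x y ^ (n - 2 * k)" for x y
    using c by (simp add: g' dform_act dform_witness k_def p_def q_def algebra_simps)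
  obtain x y where xy: "(x, y) \<in> {(1, 0), (0, 1), (1, 1), (1, -1 :: complex)}"
    and good: "max (cmod (p 0)) (cmod (q 0)) \<le> 2 * cmod (?l 0 x y)" "max (cmod (p 1)) (cmod (q 1)) \<le> 2 * cmod (?l 1 x y)"
      "max (cmod (p 2)) (cmod (q 2)) \<le> 2 * cmod (?l 2 x y)"
    using common_good_point by blast
  define u where "u i = cmod (?l i x y)" for i
  have u: "cmod (p i) \<le> 2 * u i" "cmod (q i) \<le> 2 * u i" "0 \<le> u i" if "i \<in> {0, 1, 2}" for i
    using good that by (auto simp: u_def)
  \<comment> \<open>Each coefficient is at most twice the value of its form, so the determinant 1 is
    at most 8 times the product of the two values.\<close>
  have pair: "1 / 8 \<le> u i * u j" if "i \<in> {0, 1, 2}" "j \<in> {0, 1, 2}" "p i * q j - p j * q i = 1" for i j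
  proof -
    have "1 = cmod (p i * q j - p j * q i)" using that by simp
    also have "\<dots> \<le> cmod (p i) * cmod (q j) + cmod (p j) * cmod (q i)"
      using norm_triangle_ineq4[of "p i * q j" "p j * q i"] by (simp add: norm_mult)
    also have "\<dots> \<le> (2 * u i) * (2 * u j) + (2 * u j) * (2 * u i)"
      using u[OF that(1)] u[OF that(2)] by (intro add_mono mult_mono) auto
    finally show ?thesis by simp
  qed
  have u01: "1 / 8 \<le> u 0 * u 1" and u02: "1 / 8 \<le> u 0 * u 2" and u21: "1 / 8 \<le> u 2 * u 1"
    using pair d by auto
  have u0: "0 \<le> u i" for i by (simp add: u_def)
  have "(1 / 8) ^ Suc k \<le> u 0 ^ k * u 1 ^ k * u 2 ^ (n - 2 * k)"
  proof (cases "n = 2 * k")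
    case True
    have "(1 / 8 :: real) ^ Suc k \<le> (1 / 8) ^ k" by (intro power_decreasing) auto
    also have "\<dots> \<le> (u 0 * u 1) ^ k" using u01 by (intro power_mono) auto
    finally show ?thesis using True by (simp add: power_mult_distrib)
  next
    case False
    then have n1: "n - 2 * k = 1" unfolding k_def by presburger
    obtain k' where k': "k = Suc k'" using n by (cases k) (auto simp: k_def)
    \<comment> \<open>For odd n one pair is completed to the product of all three values, whose
      square is the product of the three pair bounds; (1/8)^3 is relaxed to (1/8)^4 to have a
      rational square root.\<close>
    have "((1 / 8)\<^sup>2)\<^sup>2 \<le> (1 / 8) * (1 / 8) * (1 / 8 :: real)" by (simp add: power2_eq_square)
    also have "\<dots> \<le> (u 0 * u 1) * (u 0 * u 2) * (u 2 * u 1)"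
      using u01 u02 u21 u0 by (intro mult_mono) auto
    also have "\<dots> = (u 0 * u 1 * u 2)\<^sup>2" by (simp add: power2_eq_square algebra_simps)
    finally have 3: "(1 / 8)\<^sup>2 \<le> u 0 * u 1 * u 2"
      by (rule power2_le_imp_le) (use u0 in auto)
    have "(1 / 8 :: real) ^ Suc k = (1 / 8) ^ k' * (1 / 8)\<^sup>2" by (simp add: k' power2_eq_square)
    also have "\<dots> \<le> (u 0 * u 1) ^ k' * (u 0 * u 1 * u 2)"
      using 3 u01 u0 by (intro mult_mono power_mono) auto
    also have "\<dots> = u 0 ^ k * u 1 ^ k * u 2 ^ (n - 2 * k)"
      by (simp only: n1) (simp add: k' power_mult_distrib algebra_simps)
    finally show ?thesis .
  qed
  then have bound: "(1 / 8) ^ Suc k \<le> cmod (dform n (act n n g (witness n)) x y)"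
    unfolding F by (simp only: norm_mult norm_power u_def)
  let ?F = "\<lambda>x y. cmod (dform n (act n n g (witness n)) x y)"
  have "?F x y \<le> ?F 1 0 + ?F 0 1 + ?F 1 1 + ?F 1 (-1)"
    using xy norm_ge_zero[of "dform n (act n n g (witness n)) 1 0"] norm_ge_zero[of "dform n (act n n g (witness n)) 0 1"]
      norm_ge_zero[of "dform n (act n n g (witness n)) 1 1"] norm_ge_zero[of "dform n (act n n g (witness n)) 1 (-1)"]
    by auto
  then show ?thesis using bound unfolding k_def by linarith
qed

lemma witness_semistable:
  assumes n: "2 \<le> n"
  shows "semistable n n (witness n)"
proof -
  let ?F = "\<lambda>\<phi> x y. cmod (dform n \<phi> x y)"
  let ?S = "{\<phi>. (1 / 8) ^ Suc (n div 2) \<le> ?F \<phi> 1 0 + ?F \<phi> 0 1 + ?F \<phi> 1 1 + ?F \<phi> 1 (-1)}"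
  have "closed ?S"
    by (intro closed_Collect_le continuous_intros continuous_on_dform)
  moreover have "orbit n n (witness n) \<subseteq> ?S"
    unfolding orbit_def using dform_witness_orbit_bound[OF _ n] by blast
  ultimately have "closure (orbit n n (witness n)) \<subseteq> ?S" by (intro closure_minimal)
  moreover have "(\<lambda>i j k. 0) \<notin> ?S"
  proof -
    have "dform n (\<lambda>i j k. 0) x y = 0" for x y
      using dform_tscale[of n 0 "witness n" x y] n by (simp add: tscale_def power_0_left)
    then show ?thesis by (simp add: not_le)
  qed
  ultimately show ?thesis using witness_tens by (auto simp: semistable_alt)
qed

lemma witness_row:
  assumes "r < n" "2 * k \<le> n"
  shows "(\<Sum>c<n. witness_entry k a b r c * v c) =
    (if r < k then a else if r < 2 * k then b else a + b) * v r +
    (if Suc r < k then b else if k \<le> r \<and> Suc r < 2 * k then a else 0) * v (Suc r)"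
proof -
  let ?d = "if r < k then a else if r < 2 * k then b else a + b"
  let ?e = "if Suc r < k then b else if k \<le> r \<and> Suc r < 2 * k then a else 0"
  have "(\<Sum>c<n. witness_entry k a b r c * v c) = (\<Sum>c<n. (if c = r then ?d * v r else 0) + (if c = Suc r then ?e * v (Suc r) else 0))"
    by (intro sum.cong refl) (auto simp: witness_entry_def)
  also have "\<dots> = ?d * v r + (if Suc r < n then ?e * v (Suc r) else 0)"
    using assms by (simp only: sum.distrib sum.delta finite_lessThan lessThan_iff if_True)
  also have "\<dots> = ?d * v r + ?e * v (Suc r)" using assms by auto
  finally show ?thesis .
qed

text \<open>Every nonzero member of the pencil has a kernel of dimension at most one.\<close>

lemma witness_kernel:
  assumes n: "2 \<le> n" and k: "k = n div 2" and ab: "a \<noteq> 0 \<or> b \<noteq> 0"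
  shows "\<exists>s<n. \<forall>v. (\<forall>r<n. (\<Sum>c<n. witness_entry k a b r c * v c) = 0) \<longrightarrow> v s = 0 \<longrightarrow> (\<forall>c<n. v c = 0)"
proof -
  have kn: "2 * k \<le> n" "0 < k" "n \<le> Suc (2 * k)" using n k by auto
  consider "a = 0" "b \<noteq> 0" | "a \<noteq> 0" "b = 0" | "a \<noteq> 0" "b \<noteq> 0" using ab by blast
  then show ?thesis
  proof cases
    \<comment> \<open>The block with diagonal x becomes nilpotent with kernel spanned by the unit
      vector of index 0, and everything else is invertible. The next case is symmetric, with index
      k.\<close>
    case 1
    show ?thesis
    proof (intro exI[of _ 0] conjI allI impI)
      fix v :: "nat \<Rightarrow> complex" and c
      assume v: "\<forall>r<n. (\<Sum>c<n. witness_entry k a b r c * v c) = 0" "v 0 = 0" "c < n"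
      have row: "(if r < k then a else if r < 2 * k then b else a + b) * v r +
        (if Suc r < k then b else if k \<le> r \<and> Suc r < 2 * k then a else 0) * v (Suc r) = 0" if "r < n" for r
        using v(1)[rule_format, OF that] witness_row[OF that kn(1)] by simp
      show "v c = 0"
      proof (cases "c < k")
        case True
        show ?thesis
        proof (cases c)
          case 0
          then show ?thesis using v by simp
        next
          case (Suc r)
          then show ?thesis using row[of r] 1 True v(3) by simp
        qed
      next
        case False
        then show ?thesis using row[of c] 1 v(3) by (auto split: if_splits)
      qed
    qed (use n in simp)
  next
    case 2
    show ?thesis
    proof (intro exI[of _ k] conjI allI impI)
      fix v :: "nat \<Rightarrow> complex" and c
      assume v: "\<forall>r<n. (\<Sum>c<n. witness_entry k a b r c * v c) = 0" "v k = 0" "c < n"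
      have row: "(if r < k then a else if r < 2 * k then b else a + b) * v r +
        (if Suc r < k then b else if k \<le> r \<and> Suc r < 2 * k then a else 0) * v (Suc r) = 0" if "r < n" for r
        using v(1)[rule_format, OF that] witness_row[OF that kn(1)] by simp
      consider "c < k" | "c = k" | "k < c" "c < 2 * k" | "2 * k \<le> c" by linarith
      then show "v c = 0"
      proof cases
        case 3
        then obtain r where "c = Suc r" "k \<le> r" by (cases c) auto
        then show ?thesis using row[of r] 2 3 v(3) by simp
      qed (use row[of c] 2 v(2,3) kn in \<open>auto split: if_splits\<close>)
    qed (use kn in simp)
  next
    \<comment> \<open>Only the last diagonal entry can vanish, namely a + b for odd n, so back
      substitution starts from index n - 1.\<close>
    case 3
    show ?thesis
    proof (intro exI[of _ "n - 1"] conjI allI impI)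
      fix v :: "nat \<Rightarrow> complex" and c
      assume v: "\<forall>r<n. (\<Sum>c<n. witness_entry k a b r c * v c) = 0" "v (n - 1) = 0" "c < n"
      have row: "(if r < k then a else if r < 2 * k then b else a + b) * v r +
        (if Suc r < k then b else if k \<le> r \<and> Suc r < 2 * k then a else 0) * v (Suc r) = 0" if "r < n" for r
        using v(1)[rule_format, OF that] witness_row[OF that kn(1)] by simp
      have "v (n - Suc j) = 0" if "j < n" for j
        using that
      proof (induction j)
        case 0
        then show ?case using v(2) by simp
      next
        case (Suc j)
        then have S: "Suc (n - Suc (Suc j)) = n - Suc j" and lt: "n - Suc (Suc j) < 2 * k" "n - Suc (Suc j) < n"
          using kn by auto
        have "v (Suc (n - Suc (Suc j))) = 0" unfolding S using Suc by simp
        then show ?case using row[OF lt(2)] 3 lt(1) by (auto split: if_splits)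
      qed
      from this[of "n - Suc c"] show "v c = 0" using v(3) by simp
    qed (use n in simp)
  qed
qed

text \<open>If the diagonal limit lay in the orbit, its second slice would be equivalent to a
  nonzero member of the pencil, whose kernel has dimension at most one. The limit slice has a kernel
  of dimension at least k >= 2.\<close>

lemma witness_orbit_not_closed:
  assumes n: "4 \<le> n"
  shows "\<not> closed (orbit n n (witness n))"
proof
  assume closed: "closed (orbit n n (witness n))"
  define k where "k = n div 2"
  have k2: "2 \<le> k" "2 * k \<le> n" using n by (auto simp: k_def)
  \<comment> \<open>With opposite weights on rows and columns the total weight is 2 (c - r): zero on
    the diagonal and positive on the superdiagonal.\<close>
  define \<beta> where "\<beta> r = int n - 1 - 2 * int r" for r
  define \<psi> where "\<psi> = (\<lambda>i r c. if (\<lambda>_. 0) i + \<beta> r + (- \<beta> c) = 0 then witness n i r c else 0)"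
  have sum: "(\<Sum>r<n. \<beta> r) = 0"
  proof -
    have "(\<Sum>r<l. l' - 1 - 2 * int r) = int l * (l' - int l)" for l l'
      by (induction l) (auto simp: algebra_simps)
    then show ?thesis by (simp only: \<beta>_def) simp
  qed
  have "\<psi> \<in> closure (orbit n n (witness n))"
    unfolding \<psi>_def
  proof (rule torus_limit[OF witness_tens])
    show "(\<Sum>r<n. \<beta> r) = 0" "(\<Sum>c<n. - \<beta> c) = 0" using sum by (simp_all add: sum_negf)
    fix i r c assume "witness n i r c \<noteq> 0"
    then have "c = r \<or> c = Suc r"
      unfolding witness_def pencil_def by (auto simp: witness_entry_def split: if_splits)
    then show "0 \<le> 0 + \<beta> r + - \<beta> c" by (auto simp: \<beta>_def)
  qed simp
  then have "\<psi> \<in> orbit n n (witness n)" using closed by (simp add: closure_closed)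
  then obtain A B C where g: "(A, B, C) \<in> SLgrp n n" "\<psi> = act n n (A, B, C) (witness n)"
    unfolding orbit_def by auto
  then have c: "A \<in> carrier_mat 2 2" "B \<in> carrier_mat n n" "C \<in> carrier_mat n n"
    "det A = 1" "det B = 1" "det C = 1" by (auto simp: SLgrp_def)
  define a b where "a = A $$ (Suc 0, 0)" and "b = A $$ (Suc 0, Suc 0)"
  have "a \<noteq> 0 \<or> b \<noteq> 0" using det_2x2[OF c(1)] c(4) by (auto simp: a_def b_def)
  then obtain s where s: "s < n"
    "\<forall>v. (\<forall>r<n. (\<Sum>c<n. witness_entry k a b r c * v c) = 0) \<longrightarrow> v s = 0 \<longrightarrow> (\<forall>c<n. v c = 0)"
    using witness_kernel[OF _ k_def, of a b] n by auto
  define X where "X = mat n n (\<lambda>(r, c). witness_entry k a b r c)"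
  have X: "X \<in> carrier_mat n n" by (simp add: X_def)
  have sl: "slice n n \<psi> (Suc 0) = B * X * transpose_mat C"
    using c unfolding g(2) X_def k_def by (simp add: slice_act witness_slices a_def b_def)
  obtain BI where BI: "BI \<in> carrier_mat n n" "BI * B = 1\<^sub>m n"
    using inverse_mat_exists[OF c(2)] c(5) by auto
  have XC: "X * transpose_mat C = BI * slice n n \<psi> (Suc 0)"
  proof -
    have "BI * (B * X * transpose_mat C) = (BI * B) * X * transpose_mat C"
      using BI c X assoc_mult_mat[of BI n n "B * X" n "transpose_mat C" n] assoc_mult_mat[of BI n n B n X n] by simp
    then show ?thesis using BI X by (simp add: sl)
  qed
  \<comment> \<open>The first k diagonal entries of the second slice vanish, and k >= 2; this is
    where n >= 4 enters.\<close>
  have col0: "slice n n \<psi> (Suc 0) $$ (r, j) = 0" if "r < n" "j < 2" for r j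
  proof -
    have "\<psi> (Suc 0) r j = 0"
      using that k2 by (auto simp: \<psi>_def \<beta>_def witness_def pencil_def witness_entry_def k_def)
    then show ?thesis using that n by simp
  qed
  have XC0: "(\<Sum>c<n. witness_entry k a b r c * C $$ (j, c)) = 0" if "r < n" "j < 2" for r j
  proof -
    have "(X * transpose_mat C) $$ (r, j) = 0"
      unfolding XC using that n BI col0 by (simp add: scalar_prod_def)
    then show ?thesis using that n c by (simp add: X_def scalar_prod_def lessThan_atLeast0)
  qed
  \<comment> \<open>Rows 0 and 1 of \<open>C\<close> lie in the kernel of \<open>X\<close>. This
    combination of them vanishes at coordinate \<open>s\<close>, hence everywhere.\<close>
  define w where "w c = C $$ (1, s) * C $$ (0, c) - C $$ (0, s) * C $$ (1, c)" for c
  have w: "w c = 0" if "c < n" for c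
  proof (rule s(2)[rule_format, OF _ _ that])
    fix r assume "r < n"
    have "(\<Sum>c<n. witness_entry k a b r c * w c) = C $$ (1, s) * (\<Sum>c<n. witness_entry k a b r c * C $$ (0, c))
      - C $$ (0, s) * (\<Sum>c<n. witness_entry k a b r c * C $$ (1, c))"
      by (simp add: w_def sum_distrib_left sum_subtractf algebra_simps)
    then show "(\<Sum>c<n. witness_entry k a b r c * w c) = 0" using XC0[OF \<open>r < n\<close>] by simp
  qed (simp add: w_def)
  obtain CI where CI: "CI \<in> carrier_mat n n" "C * CI = 1\<^sub>m n"
    using inverse_mat_exists[OF c(3)] c(6) by auto
  have comb: "(\<Sum>c<n. C $$ (i, c) * CI $$ (c, j)) = (if i = j then 1 else 0)" if "i < n" "j < n" for i j
  proof -
    have "(C * CI) $$ (i, j) = (if i = j then 1 else 0)" using CI that by simp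
    then show ?thesis using CI(1) c(3) that by (simp add: scalar_prod_def lessThan_atLeast0)
  qed
  have "0 = (\<Sum>c<n. w c * CI $$ (c, j))" for j using w by simp
  also have "(\<Sum>c<n. w c * CI $$ (c, j)) = C $$ (1, s) * (\<Sum>c<n. C $$ (0, c) * CI $$ (c, j)) - C $$ (0, s) * (\<Sum>c<n. C $$ (1, c) * CI $$ (c, j))" for j
    by (simp add: w_def sum_distrib_left sum_subtractf algebra_simps)
  finally have "C $$ (1, s) * (\<Sum>c<n. C $$ (0, c) * CI $$ (c, j)) = C $$ (0, s) * (\<Sum>c<n. C $$ (1, c) * CI $$ (c, j))" for j
    by simp
  \<comment> \<open>By independence of the rows of \<open>C\<close> the coefficients of the
    combination vanish. Then row 0 itself is a kernel vector vanishing at \<open>s\<close>, hence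
    zero, which is impossible in an invertible matrix.\<close>
  from this[of 1] have "C $$ (0, s) = 0" using n by (simp add: comb)
  have "C $$ (0, c) = 0" if "c < n" for c
  proof (rule s(2)[rule_format, OF _ _ that])
    show "(\<Sum>c<n. witness_entry k a b r c * C $$ (0, c)) = 0" if "r < n" for r
      by (rule XC0[OF that]) simp
    show "C $$ (0, s) = 0" by fact
  qed
  then have "(\<Sum>c<n. C $$ (0, c) * CI $$ (c, 0)) = 0" by simp
  then show False using comb[of 0 0] n by simp
qed

theorem theorem3:
  fixes m n :: nat
  assumes "2 \<le> m" and "m \<le> n"
  shows "(\<exists>\<psi> \<in> tens m n. \<psi> \<noteq> (\<lambda>i j k. 0) \<and> strictly_semistable m n \<psi>)
           \<longleftrightarrow> (m = n \<and> 4 \<le> n)"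
proof
  assume "\<exists>\<psi> \<in> tens m n. \<psi> \<noteq> (\<lambda>i j k. 0) \<and> strictly_semistable m n \<psi>"
  then obtain \<psi> where \<psi>: "semistable m n \<psi>" "\<not> closed (orbit m n \<psi>)"
    by (auto simp: strictly_semistable_def polystable_def)
  show "m = n \<and> 4 \<le> n"
  proof (rule ccontr)
    assume "\<not> (m = n \<and> 4 \<le> n)"
    then consider "m < n" | "m = 2" "n = 2" | "m = 3" "n = 3" using assms by linarith
    then show False
      using \<psi> assms closed_orbit_wide closed_orbit_2 closed_orbit_3 by cases auto
  qed
next
  assume mn: "m = n \<and> 4 \<le> n"
  then have ss: "semistable n n (witness n)" by (intro witness_semistable) simp
  have "witness n \<noteq> (\<lambda>i j k. 0)"
  proof
    assume "witness n = (\<lambda>i j k. 0)"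
    then have "(\<lambda>i j k. 0) \<in> closure (orbit n n (witness n))"
      using mem_orbit_self[OF witness_tens, of n] closure_subset by fastforce
    then show False using ss by (simp add: semistable_alt)
  qed
  then show "\<exists>\<psi> \<in> tens m n. \<psi> \<noteq> (\<lambda>i j k. 0) \<and> strictly_semistable m n \<psi>"
    using mn ss witness_orbit_not_closed[of n] witness_tens
    by (intro bexI[of _ "witness n"]) (auto simp: strictly_semistable_def polystable_def)
qed

end
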